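(* Let $X$ be an L-embedded Banach space (real or complex) and let $(x_n)_{n\in\mathbb{N}}$ be a sequence in $X$ that is equivalent to the canonical basis of $\ell^1$. Then there is a sequence $(x_n^* )_{n\in\mathbb{N}}$ in the dual $X^*$ that generates $\ell^\infty$ isometrically, more precisely $$\Bigl\|\sum_{n}\alpha_n x_n^*\Bigr\| = \sup_n|\alpha_n| \quad\text{for all } (\alpha_n)\in \ell^\infty$$ (where the series is understood in the weak$^*$-topology of $X^*$), and there is a strictly increasing sequence $(p_n)_{n\in\mathbb{N}}$ in $\mathbb{N}$ such that $$\lim_{n\to\infty} |x_n^*(x_{p_n})| = \tilde{c}_J(x_m)$$ and $$x_n^*(x_{p_l}) = 0 \quad\text{whenever } l<n,$$ where $\tilde{c}_J(x_m)$ denotes the constant $\tilde c_J$ of the whole sequence $(x_m)_{m\in\mathbb{N}}$. In particular, the dual of every non-reflexive L-embedded Banach space contains an isometric copy of $\ell^\infty$.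
   Context: Banach spaces are real or complex, and $\mathbb{N}$ starts at $1$. A (linear) projection $P$ on a Banach space $Z$ is called an L-projection if $\|Pz\|+\|z-Pz\|=\|z\|$ for all $z\in Z$. A Banach space $X$ is called L-embedded if (canonically embedded in its bidual $X^{**}$) it is the image of an L-projection on $X^{**}$. A sequence $(x_n)$ in $X$ is equivalent to the canonical basis of $\ell^1$ if there are constants $0<a\le b$ with $a\sum|\alpha_n|\le\|\sum\alpha_n x_n\|\le b\sum|\alpha_n|$ for all $(\alpha_n)\in\ell^1$. For a bounded sequence $(x_n)$ in a Banach space, the James constant is $$c_J(x_n)=\sup_{m\in\mathbb{N}} c_m,\qquad c_m=\inf\Bigl\{\Bigl\|\sum_{n\ge m}\alpha_n x_n\Bigr\| : \sum_{n\ge m}|\alpha_n|=1\Bigr\},$$ where the $\alpha_n$ are scalars (and $(c_m)$ is increasing in $m$). Further, $$\tilde{c}_J(x_n)=\sup c_J(x_{n_k}),$$ where the supremum is taken over all subsequences $(x_{n_k})_k$ of $(x_n)$. Convention: if $(x_n^* )$ in $X^*$ is equivalent to the canonical basis of $c_0$, then for $(\alpha_n)\in\ell^\infty$ the sum $\sum_n\alpha_n x_n^*$ is the weak$^*$-limit in $X^*$ of its partial sums (which exists). *)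

theory Defs
  imports "HOL-Analysis.Analysis" "HOL-Library.Function_Algebras"
begin

section \<open>Scalar fields and Banach spaces over them\<close>

text \<open>
  Either the embedding of the reals is onto, or the field is an isometric copy of the complex
  numbers.
\<close>

class real_or_complex_field = real_normed_field +
  assumes real_or_complex:
    "(\<forall>z. \<exists>r. z = r *\<^sub>R 1) \<or>
     (\<exists>\<phi> :: complex \<Rightarrow> 'a. bij \<phi> \<and>
        (\<forall>w z. \<phi> (w + z) = \<phi> w + \<phi> z) \<and> (\<forall>w z. \<phi> (w * z) = \<phi> w * \<phi> z) \<and>
        (\<forall>z. norm (\<phi> z) = norm z))"

instance real :: real_or_complex_field
  by standard (rule disjI1, simp)

instance complex :: real_or_complex_field
  by standard (rule disjI2, rule exI[of _ id], simp)

text \<open>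
  The type class \<^class>\<open>banach\<close> provides the underlying real Banach space. For real scalars the
  locale forces \<open>smul = scaleR\<close>.
\<close>

locale banach_space_over = vector_space smul
  for smul :: "'k::real_or_complex_field \<Rightarrow> 'a::banach \<Rightarrow> 'a" +
  assumes smul_of_real: "smul (of_real r) x = r *\<^sub>R x"
    and norm_smul: "norm (smul c x) = norm c * norm x"

lemma banach_space_over_real: "banach_space_over (scaleR :: real \<Rightarrow> 'a::banach \<Rightarrow> 'a)"
  by unfold_locales (simp_all add: algebra_simps)

lemma banach_space_over_complex: "banach_space_over ((*) :: complex \<Rightarrow> complex \<Rightarrow> complex)"
  by unfold_locales (simp_all add: algebra_simps norm_mult scaleR_conv_of_real)


section \<open>Dual and bidual\<close>

text \<open>
  \<^typ>\<open>'a \<Rightarrow>\<^sub>L 'k\<close> consists of the bounded real-linear maps; the dual is its closed subspace of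
  maps that are linear over \<open>'k\<close>, with the operator norm inherited from \<^typ>\<open>'a \<Rightarrow>\<^sub>L 'k\<close>.
\<close>

definition dual ::
  "('k::real_or_complex_field \<Rightarrow> 'a::banach \<Rightarrow> 'a) \<Rightarrow> ('a \<Rightarrow>\<^sub>L 'k) set" where
  "dual smul = {f. \<forall>c x. blinfun_apply f (smul c x) = c * blinfun_apply f x}"

definition scale_functional ::
  "'k::real_or_complex_field \<Rightarrow> ('a::banach \<Rightarrow>\<^sub>L 'k) \<Rightarrow> ('a \<Rightarrow>\<^sub>L 'k)" where
  "scale_functional c f = blinfun_mult_right c o\<^sub>L f"

lemma blinfun_apply_scale_functional [simp]:
  "blinfun_apply (scale_functional c f) x = c * blinfun_apply f x"
  by (simp add: scale_functional_def)

text \<open>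
  Elements of the bidual are functions on \<^const>\<open>dual\<close>, made total by the value \<open>0\<close> outside of
  it, so that they form a subspace of the pointwise function space.
\<close>

definition bidual ::
  "('k::real_or_complex_field \<Rightarrow> 'a::banach \<Rightarrow> 'a) \<Rightarrow> (('a \<Rightarrow>\<^sub>L 'k) \<Rightarrow> 'k) set" where
  "bidual smul = {F.
     (\<forall>f\<in>dual smul. \<forall>g\<in>dual smul. F (f + g) = F f + F g) \<and>
     (\<forall>c. \<forall>f\<in>dual smul. F (scale_functional c f) = c * F f) \<and>
     (\<exists>K. \<forall>f\<in>dual smul. norm (F f) \<le> K * norm f) \<and>
     (\<forall>f. f \<notin> dual smul \<longrightarrow> F f = 0)}"

definition scale_bidual ::
  "'k::real_or_complex_field \<Rightarrow> (('a::banach \<Rightarrow>\<^sub>L 'k) \<Rightarrow> 'k) \<Rightarrow> (('a \<Rightarrow>\<^sub>L 'k) \<Rightarrow> 'k)" where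
  "scale_bidual c F = (\<lambda>f. c * F f)"

definition norm_bidual ::
  "('k::real_or_complex_field \<Rightarrow> 'a::banach \<Rightarrow> 'a) \<Rightarrow> (('a \<Rightarrow>\<^sub>L 'k) \<Rightarrow> 'k) \<Rightarrow> real" where
  "norm_bidual smul F = (SUP f\<in>{f \<in> dual smul. norm f \<le> 1}. norm (F f))"

definition canonical_embedding ::
  "('k::real_or_complex_field \<Rightarrow> 'a::banach \<Rightarrow> 'a) \<Rightarrow> 'a \<Rightarrow> (('a \<Rightarrow>\<^sub>L 'k) \<Rightarrow> 'k)" where
  "canonical_embedding smul x = (\<lambda>f. if f \<in> dual smul then blinfun_apply f x else 0)"

definition reflexive_space ::
  "('k::real_or_complex_field \<Rightarrow> 'a::banach \<Rightarrow> 'a) \<Rightarrow> bool" where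
  "reflexive_space smul \<longleftrightarrow> range (canonical_embedding smul) = bidual smul"


section \<open>L-embedded spaces\<close>

text \<open>
  The normed space is given by its carrier \<open>Z\<close>, its scalar multiplication \<open>sc\<close> and its norm \<open>nrm\<close>.
\<close>

definition L_projection ::
  "'z::ab_group_add set \<Rightarrow> ('k \<Rightarrow> 'z \<Rightarrow> 'z) \<Rightarrow> ('z \<Rightarrow> real) \<Rightarrow> ('z \<Rightarrow> 'z) \<Rightarrow> bool" where
  "L_projection Z sc nrm P \<longleftrightarrow>
     (\<forall>z\<in>Z. P z \<in> Z) \<and>
     (\<forall>y\<in>Z. \<forall>z\<in>Z. P (y + z) = P y + P z) \<and>
     (\<forall>c. \<forall>z\<in>Z. P (sc c z) = sc c (P z)) \<and>
     (\<forall>z\<in>Z. P (P z) = P z) \<and>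
     (\<forall>z\<in>Z. nrm (P z) + nrm (z - P z) = nrm z)"

definition L_embedded ::
  "('k::real_or_complex_field \<Rightarrow> 'a::banach \<Rightarrow> 'a) \<Rightarrow> bool" where
  "L_embedded smul \<longleftrightarrow>
     (\<exists>P. L_projection (bidual smul) scale_bidual (norm_bidual smul) P \<and>
          P ` bidual smul = range (canonical_embedding smul))"


section \<open>Sequences\<close>

text \<open>
  Sequences are indexed from \<open>0\<close>.
\<close>

definition equiv_l1_basis ::
  "('k::real_or_complex_field \<Rightarrow> 'a::banach \<Rightarrow> 'a) \<Rightarrow> (nat \<Rightarrow> 'a) \<Rightarrow> bool" where
  "equiv_l1_basis smul x \<longleftrightarrow>
     (\<exists>a b. 0 < a \<and> a \<le> b \<and>
        (\<forall>\<alpha>. summable (\<lambda>n. norm (\<alpha> n)) \<longrightarrow>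
           summable (\<lambda>n. smul (\<alpha> n) (x n)) \<and>
           a * (\<Sum>n. norm (\<alpha> n)) \<le> norm (\<Sum>n. smul (\<alpha> n) (x n)) \<and>
           norm (\<Sum>n. smul (\<alpha> n) (x n)) \<le> b * (\<Sum>n. norm (\<alpha> n))))"

text \<open>
  In \<open>james_tail smul x m\<close> the coefficient of \<open>x (n + m)\<close> is written \<open>\<alpha> n\<close>. All infima and
  suprema below are of nonempty bounded sets of reals as long as \<open>x\<close> is bounded.
\<close>

definition james_tail ::
  "('k::real_or_complex_field \<Rightarrow> 'a::banach \<Rightarrow> 'a) \<Rightarrow> (nat \<Rightarrow> 'a) \<Rightarrow> nat \<Rightarrow> real" where
  "james_tail smul x m =
     (INF \<alpha>\<in>{\<alpha>. (\<lambda>n. norm (\<alpha> n)) sums 1}. norm (\<Sum>n. smul (\<alpha> n) (x (n + m))))"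

definition james_const ::
  "('k::real_or_complex_field \<Rightarrow> 'a::banach \<Rightarrow> 'a) \<Rightarrow> (nat \<Rightarrow> 'a) \<Rightarrow> real" where
  "james_const smul x = (SUP m. james_tail smul x m)"

definition james_const_sup ::
  "('k::real_or_complex_field \<Rightarrow> 'a::banach \<Rightarrow> 'a) \<Rightarrow> (nat \<Rightarrow> 'a) \<Rightarrow> real" where
  "james_const_sup smul x =
     (SUP r\<in>{r :: nat \<Rightarrow> nat. strict_mono r}. james_const smul (x \<circ> r))"

text \<open>
  Convergence of a series in the weak-* topology, which is pointwise convergence.
\<close>

definition weak_star_sums ::
  "(nat \<Rightarrow> 'a::banach \<Rightarrow>\<^sub>L 'k::real_or_complex_field) \<Rightarrow> ('a \<Rightarrow>\<^sub>L 'k) \<Rightarrow> bool" where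
  "weak_star_sums g f \<longleftrightarrow>
     (\<forall>x. (\<lambda>n. blinfun_apply (g n) x) sums blinfun_apply f x)"

definition linfty :: "(nat \<Rightarrow> 'k::real_or_complex_field) set" where
  "linfty = {\<alpha>. bounded (range \<alpha>)}"

definition norm_linfty :: "(nat \<Rightarrow> 'k::real_or_complex_field) \<Rightarrow> real" where
  "norm_linfty \<alpha> = (SUP n. norm (\<alpha> n))"

definition dual_contains_isometric_linfty ::
  "('k::real_or_complex_field \<Rightarrow> 'a::banach \<Rightarrow> 'a) \<Rightarrow> bool" where
  "dual_contains_isometric_linfty smul \<longleftrightarrow>
     (\<exists>T :: (nat \<Rightarrow> 'k) \<Rightarrow> ('a \<Rightarrow>\<^sub>L 'k).
        (\<forall>\<alpha>\<in>linfty. T \<alpha> \<in> dual smul) \<and>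
        (\<forall>\<alpha>\<in>linfty. \<forall>\<beta>\<in>linfty. T (\<lambda>n. \<alpha> n + \<beta> n) = T \<alpha> + T \<beta>) \<and>
        (\<forall>c. \<forall>\<alpha>\<in>linfty. T (\<lambda>n. c * \<alpha> n) = scale_functional c (T \<alpha>)) \<and>
        (\<forall>\<alpha>\<in>linfty. norm (T \<alpha>) = norm_linfty \<alpha>))"

end

theory Submission
  imports Defs "HOL-Real_Asymp.Real_Asymp"
begin

text \<open>
  Let \<open>P\<close> be the L-projection onto \<open>X\<close>, let \<open>Q = I - P\<close>, and call an element of the bidual
  singular if \<open>P\<close> annihilates it. The proof has three ingredients.

  Singular elements are plentiful. Let \<open>z\<close> be a weak-star cluster point in the bidual of a sequence
  \<open>y\<close> whose tails satisfy lower \<open>\<ell>\<^sup>1\<close>-estimates with constants tending to \<open>d\<close>, and let \<open>a = P z\<close>. By Hahn-Banach,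
  some convex combination \<open>u\<close> of a tail of \<open>y\<close> is, up to an arbitrarily small error, as close to \<open>a\<close> as \<open>z\<close>
  is, namely \<open>\<parallel>Q z\<parallel>\<close>. In the same way some convex combination \<open>u'\<close> of later terms is as close to \<open>u\<close> as
  \<open>z\<close> is, namely \<open>\<parallel>a - u\<parallel> + \<parallel>Q z\<parallel>\<close>, which is not essentially larger than \<open>2 \<parallel>Q z\<parallel>\<close>. But the norm of
  \<open>u - u'\<close> is not essentially smaller than \<open>2 d\<close>, hence \<open>\<parallel>Q z\<parallel> \<ge> d\<close> (\<open>singular_part_cluster_ge\<close>).
  Applied to subsequences with large James constants, this gives cluster points of the given sequence whose
  singular parts have norms above any number below the constant of the theorem.

  Singular elements can be used one after another. Suppose that all combinations of \<open>g\<^sub>0, \<dots>, g\<^sub>n\<^sub>-\<^sub>1\<close>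
  in the dual with coefficients in the unit ball have norm at most \<open>C\<close>, and let \<open>s\<close> be singular. On the
  bidual consider the functionals \<open>g\<^sub>i \<circ> P\<close> and a functional of norm \<open>C\<close> that vanishes on \<open>X\<close> and has
  the value \<open>C \<parallel>s\<parallel>\<close> at \<open>s\<close>. Because norms add up in the L-decomposition, combinations of these \<open>n + 1\<close>
  functionals with coefficients in the unit ball again have norm at most \<open>C\<close>. They need not come from
  the dual of \<open>X\<close>, but functionals on \<open>X\<close> imitate them on any finite set of points of \<open>X\<close> and at \<open>s\<close>,
  at the price of replacing \<open>C\<close> by a slightly larger constant (\<open>extend_c0_family\<close>). The old functionals
  change in this step, yet keep their values at the chosen points. Iterating with constants that
  increase to \<open>1\<close> and recording a point of the sequence at each step, one obtains a weak-star limit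
  family \<open>g\<close> such that \<open>g\<^sub>i\<close> vanishes at the points recorded before step \<open>i\<close>
  (\<open>exists_triangular_c0_family\<close>); the singular element may be a different one at each step.

  The norm becomes exact by grouping. All combinations of \<open>g\<close> are bounded by the supremum of the
  coefficients and \<open>\<parallel>g\<^sub>i\<parallel>\<close> tends to \<open>1\<close>. Reflecting all coefficients but one shows that then
  \<open>\<parallel>\<Sum> \<gamma>\<^sub>i g\<^sub>i\<parallel> \<ge> 2 \<bar>\<gamma>\<^sub>i\<bar> \<parallel>g\<^sub>i\<parallel> - sup \<bar>\<gamma>\<bar>\<close>. If every coefficient is repeated infinitely often, the right-hand
  side comes arbitrarily close to \<open>sup \<bar>\<gamma>\<bar>\<close>, so that sums of \<open>g\<close> over infinitely many disjoint infinite
  blocks of indices generate \<open>\<ell>\<^sup>\<infinity>\<close> isometrically (\<open>norm_block_series\<close>). The first member of each block can be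
  scaled down without changing this, and is scaled so that its value at its own point tends to the
  required limit. In the non-reflexive case one singular element, used at every step, suffices.
\<close>

section \<open>Scalars\<close>

text \<open>
  Both alternatives in the definition of the class are isometric pictures of \<open>\<real>\<close> or \<open>\<complex>\<close>, from which
  the compactness of bounded closed sets is inherited. This gives weak-star compactness, finite nets
  of coefficients and the convergence of absolutely convergent scalar series.
\<close>

instance real_or_complex_field \<subseteq> heine_borel
proof
  fix f :: "nat \<Rightarrow> 'a" assume b: "bounded (range f)"
  consider (r) "\<forall>z::'a. \<exists>r. z = r *\<^sub>R 1"
    | (c) "\<exists>\<phi> :: complex \<Rightarrow> 'a. bij \<phi> \<and>
        (\<forall>w z. \<phi> (w + z) = \<phi> w + \<phi> z) \<and> (\<forall>w z. \<phi> (w * z) = \<phi> w * \<phi> z) \<and>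
        (\<forall>z. norm (\<phi> z) = norm z)"
    using real_or_complex[where 'a='a] by blast
  then show "\<exists>l r. strict_mono r \<and> (f \<circ> r) \<longlonglongrightarrow> l"
  proof cases
    case r
    define g where "g n = (SOME r. f n = r *\<^sub>R 1)" for n
    have g: "f n = g n *\<^sub>R 1" for n unfolding g_def using r by (metis (mono_tags, lifting) someI_ex)
    have "bounded (range g)"
      using b unfolding bounded_iff by (auto simp: g)
    then obtain l s where "strict_mono s" "(g \<circ> s) \<longlonglongrightarrow> l"
      using bounded_imp_convergent_subsequence by blast
    then have "(\<lambda>n. (g \<circ> s) n *\<^sub>R (1::'a)) \<longlonglongrightarrow> l *\<^sub>R 1"
      by (intro tendsto_intros)
    then show ?thesis using \<open>strict_mono s\<close> by (auto simp: g o_def)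
  next
    case c
    then obtain \<phi> :: "complex \<Rightarrow> 'a" where p: "bij \<phi>" "\<And>w z. \<phi> (w + z) = \<phi> w + \<phi> z"
       "\<And>z. norm (\<phi> z) = norm z" by blast
    define g where "g n = inv \<phi> (f n)" for n
    have g: "f n = \<phi> (g n)" for n unfolding g_def using p(1) by (simp add: bij_is_surj surj_f_inv_f)
    have "bounded (range g)"
      using b unfolding bounded_iff by (auto simp: g p)
    then obtain l s where s: "strict_mono s" "(g \<circ> s) \<longlonglongrightarrow> l"
      using bounded_imp_convergent_subsequence by blast
    have d: "\<phi> (w - z) = \<phi> w - \<phi> z" for w z
      using p(2)[of "w - z" z] by simp
    have "(\<lambda>n. norm ((g \<circ> s) n - l)) \<longlonglongrightarrow> 0" using tendsto_norm_zero[OF LIM_zero[OF s(2)]] by simp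
    then have "(\<lambda>n. norm ((f \<circ> s) n - \<phi> l)) \<longlonglongrightarrow> 0" by (simp add: g d[symmetric] p(3))
    then have "(f \<circ> s) \<longlonglongrightarrow> \<phi> l" using tendsto_norm_zero_iff LIM_zero_iff by metis
    then show ?thesis using s(1) by blast
  qed
qed

instance real_or_complex_field \<subseteq> banach ..

section \<open>Sublinear functionals\<close>

text \<open>
  The scaling is a parameter since the results are needed on spaces of families of functionals, where
  the type carries no canonical real vector space structure.
\<close>

locale real_scaled_space = vector_space scl
  for scl :: "real \<Rightarrow> 'v::ab_group_add \<Rightarrow> 'v"
begin

definition sublinear :: "('v \<Rightarrow> real) \<Rightarrow> bool" where
  "sublinear p \<longleftrightarrow> (\<forall>x y. p (x + y) \<le> p x + p y) \<and> (\<forall>t x. 0 \<le> t \<longrightarrow> p (scl t x) = t * p x)"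

lemma sublinearD:
  assumes "sublinear p"
  shows "p (x + y) \<le> p x + p y" "0 \<le> t \<Longrightarrow> p (scl t x) = t * p x" "p 0 = 0" "- p (- x) \<le> p x"
proof -
  show 1: "p (x + y) \<le> p x + p y" for x y using assms by (simp add: sublinear_def)
  show 2: "0 \<le> t \<Longrightarrow> p (scl t x) = t * p x" for t x using assms by (simp add: sublinear_def)
  show 3: "p 0 = 0" using 2[of 0 0] by simp
  show "- p (- x) \<le> p x" using 1[of x "-x"] 3 by simp
qed

text \<open>
  \<open>K\<close> is a convex cone of prescriptions \<open>(v, r)\<close>, each asking a functional to be at least \<open>r\<close> at \<open>v\<close>;
  a functional below \<open>p\<close> can only meet them if \<open>r \<le> p v\<close>.
\<close>

definition cone_dominated :: "('v \<times> real) set \<Rightarrow> ('v \<Rightarrow> real) \<Rightarrow> bool" where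
  "cone_dominated K p \<longleftrightarrow> (0, 0) \<in> K \<and>
     (\<forall>v r w s. (v, r) \<in> K \<longrightarrow> (w, s) \<in> K \<longrightarrow> (v + w, r + s) \<in> K) \<and>
     (\<forall>t v r. 0 < t \<longrightarrow> (v, r) \<in> K \<longrightarrow> (scl t v, t * r) \<in> K) \<and>
     (\<forall>v r. (v, r) \<in> K \<longrightarrow> r \<le> p v)"

text \<open>
  A linear functional below the infimum \<open>q\<close> lies below \<open>p\<close> and satisfies all prescriptions in \<open>K\<close>, as
  one sees at \<open>- v\<close>. So the cone can be absorbed into the sublinear functional.
\<close>

lemma sublinear_cone_inf:
  assumes p: "sublinear p" and K: "cone_dominated K p"
  defines "q \<equiv> (\<lambda>x. INF (v, r)\<in>K. p (x + v) - r)"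
  shows "sublinear q" "q x \<le> p x" "(v, r) \<in> K \<Longrightarrow> q (x) \<le> p (x + v) - r"
proof -
  note pD = sublinearD[OF p]
  have K0: "(0, 0) \<in> K"
    and Kadd: "\<And>v r w s. (v, r) \<in> K \<Longrightarrow> (w, s) \<in> K \<Longrightarrow> (v + w, r + s) \<in> K"
    and Kscl: "\<And>t v r. 0 < t \<Longrightarrow> (v, r) \<in> K \<Longrightarrow> (scl t v, t * r) \<in> K"
    and Kp: "\<And>v r. (v, r) \<in> K \<Longrightarrow> r \<le> p v"
    using K unfolding cone_dominated_def by blast+
  have lb: "- p (- x) \<le> p (x + v) - r" if "(v, r) \<in> K" for x v r
    using pD(1)[of "x + v" "- x"] Kp[OF that] by simp
  have bdd: "bdd_below ((\<lambda>(v, r). p (x + v) - r) ` K)" for x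
    by (rule bdd_belowI[of _ "- p (- x)"]) (use lb in auto)
  show up: "q x \<le> p (x + v) - r" if "(v, r) \<in> K" for x v r
    unfolding q_def using cINF_lower[OF bdd that] by simp
  have gr: "c \<le> q x" if "\<And>v r. (v, r) \<in> K \<Longrightarrow> c \<le> p (x + v) - r" for c x
    unfolding q_def using K0 that by (intro cINF_greatest) auto
  show "q x \<le> p x" for x using up[OF K0, of x] by simp
  have add: "q (x + y) \<le> q x + q y" for x y
  proof -
    have "q (x + y) - (p (y + w) - s) \<le> q x" if w: "(w, s) \<in> K" for w s
    proof (rule gr)
      fix v r assume v: "(v, r) \<in> K"
      have "q (x + y) \<le> p (x + y + (v + w)) - (r + s)" by (rule up[OF Kadd[OF v w]])
      also have "x + y + (v + w) = (x + v) + (y + w)" by (simp add: algebra_simps)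
      finally show "q (x + y) - (p (y + w) - s) \<le> p (x + v) - r"
        using pD(1)[of "x + v" "y + w"] by simp
    qed
    then have "q (x + y) - q x \<le> q y" by (intro gr) (smt (verit))
    then show ?thesis by simp
  qed
  have le: "t * q x \<le> q (scl t x)" if "0 < t" for t x
  proof (rule gr)
    fix v r assume v: "(v, r) \<in> K"
    have "q x \<le> p (x + scl (1/t) v) - (1/t) * r" using that by (intro up Kscl v) simp
    then have "t * q x \<le> t * (p (x + scl (1/t) v) - (1/t) * r)" using that by simp
    also have "\<dots> = p (scl t (x + scl (1/t) v)) - r"
      using that by (simp add: pD(2) right_diff_distrib)
    also have "scl t (x + scl (1/t) v) = scl t x + v"
      using that by (simp add: scale_right_distrib)
    finally show "t * q x \<le> p (scl t x + v) - r" .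
  qed
  have "q (scl t x) = t * q x" if "0 < t" for t x
  proof (rule antisym[OF _ le[OF that]])
    have "(1/t) * q (scl t x) \<le> q (scl (1/t) (scl t x))" using that by (intro le) simp
    then have "(1/t) * q (scl t x) \<le> q x" using that by simp
    then show "q (scl t x) \<le> t * q x" using that by (simp add: field_simps)
  qed
  moreover have "q 0 = 0"
    using up[OF K0, of 0] pD(3) gr[of 0 0] Kp by force
  ultimately show "sublinear q"
    unfolding sublinear_def using add by (metis less_eq_real_def mult_zero_left scale_zero_left)
qed

text \<open>
  A minimal sublinear functional is linear: absorbing the ray through \<open>(y, f y)\<close> gives a sublinear
  functional below \<open>f\<close>, hence \<open>f\<close> itself, and this forces \<open>f x + f y \<le> f (x + y)\<close>. Zorn's lemma
  yields minimal ones.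
\<close>

lemma linear_below_sublinear:
  assumes p: "sublinear p"
  obtains f where "\<And>x. f x \<le> p x" "\<And>x y. f (x + y) = f x + f y" "\<And>t x. f (scl t x) = t * f x"
proof -
  define A where "A = {q. sublinear q \<and> q \<le> p}"
  define R where "R = (\<lambda>a b :: 'v \<Rightarrow> real. b \<le> a)"
  have po: "partial_order_on A (relation_of R A)"
    unfolding partial_order_on_def preorder_on_def refl_on_def trans_def antisym_def relation_of_def R_def
    by auto
  have ch: "\<exists>u\<in>A. \<forall>a\<in>C. R a u" if C: "C \<in> Chains (relation_of R A)" for C
  proof (cases "C = {}")
    case True
    then show ?thesis using p by (auto simp: A_def)
  next
    case False
    have CA: "q \<in> A" if "q \<in> C" for q
      using C that unfolding Chains_def relation_of_def by auto
    have CC: "q \<le> q' \<or> q' \<le> q" if "q \<in> C" "q' \<in> C" for q q'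
      using C that unfolding Chains_def relation_of_def R_def by auto
    have CS: "sublinear q" "q x \<le> p x" if "q \<in> C" for q x
      using CA[OF that] by (auto simp: A_def le_fun_def)
    define u where "u x = (INF q\<in>C. q x)" for x
    have bdd: "bdd_below ((\<lambda>q. q x) ` C)" for x
    proof (rule bdd_belowI[of _ "- p (- x)"], clarify)
      fix q assume "q \<in> C"
      then show "- p (- x) \<le> q x" using sublinearD(4)[OF CS(1), of q x] CS(2)[of q "- x"] by linarith
    qed
    have up: "u x \<le> q x" if "q \<in> C" for q x
      unfolding u_def using cINF_lower[OF bdd that] .
    have gr: "c \<le> u x" if "\<And>q. q \<in> C \<Longrightarrow> c \<le> q x" for c x
      unfolding u_def using False that by (intro cINF_greatest)
    have "u (x + y) \<le> u x + u y" for x y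
    proof -
      have "u (x + y) - q' y \<le> u x" if q': "q' \<in> C" for q'
      proof (rule gr)
        fix q assume q: "q \<in> C"
        obtain m where m: "m \<in> C" "m \<le> q" "m \<le> q'" using CC[OF q q'] q q' by auto
        have "u (x + y) \<le> m x + m y" using up[OF m(1)] sublinearD(1)[OF CS(1)[OF m(1)]] order_trans by blast
        also have "\<dots> \<le> q x + q' y" using m(2,3) by (intro add_mono) (auto simp: le_fun_def)
        finally show "u (x + y) - q' y \<le> q x" by simp
      qed
      then have "u (x + y) - u x \<le> u y" by (intro gr) (smt (verit))
      then show ?thesis by simp
    qed
    moreover have "u (scl t x) = t * u x" if t: "0 \<le> t" for t x
    proof (cases "t = 0")
      case True
      have "u 0 = 0"
      proof -
        have "(INF q\<in>C. q 0) = (INF q\<in>C. 0)" by (rule INF_cong) (simp_all add: sublinearD(3)[OF CS(1)])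
        then show ?thesis using False by (simp add: u_def)
      qed
      then show ?thesis using True by simp
    next
      case nz: False
      then have t': "0 < t" using t by simp
      show ?thesis
      proof (rule antisym)
        have "(1/t) * u (scl t x) \<le> u x"
        proof (rule gr)
          fix q assume q: "q \<in> C"
          show "(1/t) * u (scl t x) \<le> q x"
            using up[OF q, of "scl t x"] sublinearD(2)[OF CS(1)[OF q] t, of x] t' by (simp add: field_simps)
        qed
        then show "u (scl t x) \<le> t * u x" using t' by (simp add: field_simps)
        show "t * u x \<le> u (scl t x)"
        proof (rule gr)
          fix q assume q: "q \<in> C"
          show "t * u x \<le> q (scl t x)"
            using up[OF q, of x] sublinearD(2)[OF CS(1)[OF q] t, of x] t' by simp
        qed
      qed
    qed
    ultimately have "sublinear u" by (simp add: sublinear_def)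
    moreover have "u \<le> p" using False up CS(2) by (metis all_not_in_conv le_funI order_trans)
    ultimately show ?thesis using up by (intro bexI[of _ u]) (auto simp: A_def R_def le_fun_def)
  qed
  obtain f where f: "f \<in> A" and min: "\<And>g. g \<in> A \<Longrightarrow> g \<le> f \<Longrightarrow> g = f"
    using predicate_Zorn[OF po ch] unfolding R_def by blast
  have fs: "sublinear f" and fp: "\<And>x. f x \<le> p x" using f by (auto simp: A_def le_fun_def)
  note fD = sublinearD[OF fs]
  have ge: "f x + f y \<le> f (x + y)" for x y
  proof -
    \<comment> \<open>The ray that asks a functional to be at least as large as \<open>f\<close> at \<open>y\<close>.\<close>
    define K where "K = {(scl t y, t * f y) | t. 0 \<le> t}"
    have K: "cone_dominated K f"
      unfolding cone_dominated_def
    proof (intro conjI allI impI)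
      show "(0, 0) \<in> K" unfolding K_def by (intro CollectI exI[of _ 0]) simp
      fix v r assume v: "(v, r) \<in> K"
      then obtain t where t: "v = scl t y" "r = t * f y" "0 \<le> t" by (auto simp: K_def)
      show "r \<le> f v" using t fD(2) by simp
      show "(scl c v, c * r) \<in> K" if "0 < c" for c
        unfolding K_def using t that by (intro CollectI exI[of _ "c * t"]) simp
      fix w s assume w: "(w, s) \<in> K"
      then obtain t' where t': "w = scl t' y" "s = t' * f y" "0 \<le> t'" by (auto simp: K_def)
      show "(v + w, r + s) \<in> K"
        unfolding K_def using t t' by (intro CollectI exI[of _ "t + t'"]) (simp add: scale_left_distrib distrib_right)
    qed
    define q where "q = (\<lambda>x. INF (v, r)\<in>K. f (x + v) - r)"
    note q = sublinear_cone_inf[OF fs K, folded q_def]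
    have "q = f"
    proof (rule min)
      show "q \<le> f" using q(2) unfolding q_def le_fun_def by blast
      then show "q \<in> A" using q(1) f by (auto simp: A_def)
    qed
    moreover have "(y, f y) \<in> K" unfolding K_def by (intro CollectI exI[of _ 1]) simp
    ultimately show ?thesis using q(3)[of y "f y" x] fun_cong[of q f x] unfolding q_def by linarith
  qed
  have add: "f (x + y) = f x + f y" for x y using ge fD(1) by (simp add: antisym)
  have neg: "f (- x) = - f x" for x using add[of x "- x"] fD(3) by simp
  have "f (scl t x) = t * f x" for t x
  proof (cases "0 \<le> t")
    case False
    have "f (scl t x) = - f (scl (- t) x)" by (simp flip: neg)
    then show ?thesis using fD(2)[of "- t" x] False by simp
  qed (simp add: fD(2))
  then show ?thesis using that fp add by blast
qed

text \<open>
  The Mazur-Orlicz form of the Hahn-Banach theorem. It covers the separation of a point from a convex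
  set as well as norming functionals, each by a suitable cone.
\<close>

theorem mazur_orlicz:
  assumes p: "sublinear p" and K: "cone_dominated K p"
  obtains f where "\<And>x. f x \<le> p x" "\<And>x y. f (x + y) = f x + f y" "\<And>t x. f (scl t x) = t * f x"
    "\<And>v r. (v, r) \<in> K \<Longrightarrow> r \<le> f v"
proof -
  note q = sublinear_cone_inf[OF p K]
  obtain f where f: "\<And>x. f x \<le> (INF (v, r)\<in>K. p (x + v) - r)"
    "\<And>x y. f (x + y) = f x + f y" "\<And>t x. f (scl t x) = t * f x"
    using linear_below_sublinear[OF q(1)] by blast
  have neg: "f (- x) = - f x" for x using f(3)[of "- 1" x] by simp
  have "r \<le> f v" if "(v, r) \<in> K" for v r
    using f(1)[of "- v"] q(3)[OF that, of "- v"] neg[of v] sublinearD(3)[OF p] by simp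
  then show ?thesis using that f q(2) by (meson order_trans)
qed

end

text \<open>
  The element \<open>j\<close> is the imaginary unit over the complex numbers and \<open>0\<close> over the reals, so that
  \<open>z = re z - j re (j z)\<close> holds in both cases and no later argument has to distinguish them.
\<close>

lemma scalar_real_part:
  obtains re :: "'k::real_or_complex_field \<Rightarrow> real" and j :: 'k where
    "bounded_linear re" "\<And>z. \<bar>re z\<bar> \<le> norm z"
    "\<And>r. re (of_real r) = r" "\<And>r. re (j * of_real r) = 0"
    "\<And>z. z = of_real (re z) - j * of_real (re (j * z))"
    "j = 0 \<or> j * j = - 1"
proof -
  consider (r) "\<forall>z::'k. \<exists>r. z = r *\<^sub>R 1"
    | (c) "\<exists>\<phi> :: complex \<Rightarrow> 'k. bij \<phi> \<and>
        (\<forall>w z. \<phi> (w + z) = \<phi> w + \<phi> z) \<and> (\<forall>w z. \<phi> (w * z) = \<phi> w * \<phi> z) \<and>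
        (\<forall>z. norm (\<phi> z) = norm z)"
    using real_or_complex[where 'a='k] by blast
  then show ?thesis
  proof cases
    case r
    define re :: "'k \<Rightarrow> real" where "re z = (SOME r. z = r *\<^sub>R 1)" for z
    have re: "z = re z *\<^sub>R 1" for z unfolding re_def using r by (metis (mono_tags, lifting) someI_ex)
    have uniq: "re (r *\<^sub>R 1) = r" for r using re[of "r *\<^sub>R 1"] by (metis scaleR_cancel_right zero_neq_one)
    have nrm: "\<bar>re z\<bar> = norm z" for z by (subst (2) re) simp
    have "bounded_linear re"
    proof (rule bounded_linear_intro[of _ 1])
      fix x y :: 'k and t :: real
      show "re (x + y) = re x + re y" using uniq[of "re x + re y"] re by (metis scaleR_left_distrib)
      show "re (t *\<^sub>R x) = t *\<^sub>R re x" using uniq[of "t * re x"] re by (metis scaleR_scaleR real_scaleR_def)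
      show "norm (re x) \<le> norm x * 1" by (simp add: nrm)
    qed
    moreover have "z = of_real (re z) - 0 * of_real (re (0 * z))" for z
      using re[of z] by (simp add: of_real_def)
    ultimately show ?thesis using that[of re 0] nrm uniq uniq[of 0] by (simp add: of_real_def)
  next
    case c
    then obtain \<phi> :: "complex \<Rightarrow> 'k" where p: "bij \<phi>" "\<And>w z. \<phi> (w + z) = \<phi> w + \<phi> z"
       "\<And>w z. \<phi> (w * z) = \<phi> w * \<phi> z" "\<And>z. norm (\<phi> z) = norm z" by blast
    have p0: "\<phi> 0 = 0" using p(2)[of 0 0] by simp
    have neg: "\<phi> (- z) = - \<phi> z" for z using p(2)[of z "- z"] p0 by (simp add: eq_neg_iff_add_eq_0 add.commute)
    have p1: "\<phi> 1 = 1"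
    proof -
      have "\<phi> 1 * \<phi> 1 = \<phi> 1 * 1" using p(3)[of 1 1] by simp
      moreover have "\<phi> 1 \<noteq> 0" using p(4)[of 1] by auto
      ultimately show ?thesis using mult_left_cancel by blast
    qed
    have pbl: "bounded_linear \<phi>"
    proof -
      have cont: "continuous_on UNIV \<phi>"
        unfolding continuous_on_iff
      proof (intro ballI allI impI)
        fix x and e :: real assume "e > 0"
        have "dist (\<phi> y) (\<phi> x) = dist y x" for y
          using p(4)[of "y - x"] p(2)[of y "- x"] neg[of x] by (simp add: dist_norm)
        then show "\<exists>d>0. \<forall>x'\<in>UNIV. dist x' x < d \<longrightarrow> dist (\<phi> x') (\<phi> x) < e" using \<open>e > 0\<close> by auto
      qed
      have real: "\<phi> (of_real t) = of_real t" for t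
      proof -
        have nat: "\<phi> (of_nat n) = of_nat n" for n by (induction n) (simp_all add: p0 p1 p(2))
        have int: "\<phi> (of_int n) = of_int n" for n
          by (cases n rule: int_cases2) (simp_all add: nat neg)
        \<comment> \<open>An isometric additive and multiplicative map fixes the rationals, hence by continuity the reals.\<close>
        have rat: "\<phi> (of_rat q) = of_rat q" for q
        proof (cases q)
          case (Fract a b)
          have "\<phi> (of_rat q) * \<phi> (of_int b) = \<phi> (of_int a)"
            unfolding p(3)[symmetric] using Fract by (simp add: of_rat_rat)
          then show ?thesis using Fract by (simp add: int of_rat_rat field_simps)
        qed
        have "closed {t. \<phi> (of_real t) = of_real t}"
          by (intro closed_Collect_eq continuous_intros continuous_on_compose2[OF cont]) auto
        moreover have "\<rat> \<subseteq> {t. \<phi> (of_real t) = of_real t}"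
        proof
          fix t :: real assume "t \<in> \<rat>"
          then obtain q where q: "t = of_rat q" by (auto elim: Rats_cases)
          have "complex_of_real (of_rat q) = of_rat q" "(of_real (of_rat q) :: 'k) = of_rat q"
            by (cases q; simp add: of_rat_rat)+
          then show "t \<in> {t. \<phi> (of_real t) = of_real t}" using q rat[of q] by simp
        qed
        ultimately have "closure \<rat> \<subseteq> {t. \<phi> (of_real t) = of_real t}" using closure_minimal by blast
        then show ?thesis using Rats_closure_real by auto
      qed
      show ?thesis
      proof (rule bounded_linear_intro[of _ 1])
        show "\<phi> (t *\<^sub>R x) = t *\<^sub>R \<phi> x" for t x
          by (simp add: scaleR_conv_of_real p(3) real)
      qed (simp_all add: p)
    qed
    have preal: "\<phi> (of_real t) = of_real t" for t
      using linear_scale[OF bounded_linear.linear[OF pbl], of t 1] unfolding p1 of_real_def .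
    define \<psi> where "\<psi> = inv \<phi>"
    have ps: "\<phi> (\<psi> z) = z" "\<psi> (\<phi> w) = w" for z w
      using p(1) unfolding \<psi>_def by (simp_all add: bij_is_surj surj_f_inv_f bij_is_inj inv_f_f)
    define re where "re z = Re (\<psi> z)" for z
    define j where "j = \<phi> \<i>"
    have psn: "norm (\<psi> z) = norm z" for z using p(4)[of "\<psi> z"] ps by simp
    have "bounded_linear re"
    proof (rule bounded_linear_intro[of _ 1])
      fix x y :: 'k and t :: real
      have "\<psi> (x + y) = \<psi> x + \<psi> y" using ps p(2) by metis
      then show "re (x + y) = re x + re y" by (simp add: re_def)
      have "\<phi> (t *\<^sub>R \<psi> x) = t *\<^sub>R x" by (simp add: linear_scale[OF bounded_linear.linear[OF pbl]] ps)
      then have "\<psi> (t *\<^sub>R x) = t *\<^sub>R \<psi> x" using ps(2)[of "t *\<^sub>R \<psi> x"] by simp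
      then show "re (t *\<^sub>R x) = t *\<^sub>R re x" by (simp add: re_def)
      show "norm (re x) \<le> norm x * 1" using abs_Re_le_cmod[of "\<psi> x"] by (simp add: re_def psn)
    qed
    moreover have "\<bar>re z\<bar> \<le> norm z" for z using abs_Re_le_cmod[of "\<psi> z"] by (simp add: re_def psn)
    moreover have "re (of_real r) = r" for r using ps(2)[of "of_real r"] by (simp add: preal re_def)
    moreover have "re (j * of_real r) = 0" for r
      using ps(2)[of "\<i> * of_real r"] by (simp add: preal p(3) re_def j_def)
    moreover have "z = of_real (re z) - j * of_real (re (j * z))" for z
    proof -
      have "\<psi> (j * z) = \<i> * \<psi> z" unfolding j_def using ps p(3) by metis
      then have 1: "re (j * z) = - Im (\<psi> z)" by (simp add: re_def)
      have "z = \<phi> (of_real (Re (\<psi> z)) + \<i> * of_real (Im (\<psi> z)))"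
        by (subst complex_eq[symmetric]) (rule ps(1)[symmetric])
      then have "z = of_real (Re (\<psi> z)) + j * of_real (Im (\<psi> z))"
        by (simp only: p(2) p(3) preal j_def)
      moreover have "re z = Re (\<psi> z)" by (simp add: re_def)
      ultimately show ?thesis using 1 by simp
    qed
    moreover have "j * j = - 1" unfolding j_def p(3)[symmetric] by (simp add: neg p1)
    ultimately show ?thesis using that by blast
  qed
qed

text \<open>
  The usual passage from a real functional \<open>f\<close> to \<open>F x = f x - j f (j x)\<close>. It keeps the bound by a seminorm,
  because \<open>F x\<close> can be rotated to a real value.
\<close>

lemma scalar_linear_of_real_linear:
  fixes sc :: "'k::real_or_complex_field \<Rightarrow> 'v::ab_group_add \<Rightarrow> 'v" and f p :: "'v \<Rightarrow> real"
  assumes "vector_space sc"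
    and add: "\<And>x y. f (x + y) = f x + f y" and scl: "\<And>t x. f (sc (of_real t) x) = t * f x"
    and le: "\<And>x. f x \<le> p x" and p: "\<And>c x. p (sc c x) = norm c * p x"
  obtains F and re :: "'k \<Rightarrow> real" where
    "\<And>x y. F (x + y) = F x + F y" "\<And>c x. F (sc c x) = c * F x" "\<And>x. norm (F x) \<le> p x"
    "\<And>x. re (F x) = f x" "bounded_linear re" "\<And>z. \<bar>re z\<bar> \<le> norm z"
proof -
  interpret vector_space sc by fact
  obtain re and j :: 'k where re: "bounded_linear re" "\<And>z. \<bar>re z\<bar> \<le> norm z"
    "\<And>r. re (of_real r) = r" "\<And>r. re (j * of_real r) = 0"
    and dec: "\<And>z. z = of_real (re z) - j * of_real (re (j * z))"
    and j: "j = 0 \<or> j * j = - 1" using scalar_real_part[where 'k='k] by blast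
  interpret re: bounded_linear re by fact
  define F where "F x = of_real (f x) - j * of_real (f (sc j x))" for x
  have Fadd: "F (x + y) = F x + F y" for x y
    by (simp add: F_def add scale_right_distrib algebra_simps)
  have f0: "f 0 = 0" using add[of 0 0] by simp
  have fneg: "f (- x) = - f x" for x using add[of x "- x"] f0 by simp
  have Freal: "F (sc (of_real t) x) = of_real t * F x" for t x
    using scl[of t "sc j x"] scl[of t x]
    by (simp add: F_def mult.commute[of j] mult.left_commute right_diff_distrib)
  have Fj: "F (sc j x) = j * F x" for x
  proof (cases "j = 0")
    case True
    then show ?thesis using f0 by (simp add: F_def)
  next
    case False
    then have jj: "j * j = - 1" using j by simp
    have "j * F x = j * of_real (f (sc j x)) * 0 + j * of_real (f x) - (j * j) * of_real (f (sc j x))"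
      by (simp add: F_def algebra_simps)
    then have "j * F x = j * of_real (f x) + of_real (f (sc j x))" using jj by simp
    moreover have "F (sc j x) = of_real (f (sc j x)) + j * of_real (f x)"
      by (simp add: F_def jj fneg)
    ultimately show ?thesis by simp
  qed
  have Fscl: "F (sc c x) = c * F x" for c x
  proof -
    define a b where "a = re c" and "b = - re (j * c)"
    have c: "c = of_real a + of_real b * j" using dec[of c] by (simp add: a_def b_def mult.commute)
    have "sc c x = sc (of_real a) x + sc (of_real b) (sc j x)" by (simp add: c scale_left_distrib del: of_real_eq_iff)
    then have "F (sc c x) = of_real a * F x + of_real b * (j * F x)" by (simp only: Fadd Freal Fj)
    also have "\<dots> = c * F x" by (simp add: c algebra_simps)
    finally show ?thesis .
  qed
  have ref: "re (F x) = f x" for x by (simp add: F_def re.diff re)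
  have "norm (F x) \<le> p x" for x
  proof (cases "F x = 0")
    case True
    have "0 = f (sc 0 x)" using f0 by simp
    also have "f x \<le> p x" "f (- x) \<le> p (sc (- 1) x)" using le[of x] le[of "- x"] by auto
    then show ?thesis using True p[of "- 1" x] fneg[of x] by simp
  next
    case False
    define c where "c = of_real (norm (F x)) / F x"
    have nc: "norm c = 1" using False by (simp add: c_def norm_divide)
    have "F (sc c x) = of_real (norm (F x))" using False by (simp add: Fscl c_def)
    then have "norm (F x) = f (sc c x)" using ref[of "sc c x"] re(3) by simp
    also have "\<dots> \<le> p x" using le[of "sc c x"] p[of c x] nc by simp
    finally show ?thesis .
  qed
  then show ?thesis using that[of F re] Fadd Fscl ref re by blast
qed

lemma seminorm_norming_functional:
  fixes sc :: "'k::real_or_complex_field \<Rightarrow> 'v::ab_group_add \<Rightarrow> 'v" and p :: "'v \<Rightarrow> real"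
  assumes vs: "vector_space sc"
    and add: "\<And>x y. p (x + y) \<le> p x + p y" and scl: "\<And>c x. p (sc c x) = norm c * p x"
  obtains \<Phi> where "\<And>x y. \<Phi> (x + y) = \<Phi> x + \<Phi> y" "\<And>c x. \<Phi> (sc c x) = c * \<Phi> x"
    "\<And>x. norm (\<Phi> x) \<le> p x" "p u \<le> norm (\<Phi> u)"
proof -
  interpret K: vector_space sc by fact
  interpret R: real_scaled_space "\<lambda>t. sc (of_real t)"
    by unfold_locales (simp_all add: K.scale_right_distrib K.scale_left_distrib)
  have p: "R.sublinear p" by (simp add: R.sublinear_def add scl)
  define K where "K = {(sc (of_real t) u, t * p u) | t. 0 \<le> t}"
  have "R.cone_dominated K p"
    unfolding R.cone_dominated_def
  proof (intro conjI allI impI)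
    show "(0, 0) \<in> K" unfolding K_def by (intro CollectI exI[of _ 0]) simp
    fix v r assume v: "(v, r) \<in> K"
    then obtain t where t: "v = sc (of_real t) u" "r = t * p u" "0 \<le> t" by (auto simp: K_def)
    show "r \<le> p v" using t scl by simp
    show "(sc (of_real c) v, c * r) \<in> K" if "0 < c" for c
      unfolding K_def using t that by (intro CollectI exI[of _ "c * t"]) simp
    fix w s assume w: "(w, s) \<in> K"
    then obtain t' where t': "w = sc (of_real t') u" "s = t' * p u" "0 \<le> t'" by (auto simp: K_def)
    show "(v + w, r + s) \<in> K"
      unfolding K_def using t t'
      by (intro CollectI exI[of _ "t + t'"]) (simp add: K.scale_left_distrib distrib_right)
  qed
  then obtain f where f: "\<And>x. f x \<le> p x" "\<And>x y. f (x + y) = f x + f y"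
    "\<And>t x. f (sc (of_real t) x) = t * f x" and K: "\<And>v r. (v, r) \<in> K \<Longrightarrow> r \<le> f v"
    using R.mazur_orlicz[OF p] by blast
  have "(u, p u) \<in> K" unfolding K_def by (intro CollectI exI[of _ 1]) simp
  then have fu: "p u \<le> f u" by (rule K)
  obtain \<Phi> and re :: "'k \<Rightarrow> real" where \<Phi>: "\<And>x y. \<Phi> (x + y) = \<Phi> x + \<Phi> y"
    "\<And>c x. \<Phi> (sc c x) = c * \<Phi> x" "\<And>x. norm (\<Phi> x) \<le> p x"
    and re: "\<And>x. re (\<Phi> x) = f x" "bounded_linear re" "\<And>z. \<bar>re z\<bar> \<le> norm z"
    by (rule scalar_linear_of_real_linear[where sc=sc and f=f and p=p, OF vs f(2) f(3) f(1) scl]) (rule that)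
  have "p u \<le> norm (\<Phi> u)" using fu re(1)[of u] re(3)[of "\<Phi> u"] by linarith
  then show ?thesis by (rule that[OF \<Phi>])
qed

section \<open>Dual and bidual\<close>

lemma dual_add: "f \<in> dual smul \<Longrightarrow> g \<in> dual smul \<Longrightarrow> f + g \<in> dual smul"
  by (simp add: dual_def blinfun.add_left algebra_simps)

lemma dual_zero [simp]: "0 \<in> dual smul"
  by (simp add: dual_def)

lemma dual_scale: "f \<in> dual smul \<Longrightarrow> scale_functional c f \<in> dual smul"
  by (simp add: dual_def)

lemma dual_sum: "(\<And>i. i \<in> I \<Longrightarrow> f i \<in> dual smul) \<Longrightarrow> (\<Sum>i\<in>I. f i) \<in> dual smul"
  by (induction I rule: infinite_finite_induct) (auto intro: dual_add)

lemma norm_scale_functional: "norm (scale_functional c f) = norm c * norm f"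
proof (rule antisym)
  show le: "norm (scale_functional c f) \<le> norm c * norm f" for c f
    by (rule norm_blinfun_bound) (auto simp: norm_mult mult.assoc intro: mult_left_mono norm_blinfun)
  show "norm c * norm f \<le> norm (scale_functional c f)"
  proof (cases "c = 0")
    case False
    have "f = scale_functional (inverse c) (scale_functional c f)"
      using False by (intro blinfun_eqI) (simp add: mult.assoc[symmetric])
    then have "norm f \<le> norm (inverse c) * norm (scale_functional c f)" using le by metis
    then show ?thesis using False by (simp add: norm_inverse norm_divide field_simps)
  qed simp
qed

lemma vector_space_scale_functional: "vector_space scale_functional"
  by unfold_locales (auto intro!: blinfun_eqI simp: algebra_simps blinfun.add_left)

lemma bidual_addD: "F \<in> bidual smul \<Longrightarrow> f \<in> dual smul \<Longrightarrow> g \<in> dual smul \<Longrightarrow> F (f + g) = F f + F g"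
  by (simp add: bidual_def)

lemma bidual_scaleD: "F \<in> bidual smul \<Longrightarrow> f \<in> dual smul \<Longrightarrow> F (scale_functional c f) = c * F f"
  by (simp add: bidual_def)

lemma bidual_zero_outside: "F \<in> bidual smul \<Longrightarrow> f \<notin> dual smul \<Longrightarrow> F f = 0"
  by (simp add: bidual_def)

lemma bidual_zeroD: "F \<in> bidual smul \<Longrightarrow> F 0 = 0"
  using bidual_addD[of F smul 0 0] by simp

lemma bidual_sumD:
  assumes "F \<in> bidual smul" "\<And>i. i \<in> I \<Longrightarrow> f i \<in> dual smul"
  shows "F (\<Sum>i\<in>I. f i) = (\<Sum>i\<in>I. F (f i))"
  using assms(2)
  by (induction I rule: infinite_finite_induct)
    (auto simp: bidual_zeroD[OF assms(1)] bidual_addD[OF assms(1)] dual_sum)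

text \<open>
  Boundedness makes the supremum in the definition of the norm meaningful, and homogeneity extends the
  resulting bound from the unit ball to the whole dual.
\<close>

lemma bidual_bounds:
  assumes "F \<in> bidual smul"
  shows bidual_norm_le: "f \<in> dual smul \<Longrightarrow> norm (F f) \<le> norm_bidual smul F * norm f"
    and norm_bidual_nonneg: "0 \<le> norm_bidual smul F"
    and norm_bidual_bdd: "bdd_above ((\<lambda>f. norm (F f)) ` {f \<in> dual smul. norm f \<le> 1})"
proof -
  obtain K where K: "\<And>f. f \<in> dual smul \<Longrightarrow> norm (F f) \<le> K * norm f"
    using assms unfolding bidual_def by blast
  show bdd: "bdd_above ((\<lambda>f. norm (F f)) ` {f \<in> dual smul. norm f \<le> 1})"
  proof (rule bdd_aboveI2[of _ _ "\<bar>K\<bar>"], clarify)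
    fix f assume f: "f \<in> dual smul" "norm f \<le> 1"
    have "norm (F f) \<le> \<bar>K\<bar> * norm f" using K[OF f(1)] by (smt (verit) mult_right_mono norm_ge_zero)
    also have "\<dots> \<le> \<bar>K\<bar> * 1" using f(2) by (intro mult_left_mono) auto
    finally show "norm (F f) \<le> \<bar>K\<bar>" by simp
  qed
  have up: "norm (F f) \<le> norm_bidual smul F" if "f \<in> dual smul" "norm f \<le> 1" for f
    unfolding norm_bidual_def using bdd that by (intro cSUP_upper) auto
  show "0 \<le> norm_bidual smul F" using up[of 0] bidual_zeroD[OF assms] by simp
  show "norm (F f) \<le> norm_bidual smul F * norm f" if f: "f \<in> dual smul"
  proof (cases "f = 0")
    case True
    then show ?thesis using bidual_zeroD[OF assms] by simp
  next
    case False
    have "norm (F (scale_functional (of_real (1 / norm f)) f)) \<le> norm_bidual smul F"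
      using f False by (intro up dual_scale) (simp_all add: norm_scale_functional norm_divide)
    then show ?thesis using False by (simp add: bidual_scaleD[OF assms f] norm_mult norm_divide field_simps)
  qed
qed

lemma norm_bidual_le:
  assumes "\<And>f. f \<in> dual smul \<Longrightarrow> norm (F f) \<le> K * norm f" "0 \<le> K"
  shows "norm_bidual smul F \<le> K"
  unfolding norm_bidual_def
proof (rule cSUP_least)
  show "{f \<in> dual smul. norm f \<le> 1} \<noteq> {}" using dual_zero by (auto intro!: exI[of _ 0])
  fix f assume f: "f \<in> {f \<in> dual smul. norm f \<le> 1}"
  have "norm (F f) \<le> K * norm f" using f assms(1) by simp
  also have "\<dots> \<le> K * 1" using f assms(2) by (intro mult_left_mono) auto
  finally show "norm (F f) \<le> K" by simp
qed

lemma norm_bidual_approx: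
  assumes "F \<in> bidual smul" "r < norm_bidual smul F"
  obtains f where "f \<in> dual smul" "norm f \<le> 1" "r < norm (F f)"
proof -
  have "{f \<in> dual smul. norm f \<le> 1} \<noteq> {}" using dual_zero by (auto intro!: exI[of _ 0])
  then have "\<exists>f\<in>{f \<in> dual smul. norm f \<le> 1}. r < norm (F f)"
    using assms(2) less_cSUP_iff[OF _ norm_bidual_bdd[OF assms(1)]] unfolding norm_bidual_def by blast
  then show ?thesis using that by auto
qed

lemma norm_bidual_eq_0:
  assumes "F \<in> bidual smul" "norm_bidual smul F = 0"
  shows "F = 0"
proof
  fix f show "F f = 0 f"
    using bidual_norm_le[OF assms(1), of f] bidual_zero_outside[OF assms(1), of f] assms(2)
    by (cases "f \<in> dual smul") auto
qed

lemma bidualI: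
  assumes "\<And>f g. f \<in> dual smul \<Longrightarrow> g \<in> dual smul \<Longrightarrow> F (f + g) = F f + F g"
    and "\<And>c f. f \<in> dual smul \<Longrightarrow> F (scale_functional c f) = c * F f"
    and "\<And>f. f \<in> dual smul \<Longrightarrow> norm (F f) \<le> K * norm f"
    and "\<And>f. f \<notin> dual smul \<Longrightarrow> F f = 0"
  shows "F \<in> bidual smul"
  using assms unfolding bidual_def by blast

lemma bidual_zero [simp]: "0 \<in> bidual smul"
  by (rule bidualI[of _ _ 0]) auto

lemma bidual_scale:
  assumes "F \<in> bidual smul" shows "scale_bidual c F \<in> bidual smul"
proof (rule bidualI[of _ _ "norm c * norm_bidual smul F"])
  fix f assume "f \<in> dual smul"
  then show "norm (scale_bidual c F f) \<le> norm c * norm_bidual smul F * norm f"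
    using bidual_norm_le[OF assms, of f]
    by (simp add: scale_bidual_def norm_mult mult.assoc mult_left_mono)
qed (use assms in \<open>auto simp: scale_bidual_def bidual_addD bidual_scaleD bidual_zero_outside algebra_simps\<close>)

lemma bidual_add:
  assumes "F \<in> bidual smul" "G \<in> bidual smul" shows "F + G \<in> bidual smul"
proof (rule bidualI[of _ _ "norm_bidual smul F + norm_bidual smul G"])
  fix f assume "f \<in> dual smul"
  then show "norm ((F + G) f) \<le> (norm_bidual smul F + norm_bidual smul G) * norm f"
    using bidual_norm_le[OF assms(1), of f] bidual_norm_le[OF assms(2), of f] norm_triangle_ineq[of "F f" "G f"]
    by (simp add: distrib_right)
qed (use assms in \<open>auto simp: bidual_addD bidual_scaleD bidual_zero_outside algebra_simps\<close>)

lemma bidual_diff: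
  assumes "F \<in> bidual smul" "G \<in> bidual smul" shows "F - G \<in> bidual smul"
proof -
  have "F - G = F + scale_bidual (- 1) G" by (auto simp: scale_bidual_def)
  then show ?thesis using assms bidual_add bidual_scale by metis
qed

lemma bidual_sum:
  "(\<And>i. i \<in> I \<Longrightarrow> F i \<in> bidual smul) \<Longrightarrow> (\<Sum>i\<in>I. F i) \<in> bidual smul"
  by (induction I rule: infinite_finite_induct) (auto intro: bidual_add)

lemma norm_bidual_scale:
  assumes "F \<in> bidual smul"
  shows "norm_bidual smul (scale_bidual c F) = norm c * norm_bidual smul F"
proof (rule antisym)
  have le: "norm_bidual smul (scale_bidual c F) \<le> norm c * norm_bidual smul F"
    if "F \<in> bidual smul" for c F
    using bidual_norm_le[OF that] norm_bidual_nonneg[OF that]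
    by (intro norm_bidual_le) (auto simp: scale_bidual_def norm_mult mult.assoc mult_left_mono)
  then show "norm_bidual smul (scale_bidual c F) \<le> norm c * norm_bidual smul F" using assms by blast
  show "norm c * norm_bidual smul F \<le> norm_bidual smul (scale_bidual c F)"
  proof (cases "c = 0")
    case False
    have "norm_bidual smul (scale_bidual (inverse c) (scale_bidual c F))
      \<le> norm (inverse c) * norm_bidual smul (scale_bidual c F)"
      by (intro le bidual_scale assms)
    moreover have "scale_bidual (inverse c) (scale_bidual c F) = F"
      using False by (simp add: scale_bidual_def mult.assoc[symmetric])
    ultimately show ?thesis using False by (simp add: norm_inverse norm_divide field_simps)
  qed (use norm_bidual_nonneg[OF bidual_scale[OF assms]] in simp)
qed

lemma canonical_embedding_dual [simp]: "f \<in> dual smul \<Longrightarrow> canonical_embedding smul x f = blinfun_apply f x"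
  by (simp add: canonical_embedding_def)

lemma canonical_bidual: "canonical_embedding smul x \<in> bidual smul"
proof (rule bidualI[of _ _ "norm x"])
  fix f assume "f \<in> dual smul"
  then show "norm (canonical_embedding smul x f) \<le> norm x * norm f"
    using norm_blinfun[of f x] by (simp add: mult.commute)
qed (auto simp: dual_add dual_scale canonical_embedding_def blinfun.add_left)

lemma norm_canonical_le: "norm_bidual smul (canonical_embedding smul x) \<le> norm x"
proof (rule norm_bidual_le)
  fix f assume "f \<in> dual smul"
  then show "norm (canonical_embedding smul x f) \<le> norm x * norm f"
    using norm_blinfun[of f x] by (simp add: mult.commute)
qed simp

lemma canonical_diff:
  "canonical_embedding smul (x - y) = canonical_embedding smul x - canonical_embedding smul y"
  by (rule ext) (simp add: canonical_embedding_def blinfun.diff_right)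

section \<open>Cluster points of sequences in the bidual\<close>

text \<open>
  Tychonoff's theorem in sequential clothing. A filter that refines the sequential one serves as a subnet,
  so limits of linear identities and of norm bounds can be taken with the ordinary limit rules.
\<close>

lemma pointwise_cluster_filter:
  fixes F :: "nat \<Rightarrow> 'b \<Rightarrow> 'k::heine_borel"
  assumes "\<And>n b. F n b \<in> cball c (M b)"
  obtains \<F> G where "\<F> \<le> sequentially" "\<F> \<noteq> bot" "\<And>b. ((\<lambda>n. F n b) \<longlongrightarrow> G b) \<F>"
proof -
  let ?S = "Pi\<^sub>E UNIV (\<lambda>b. cball c (M b))"
  have "compactin (product_topology (\<lambda>i. euclidean) UNIV) ?S"
    by (simp add: compactin_PiE)
  then have "compact ?S" by (simp add: euclidean_product_topology)
  moreover have "filtermap F sequentially \<noteq> bot" by (simp add: filtermap_bot_iff)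
  moreover have "eventually (\<lambda>x. x \<in> ?S) (filtermap F sequentially)"
    unfolding eventually_filtermap by (rule always_eventually) (use assms in auto)
  ultimately obtain G where G: "inf (nhds G) (filtermap F sequentially) \<noteq> bot"
    unfolding compact_filter by blast
  define \<F> where "\<F> = inf sequentially (filtercomap F (nhds G))"
  have "\<F> \<noteq> bot"
  proof
    assume "\<F> = bot"
    then have "eventually (\<lambda>_. False) \<F>" by simp
    then obtain P Q where PQ: "eventually P sequentially" "eventually Q (filtercomap F (nhds G))"
      "\<And>x. P x \<Longrightarrow> Q x \<Longrightarrow> False"
      unfolding \<F>_def eventually_inf by blast
    then obtain R where R: "eventually R (nhds G)" "\<And>x. R (F x) \<Longrightarrow> Q x"
      by (auto simp: eventually_filtercomap)
    have "eventually (\<lambda>_. False) (inf (nhds G) (filtermap F sequentially))"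
      unfolding eventually_inf
      apply (rule exI[of _ R], rule exI[of _ "\<lambda>y. \<not> R y"])
      using R PQ by (auto simp: eventually_filtermap elim!: eventually_mono)
    then show False using G by (simp add: trivial_limit_def)
  qed
  moreover have "\<F> \<le> sequentially" by (simp add: \<F>_def)
  moreover have "((\<lambda>n. F n b) \<longlongrightarrow> G b) \<F>" for b
  proof -
    have lim: "filterlim F (nhds G) \<F>" unfolding \<F>_def
      by (simp add: filterlim_iff_le_filtercomap)
    show ?thesis
    proof (rule topological_tendstoI)
      fix S assume S: "open S" "G b \<in> S"
      have "open ((\<lambda>f. f b) -` S)"
        using continuous_on_product_coordinates[of b] S(1) open_vimage by blast
      then have "eventually (\<lambda>f. f \<in> (\<lambda>f. f b) -` S) (nhds G)"
        using S(2) eventually_nhds by blast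
      then show "eventually (\<lambda>n. F n b \<in> S) \<F>"
        using filterlim_iff[of F "nhds G" \<F>] lim by auto
    qed
  qed
  ultimately show ?thesis using that by blast
qed

lemma convex_hull_image_combination:
  fixes y :: "'i \<Rightarrow> 'v::real_vector"
  assumes "c \<in> convex hull (y ` A)"
  obtains I u where "finite I" "I \<subseteq> A" "\<And>i. i \<in> I \<Longrightarrow> 0 \<le> u i" "(\<Sum>i\<in>I. u i) = 1"
    "c = (\<Sum>i\<in>I. u i *\<^sub>R y i)"
proof -
  obtain S u where S: "finite S" "S \<subseteq> y ` A" "\<And>x. x \<in> S \<Longrightarrow> 0 \<le> u x" "sum u S = 1"
    "(\<Sum>v\<in>S. u v *\<^sub>R v) = c"
    using assms unfolding convex_hull_explicit by blast
  obtain I where I: "I \<subseteq> A" "inj_on y I" "S = y ` I" using S(2) unfolding subset_image_inj by blast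
  show ?thesis
  proof (rule that[of I "u \<circ> y"])
    show "finite I" using S(1) I finite_imageD by blast
    show "sum (u \<circ> y) I = 1" using S(4) I by (simp add: sum.reindex)
    show "c = (\<Sum>i\<in>I. (u \<circ> y) i *\<^sub>R y i)" using S(5) I by (simp add: sum.reindex)
  qed (use S(3) I in auto)
qed

context banach_space_over
begin

text \<open>
  The real functional is recovered as \<open>re \<circ> F\<close>, with \<open>re\<close> the real part for the given scalar field.
\<close>

lemma dual_of_real_linear:
  assumes "\<And>x. f x \<le> norm x" "\<And>x y. f (x + y) = f x + f y" "\<And>t x. f (t *\<^sub>R x) = t * f x"
  obtains F and re :: "'k \<Rightarrow> real" where "F \<in> dual smul" "norm F \<le> 1" "\<And>x. re (blinfun_apply F x) = f x"
    "bounded_linear re" "\<And>z. \<bar>re z\<bar> \<le> norm z"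
proof -
  have "f (smul (of_real t) x) = t * f x" for t x using assms(3) by (simp add: smul_of_real)
  note lin = scalar_linear_of_real_linear[where f=f and p=norm, OF vector_space_axioms assms(2) this assms(1) norm_smul]
  obtain F and re :: "'k \<Rightarrow> real" where F: "\<And>x y. F (x + y) = F x + F y" "\<And>c x. F (smul c x) = c * F x"
    "\<And>x. norm (F x) \<le> norm x" and re: "\<And>x. re (F x) = f x" "bounded_linear re" "\<And>z. \<bar>re z\<bar> \<le> norm z"
    by (rule lin) (rule that)
  have "bounded_linear F"
  proof (rule bounded_linear_intro[of _ 1])
    show "F (t *\<^sub>R x) = t *\<^sub>R F x" for t x
      using F(2)[of "of_real t" x] by (simp add: smul_of_real scaleR_conv_of_real)
  qed (use F in auto)
  then have B: "blinfun_apply (Blinfun F) = F" by (rule bounded_linear_Blinfun_apply)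
  show ?thesis
  proof (rule that[of "Blinfun F" re])
    show "Blinfun F \<in> dual smul" using F(2) by (simp add: dual_def B)
    show "norm (Blinfun F) \<le> 1" using F(3) by (intro norm_blinfun_bound) (auto simp: B)
  qed (auto simp: re B)
qed

lemma bounded_sequence_cluster:
  assumes b: "\<And>n. norm (y n) \<le> b"
  obtains z \<F> where "z \<in> bidual smul" "\<F> \<le> sequentially" "\<F> \<noteq> bot"
    "\<And>f. f \<in> dual smul \<Longrightarrow> ((\<lambda>n. blinfun_apply f (y n)) \<longlongrightarrow> z f) \<F>"
proof -
  have in_ball: "canonical_embedding smul (y n) f \<in> cball 0 (b * norm f)" for n f
  proof -
    have "0 \<le> b" using b[of 0] norm_ge_zero order_trans by blast
    have "norm (blinfun_apply f (y n)) \<le> norm f * norm (y n)" by (rule norm_blinfun)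
    also have "\<dots> \<le> norm f * b" using b by (intro mult_left_mono) auto
    finally show ?thesis using \<open>0 \<le> b\<close> by (simp add: canonical_embedding_def mult.commute)
  qed
  obtain \<F> z where \<F>: "\<F> \<le> sequentially" "\<F> \<noteq> bot"
    and lim: "\<And>f. ((\<lambda>n. canonical_embedding smul (y n) f) \<longlongrightarrow> z f) \<F>"
    by (rule pointwise_cluster_filter[of "\<lambda>n. canonical_embedding smul (y n)", OF in_ball]) (rule that)
  have cb: "canonical_embedding smul (y n) \<in> bidual smul" for n by (rule canonical_bidual)
  have "z \<in> bidual smul"
  proof (rule bidualI[of _ _ b])
    fix f g :: "'a \<Rightarrow>\<^sub>L 'k" assume f: "f \<in> dual smul"
    have "((\<lambda>n. canonical_embedding smul (y n) (scale_functional c f)) \<longlongrightarrow> c * z f) \<F>" for c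
      unfolding bidual_scaleD[OF cb f] by (intro tendsto_mult tendsto_const lim)
    then show "z (scale_functional c f) = c * z f" for c using tendsto_unique[OF \<F>(2) lim] by blast
    have nle: "norm (canonical_embedding smul (y n) f) \<le> b * norm f" for n using in_ball[of n f] by simp
    show "norm (z f) \<le> b * norm f"
      by (rule tendsto_upperbound[OF tendsto_norm[OF lim] always_eventually \<F>(2)]) (simp add: nle)
    assume g: "g \<in> dual smul"
    have "((\<lambda>n. canonical_embedding smul (y n) (f + g)) \<longlongrightarrow> z f + z g) \<F>"
      unfolding bidual_addD[OF cb f g] by (intro tendsto_add lim)
    then show "z (f + g) = z f + z g" using tendsto_unique[OF \<F>(2) lim] by blast
  next
    fix f :: "'a \<Rightarrow>\<^sub>L 'k" assume "f \<notin> dual smul"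
    then have "((\<lambda>n. canonical_embedding smul (y n) f) \<longlongrightarrow> 0) \<F>" by (simp add: canonical_embedding_def)
    then show "z f = 0" using tendsto_unique[OF \<F>(2) lim] by blast
  qed
  moreover have "((\<lambda>n. blinfun_apply f (y n)) \<longlongrightarrow> z f) \<F>" if "f \<in> dual smul" for f
    using lim[of f] that by simp
  ultimately show ?thesis by (rule that[OF _ \<F>])
qed

text \<open>
  If every convex combination of the tail were farther from \<open>x\<close> than \<open>z\<close> is, a functional of norm one
  would separate \<open>x\<close> from the tail by more than that distance. Passing to the limit along \<open>\<F>\<close>, it would
  separate \<open>x\<close> from \<open>z\<close> by the same amount.
\<close>

lemma dist_convex_hull_tail_le:
  assumes lim: "\<And>f. f \<in> dual smul \<Longrightarrow> ((\<lambda>n. blinfun_apply f (y n)) \<longlongrightarrow> z f) \<F>"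
    and \<F>: "\<F> \<le> sequentially" "\<F> \<noteq> bot" and z: "z \<in> bidual smul" and e: "0 < e"
  obtains c where "c \<in> convex hull (y ` {m..})"
    "norm (x - c) \<le> norm_bidual smul (z - canonical_embedding smul x) + e"
proof -
  define \<delta> where "\<delta> = norm_bidual smul (z - canonical_embedding smul x) + e"
  define C where "C = convex hull (y ` {m..})"
  have zx: "z - canonical_embedding smul x \<in> bidual smul"
    by (intro bidual_diff z canonical_bidual)
  have False if far: "\<And>c. c \<in> C \<Longrightarrow> \<delta> < norm (x - c)"
  proof -
    interpret R: real_scaled_space "scaleR :: real \<Rightarrow> 'a \<Rightarrow> 'a"
      by unfold_locales (simp_all add: scaleR_right_distrib scaleR_left_distrib)
    \<comment> \<open>The cone that asks a functional to exceed its value at \<open>x\<close> by \<open>\<delta>\<close> throughout \<open>C\<close>.\<close>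
    define K where "K = {(t *\<^sub>R (c - x), t * \<delta>) | t c. 0 \<le> t \<and> c \<in> C}"
    have C: "y i \<in> C" if "m \<le> i" for i using that unfolding C_def by (simp add: hull_inc)
    have "R.cone_dominated K norm"
      unfolding R.cone_dominated_def
    proof (intro conjI allI impI)
      show "(0, 0) \<in> K" unfolding K_def using C[of m] by (intro CollectI exI[of _ 0] exI[of _ "y m"]) simp
      fix v r assume v: "(v, r) \<in> K"
      then obtain t c where t: "v = t *\<^sub>R (c - x)" "r = t * \<delta>" "0 \<le> t" "c \<in> C" by (auto simp: K_def)
      show "r \<le> norm v" using t far[OF t(4)] by (simp add: norm_minus_commute mult_left_mono)
      show "(k *\<^sub>R v, k * r) \<in> K" if "0 < k" for k
        unfolding K_def using t that by (intro CollectI exI[of _ "k * t"] exI[of _ c]) simp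
      fix w s assume w: "(w, s) \<in> K"
      then obtain t' c' where t': "w = t' *\<^sub>R (c' - x)" "s = t' * \<delta>" "0 \<le> t'" "c' \<in> C" by (auto simp: K_def)
      show "(v + w, r + s) \<in> K"
      proof (cases "t + t' = 0")
        case True
        then have "t = 0" "t' = 0" using t(3) t'(3) by auto
        then show ?thesis using \<open>(0, 0) \<in> K\<close> t t' by simp
      next
        case False
        define d where "d = (t / (t + t')) *\<^sub>R c + (t' / (t + t')) *\<^sub>R c'"
        have "d \<in> C"
          unfolding d_def C_def
        proof (rule convexD[OF convex_convex_hull])
          show "t / (t + t') + t' / (t + t') = 1" using False by (simp flip: add_divide_distrib)
        qed (use t t' in \<open>auto simp: C_def\<close>)
        moreover have "(t + t') *\<^sub>R d = t *\<^sub>R c + t' *\<^sub>R c'"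
          using False by (simp add: d_def scaleR_right_distrib)
        then have "(t + t') *\<^sub>R (d - x) = v + w"
          by (simp add: t t' algebra_simps)
        moreover have "r + s = (t + t') * \<delta>" by (simp add: t t' algebra_simps)
        moreover have "0 \<le> t + t'" using t t' by simp
        ultimately show ?thesis unfolding K_def by (intro CollectI exI[of _ "t + t'"] exI[of _ d]) auto
      qed
    qed
    moreover have "R.sublinear norm" by (simp add: R.sublinear_def norm_triangle_ineq)
    ultimately obtain f where f: "\<And>x. f x \<le> norm x" "\<And>x y. f (x + y) = f x + f y"
      "\<And>t x. f (t *\<^sub>R x) = t * f x" and K: "\<And>v r. (v, r) \<in> K \<Longrightarrow> r \<le> f v"
      using R.mazur_orlicz by blast
    obtain F and re :: "'k \<Rightarrow> real" where F: "F \<in> dual smul" "norm F \<le> 1" "\<And>x. re (blinfun_apply F x) = f x"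
      and bl: "bounded_linear re" and re: "\<And>z. \<bar>re z\<bar> \<le> norm z"
      using dual_of_real_linear[OF f] by blast
    have ge: "\<delta> \<le> re (blinfun_apply F (y i) - blinfun_apply F x)" if "m \<le> i" for i
    proof -
      have "(y i - x, \<delta>) \<in> K"
        unfolding K_def using C[OF that] by (intro CollectI exI[of _ 1] exI[of _ "y i"]) simp
      then show ?thesis using K F(3)[of "y i - x"] by (simp add: blinfun.diff_right)
    qed
    have "((\<lambda>i. re (blinfun_apply F (y i) - blinfun_apply F x)) \<longlongrightarrow> re (z F - blinfun_apply F x)) \<F>"
      by (intro bounded_linear.tendsto[OF bl] tendsto_diff lim F tendsto_const)
    moreover have "\<forall>\<^sub>F i in \<F>. \<delta> \<le> re (blinfun_apply F (y i) - blinfun_apply F x)"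
      using filter_leD[OF \<F>(1) eventually_ge_at_top[of m]] ge by (auto elim!: eventually_mono)
    ultimately have "\<delta> \<le> re (z F - blinfun_apply F x)"
      using tendsto_lowerbound \<F>(2) by blast
    also have "\<dots> \<le> norm ((z - canonical_embedding smul x) F)"
      using re[of "z F - blinfun_apply F x"] F(1) by simp
    also have "\<dots> \<le> norm_bidual smul (z - canonical_embedding smul x) * norm F"
      by (rule bidual_norm_le[OF zx F(1)])
    also have "\<dots> \<le> norm_bidual smul (z - canonical_embedding smul x) * 1"
      using F(2) norm_bidual_nonneg[OF zx] by (intro mult_left_mono)
    finally show False using e by (simp add: \<delta>_def)
  qed
  then show ?thesis using that unfolding C_def \<delta>_def by (meson not_le)
qed

end

section \<open>Finite nets and finite combinations\<close>

text \<open>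
  Replaces the infinitely many coefficients in the unit ball by finitely many.
\<close>

lemma finite_net_unit_ball:
  assumes "0 < \<delta>"
  obtains D :: "'k::{heine_borel,real_normed_vector} set" where "finite D" "D \<subseteq> cball 0 1"
    "\<And>z. norm z \<le> 1 \<Longrightarrow> \<exists>d\<in>D. norm (z - d) \<le> \<delta>"
proof -
  have "seq_compact (cball (0::'k) 1)" by (simp add: compact_imp_seq_compact)
  from seq_compact_imp_totally_bounded[OF this, rule_format, OF assms]
  obtain D where D: "finite D" "D \<subseteq> cball 0 1" "cball (0::'k) 1 \<subseteq> (\<Union>x\<in>D. ball x \<delta>)"
    by (elim exE conjE) (rule that)
  have "\<exists>d\<in>D. norm (z - d) \<le> \<delta>" if "norm z \<le> 1" for z :: 'k
  proof -
    have "z \<in> cball 0 1" using that by simp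
    then have "z \<in> (\<Union>x\<in>D. ball x \<delta>)" using D(3) by (rule rev_subsetD)
    then obtain d where "d \<in> D" "z \<in> ball d \<delta>" by (elim UN_E) (rule that)
    then show ?thesis by (intro bexI[of _ d]) (simp_all add: dist_norm norm_minus_commute)
  qed
  then show ?thesis using D(1,2) that by metis
qed

lemma sum_fun_apply: "(\<Sum>i\<in>I. F i) x = (\<Sum>i\<in>I. F i x)"
  by (induction I rule: infinite_finite_induct) auto

text \<open>
  Linearity is only needed on \<open>S\<close>, which is what makes the induction work: removing one functional
  \<open>\<phi> i\<close> is paid for by shrinking \<open>S\<close> to its kernel.
\<close>

lemma common_kernel_imp_combination:
  fixes \<psi> :: "'v::ab_group_add \<Rightarrow> 'k::field" and sc :: "'k \<Rightarrow> 'v \<Rightarrow> 'v"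
  assumes "vector_space sc" "finite I"
    and "0 \<in> S" "\<And>x y. x \<in> S \<Longrightarrow> y \<in> S \<Longrightarrow> x + y \<in> S" "\<And>c x. x \<in> S \<Longrightarrow> sc c x \<in> S"
    and "\<And>x y. x \<in> S \<Longrightarrow> y \<in> S \<Longrightarrow> \<psi> (x + y) = \<psi> x + \<psi> y" "\<And>c x. x \<in> S \<Longrightarrow> \<psi> (sc c x) = c * \<psi> x"
    and "\<And>i x y. i \<in> I \<Longrightarrow> x \<in> S \<Longrightarrow> y \<in> S \<Longrightarrow> \<phi> i (x + y) = \<phi> i x + \<phi> i y"
    and "\<And>i c x. i \<in> I \<Longrightarrow> x \<in> S \<Longrightarrow> \<phi> i (sc c x) = c * \<phi> i x"
    and "\<And>x. x \<in> S \<Longrightarrow> (\<And>i. i \<in> I \<Longrightarrow> \<phi> i x = 0) \<Longrightarrow> \<psi> x = 0"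
  shows "\<exists>c. \<forall>x\<in>S. \<psi> x = (\<Sum>i\<in>I. c i * \<phi> i x)"
  using assms(2-)
proof (induction I arbitrary: S rule: finite_induct)
  case empty
  then show ?case by auto
next
  case (insert i I)
  interpret vector_space sc by fact
  note S = insert.prems(1-3) and psi = insert.prems(4,5) and phi = insert.prems(6,7) and ker = insert.prems(8)
  define S' where "S' = {x \<in> S. \<phi> i x = 0}"
  have phi0: "\<phi> i 0 = 0" using phi(2)[of i 0 0] S(1) by simp
  have "\<exists>c. \<forall>x\<in>S'. \<psi> x = (\<Sum>k\<in>I. c k * \<phi> k x)"
    by (rule insert.IH) (auto simp: S'_def S psi phi phi0 intro: ker)
  then obtain c where c: "\<And>x. x \<in> S' \<Longrightarrow> \<psi> x = (\<Sum>k\<in>I. c k * \<phi> k x)" by blast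
  show ?case
  proof (cases "\<exists>x\<in>S. \<phi> i x \<noteq> 0")
    case False
    then have "\<psi> x = (\<Sum>k\<in>insert i I. c k * \<phi> k x)" if "x \<in> S" for x
      using c[of x] that insert.hyps by (simp add: S'_def)
    then show ?thesis by blast
  next
    case True
    then obtain x0 where x0: "x0 \<in> S" "\<phi> i x0 \<noteq> 0" by blast
    define e where "e = sc (inverse (\<phi> i x0)) x0"
    have e: "e \<in> S" "\<phi> i e = 1" using x0 by (auto simp: e_def S phi)
    define d where "d k = (if k = i then \<psi> e - (\<Sum>k\<in>I. c k * \<phi> k e) else c k)" for k
    have "\<psi> x = (\<Sum>k\<in>insert i I. d k * \<phi> k x)" if x: "x \<in> S" for x
    proof -
      define y where "y = x + sc (- \<phi> i x) e"
      have eS: "sc c e \<in> S" for c using S(3)[OF e(1)] .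
      have phi_y: "\<phi> k y = \<phi> k x - \<phi> i x * \<phi> k e" if k: "k \<in> insert i I" for k
        unfolding y_def phi(1)[OF k x eS] phi(2)[OF k e(1)] by simp
      have "y \<in> S" unfolding y_def by (rule S(2)[OF x eS])
      then have y: "y \<in> S'" unfolding S'_def using phi_y[of i] e(2) by simp
      have 1: "\<psi> y = \<psi> x - \<phi> i x * \<psi> e"
        unfolding y_def psi(1)[OF x eS] psi(2)[OF e(1)] by simp
      have 2: "\<phi> k y = \<phi> k x - \<phi> i x * \<phi> k e" if "k \<in> I" for k
        using phi_y that by simp
      have "\<psi> x = \<phi> i x * \<psi> e + (\<Sum>k\<in>I. c k * (\<phi> k x - \<phi> i x * \<phi> k e))"
        using c[OF y] 1 2 by (simp add: algebra_simps)
      also have "\<dots> = (\<psi> e - (\<Sum>k\<in>I. c k * \<phi> k e)) * \<phi> i x + (\<Sum>k\<in>I. c k * \<phi> k x)"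
        by (simp add: algebra_simps sum_subtractf sum_distrib_left)
      also have "(\<Sum>k\<in>I. c k * \<phi> k x) = (\<Sum>k\<in>I. d k * \<phi> k x)"
        using insert.hyps by (intro sum.cong) (auto simp: d_def)
      finally show ?thesis using insert.hyps by (simp add: d_def)
    qed
    then show ?thesis by blast
  qed
qed

lemma blinfun_norm_attained_approx:
  fixes f :: "'b::real_normed_vector \<Rightarrow>\<^sub>L 'c::real_normed_vector"
  assumes "K < norm f"
  obtains w where "norm w \<le> 1" "K \<le> norm (blinfun_apply f w)"
proof -
  have "\<exists>w. norm w \<le> 1 \<and> K \<le> norm (blinfun_apply f w)"
  proof (rule ccontr)
    assume "\<not> ?thesis"
    then have lt: "norm (blinfun_apply f w) < K" if "norm w \<le> 1" for w using that by force
    have "0 < K" using lt[of 0] by simp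
    have "norm f \<le> K"
    proof (rule norm_blinfun_bound)
      fix x show "norm (blinfun_apply f x) \<le> K * norm x"
      proof (cases "x = 0")
        case False
        have "norm (blinfun_apply f (x /\<^sub>R norm x)) < K" using False by (intro lt) simp
        then show ?thesis using False by (simp add: blinfun.scaleR_right field_simps)
      qed simp
    qed (use \<open>0 < K\<close> in simp)
    then show False using assms by simp
  qed
  then show ?thesis using that by blast
qed

text \<open>
  Any strictly increasing sequence of positive numbers with limit \<open>1\<close> would do. The bound at step \<open>n\<close> has to stay below \<open>1\<close>,
  since every step loses a little.
\<close>

definition level :: "nat \<Rightarrow> real" where
  "level n = 1 - 1 / (real n + 2)"

lemma level: "0 < level n" "level n < 1" "level n < level (Suc n)" "level \<longlonglongrightarrow> 1"
proof -
  show "level \<longlonglongrightarrow> 1" unfolding level_def by real_asymp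
qed (auto simp: level_def field_simps)

section \<open>Singular parts of cluster points\<close>

locale L_embedded_space = banach_space_over smul
  for smul :: "'k::real_or_complex_field \<Rightarrow> 'a::banach \<Rightarrow> 'a" +
  fixes P :: "(('a \<Rightarrow>\<^sub>L 'k) \<Rightarrow> 'k) \<Rightarrow> (('a \<Rightarrow>\<^sub>L 'k) \<Rightarrow> 'k)"
  assumes L_proj: "L_projection (bidual smul) scale_bidual (norm_bidual smul) P"
    and range_P: "P ` bidual smul = range (canonical_embedding smul)"
begin

lemma P_bidual: "z \<in> bidual smul \<Longrightarrow> P z \<in> bidual smul"
  and P_add: "y \<in> bidual smul \<Longrightarrow> z \<in> bidual smul \<Longrightarrow> P (y + z) = P y + P z"
  and P_scale: "z \<in> bidual smul \<Longrightarrow> P (scale_bidual c z) = scale_bidual c (P z)"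
  and P_idem: "z \<in> bidual smul \<Longrightarrow> P (P z) = P z"
  and P_norm: "z \<in> bidual smul \<Longrightarrow> norm_bidual smul (P z) + norm_bidual smul (z - P z) = norm_bidual smul z"
  using L_proj unfolding L_projection_def by blast+

lemma P_zero: "P 0 = 0"
  using P_add[of 0 0] by simp

lemma P_diff:
  assumes "y \<in> bidual smul" "z \<in> bidual smul" shows "P (y - z) = P y - P z"
  using P_add[of "y - z" z] bidual_diff[of y smul z] assms by (simp add: algebra_simps)

lemma P_sum:
  "(\<And>i. i \<in> I \<Longrightarrow> z i \<in> bidual smul) \<Longrightarrow> P (\<Sum>i\<in>I. z i) = (\<Sum>i\<in>I. P (z i))"
  by (induction I rule: infinite_finite_induct) (auto simp: P_zero P_add bidual_sum)

lemma P_canonical: "P (canonical_embedding smul x) = canonical_embedding smul x"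
proof -
  obtain z where "z \<in> bidual smul" "canonical_embedding smul x = P z"
    using range_P by (metis imageE rangeI)
  then show ?thesis using P_idem by simp
qed

lemma P_in_range: "z \<in> bidual smul \<Longrightarrow> \<exists>x. P z = canonical_embedding smul x"
  using range_P by blast

text \<open>
  With \<open>x = P z\<close>, choose \<open>c0\<close> in the convex hull of a tail such that \<open>\<parallel>x - c0\<parallel>\<close> hardly exceeds \<open>\<parallel>z - x\<parallel>\<close>,
  then \<open>c1\<close> in the convex hull of later terms such that \<open>\<parallel>c0 - c1\<parallel>\<close> hardly exceeds \<open>\<parallel>z - c0\<parallel>\<close>. Since
  \<open>\<parallel>z - c0\<parallel> \<le> \<parallel>x - c0\<parallel> + \<parallel>z - x\<parallel>\<close>, the norm of \<open>c0 - c1\<close> hardly exceeds \<open>2 \<parallel>z - x\<parallel>\<close>, whereas its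
  coefficients have total size \<open>2\<close>. Approximating \<open>x\<close> by the sequence itself, rather than estimating \<open>\<parallel>z\<parallel>\<close>,
  is what bounds the singular part without any loss.
\<close>

lemma singular_part_cluster_ge:
  assumes lim: "\<And>f. f \<in> dual smul \<Longrightarrow> ((\<lambda>n. blinfun_apply f (y n)) \<longlongrightarrow> z f) \<F>"
    and \<F>: "\<F> \<le> sequentially" "\<F> \<noteq> bot" and z: "z \<in> bidual smul"
    and l1: "\<And>e. 0 < e \<Longrightarrow> \<exists>m. \<forall>I \<alpha>. finite I \<longrightarrow> I \<subseteq> {m..} \<longrightarrow>
      (d - e) * (\<Sum>i\<in>I. norm (\<alpha> i)) \<le> norm (\<Sum>i\<in>I. smul (\<alpha> i) (y i))"
  shows "d \<le> norm_bidual smul (z - P z)"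
proof (rule field_le_epsilon)
  fix e :: real assume e: "0 < e"
  let ?N = "norm_bidual smul" and ?hat = "canonical_embedding smul"
  obtain x where x: "P z = ?hat x" using P_in_range[OF z] by blast
  obtain m where m: "\<And>I \<alpha>. finite I \<Longrightarrow> I \<subseteq> {m..} \<Longrightarrow>
      (d - e/2) * (\<Sum>i\<in>I. norm (\<alpha> i)) \<le> norm (\<Sum>i\<in>I. smul (\<alpha> i) (y i))"
    using l1[of "e/2"] e by auto
  obtain c0 where c0: "c0 \<in> convex hull (y ` {m..})" "norm (x - c0) \<le> ?N (z - ?hat x) + e/2"
    using dist_convex_hull_tail_le[OF lim \<F> z, of "e/2" m x] e by auto
  obtain I u where I: "finite I" "I \<subseteq> {m..}" "\<And>i. i \<in> I \<Longrightarrow> 0 \<le> u i" "(\<Sum>i\<in>I. u i) = 1"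
    "c0 = (\<Sum>i\<in>I. u i *\<^sub>R y i)" by (rule convex_hull_image_combination[OF c0(1)]) (rule that)
  obtain k where k: "\<And>i. i \<in> I \<Longrightarrow> i < k" using finite_nat_set_iff_bounded I(1) by auto
  obtain c1 where c1: "c1 \<in> convex hull (y ` {max m k..})" "norm (c0 - c1) \<le> ?N (z - ?hat c0) + e/2"
    using dist_convex_hull_tail_le[OF lim \<F> z, of "e/2" "max m k" c0] e by auto
  obtain J v where J: "finite J" "J \<subseteq> {max m k..}" "\<And>i. i \<in> J \<Longrightarrow> 0 \<le> v i" "(\<Sum>i\<in>J. v i) = 1"
    "c1 = (\<Sum>i\<in>J. v i *\<^sub>R y i)" by (rule convex_hull_image_combination[OF c1(1)]) (rule that)
  have disj: "I \<inter> J = {}" using k J(2) by fastforce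
  \<comment> \<open>The coefficients of \<open>c0 - c1\<close>; they do not overlap since \<open>J\<close> lies beyond \<open>I\<close>.\<close>
  define \<alpha> :: "nat \<Rightarrow> 'k" where "\<alpha> i = (if i \<in> I then of_real (u i) else - of_real (v i))" for i
  have "(\<Sum>i\<in>I \<union> J. norm (\<alpha> i)) = (\<Sum>i\<in>I. norm (\<alpha> i)) + (\<Sum>i\<in>J. norm (\<alpha> i))"
    using I(1) J(1) disj by (rule sum.union_disjoint)
  also have "(\<Sum>i\<in>I. norm (\<alpha> i)) = 1" using I(3,4) by (simp add: \<alpha>_def)
  also have "(\<Sum>i\<in>J. norm (\<alpha> i)) = (\<Sum>i\<in>J. v i)"
    using J(3) disj by (intro sum.cong) (auto simp: \<alpha>_def)
  finally have s2: "(\<Sum>i\<in>I \<union> J. norm (\<alpha> i)) = 2" using J(4) by simp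
  have "(\<Sum>i\<in>I \<union> J. smul (\<alpha> i) (y i)) = (\<Sum>i\<in>I. smul (\<alpha> i) (y i)) + (\<Sum>i\<in>J. smul (\<alpha> i) (y i))"
    using I(1) J(1) disj by (rule sum.union_disjoint)
  also have "(\<Sum>i\<in>I. smul (\<alpha> i) (y i)) = c0" by (simp add: I(5) \<alpha>_def smul_of_real)
  also have "(\<Sum>i\<in>J. smul (\<alpha> i) (y i)) = (\<Sum>i\<in>J. - (v i *\<^sub>R y i))"
    using disj by (intro sum.cong) (auto simp: \<alpha>_def smul_of_real)
  finally have s3: "(\<Sum>i\<in>I \<union> J. smul (\<alpha> i) (y i)) = c0 - c1" by (simp add: J(5) sum_negf)
  have "(d - e/2) * 2 \<le> norm (c0 - c1)"
  proof -
    have "J \<subseteq> {m..}" using J(2) by auto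
    then show ?thesis using m[of "I \<union> J" \<alpha>] I(1,2) J(1) s2 s3 by auto
  qed
  moreover have "?N (z - ?hat c0) \<le> norm (x - c0) + ?N (z - ?hat x)"
  proof -
    have zc: "z - ?hat c0 \<in> bidual smul" by (intro bidual_diff z canonical_bidual)
    have P1: "P (z - ?hat c0) = ?hat (x - c0)"
      using P_diff[OF z canonical_bidual] x P_canonical by (simp add: canonical_diff)
    have Q1: "z - ?hat c0 - ?hat (x - c0) = z - ?hat x" by (simp add: canonical_diff)
    show ?thesis using P_norm[OF zc] norm_canonical_le[of smul "x - c0"] unfolding P1 Q1 by linarith
  qed
  ultimately show "d \<le> ?N (z - P z) + e" using c0(2) c1(2) x by simp
qed

section \<open>Extending a family of functionals\<close>

text \<open>
  \<open>\<Xi>\<close> is a linear combination of evaluations at the points of \<open>F\<close> and of \<open>s\<close>. When \<open>s\<close> is singular this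
  determines the decomposition of \<open>\<Xi>\<close>: the first summand is its part in \<open>X\<close>, the second its singular part.
\<close>

lemma vanishing_imp_canonical_plus_multiple:
  assumes \<Xi>: "\<Xi> \<in> bidual smul" and s: "s \<in> bidual smul" and F: "finite F"
    and ker: "\<forall>f\<in>dual smul. (\<forall>x\<in>F. blinfun_apply f x = 0) \<longrightarrow> s f = 0 \<longrightarrow> \<Xi> f = 0"
  shows "\<exists>w c. \<Xi> = canonical_embedding smul w + scale_bidual c s \<and>
    (\<forall>f\<in>dual smul. (\<forall>x\<in>F. blinfun_apply f x = 0) \<longrightarrow> blinfun_apply f w = 0)"
proof -
  define \<phi> where "\<phi> k f = (case k of None \<Rightarrow> s f | Some x \<Rightarrow> blinfun_apply f x)" for k f
  have "\<exists>c. \<forall>f\<in>dual smul. \<Xi> f = (\<Sum>k\<in>insert None (Some ` F). c k * \<phi> k f)"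
  proof (rule common_kernel_imp_combination[OF vector_space_scale_functional])
    fix f assume f: "f \<in> dual smul" and \<phi>0: "\<And>k. k \<in> insert None (Some ` F) \<Longrightarrow> \<phi> k f = 0"
    have "\<forall>x\<in>F. blinfun_apply f x = 0" using \<phi>0[of "Some x" for x] by (simp add: \<phi>_def)
    moreover have "s f = 0" using \<phi>0[of None] by (simp add: \<phi>_def)
    ultimately show "\<Xi> f = 0" using ker f by simp
  qed (use F s \<Xi> in \<open>auto simp: \<phi>_def dual_add dual_scale bidual_addD bidual_scaleD blinfun.add_left split: option.split\<close>)
  then obtain c where c: "\<And>f. f \<in> dual smul \<Longrightarrow> \<Xi> f = (\<Sum>k\<in>insert None (Some ` F). c k * \<phi> k f)" by blast
  define w where "w = (\<Sum>x\<in>F. smul (c (Some x)) x)"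
  have fw: "blinfun_apply f w = (\<Sum>x\<in>F. c (Some x) * blinfun_apply f x)" if "f \<in> dual smul" for f
    using that by (simp add: w_def blinfun.sum_right dual_def)
  have "\<Xi> = canonical_embedding smul w + scale_bidual (c None) s"
  proof
    fix f show "\<Xi> f = (canonical_embedding smul w + scale_bidual (c None) s) f"
    proof (cases "f \<in> dual smul")
      case True
      have "(\<Sum>k\<in>insert None (Some ` F). c k * \<phi> k f) = c None * s f + (\<Sum>x\<in>F. c (Some x) * blinfun_apply f x)"
        using F by (subst sum.insert) (auto simp: \<phi>_def sum.reindex)
      then show ?thesis using c[OF True] fw[OF True] True by (simp add: scale_bidual_def)
    next
      case False
      then show ?thesis using \<Xi> s
        by (simp add: bidual_zero_outside scale_bidual_def canonical_embedding_def)
    qed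
  qed
  moreover have "\<forall>f\<in>dual smul. (\<forall>x\<in>F. blinfun_apply f x = 0) \<longrightarrow> blinfun_apply f w = 0"
    by (simp add: fw)
  ultimately show ?thesis by blast
qed

text \<open>
  Otherwise \<open>s\<close> would be a combination of evaluations at the points of \<open>F\<close>, an element of \<open>X\<close>, which
  \<open>P\<close> fixes.
\<close>

lemma singular_separated:
  assumes s: "s \<in> bidual smul" "P s = 0" "s \<noteq> 0" and F: "finite F"
  obtains e where "e \<in> dual smul" "\<And>x. x \<in> F \<Longrightarrow> blinfun_apply e x = 0" "s e = r"
proof -
  have "\<exists>f\<in>dual smul. (\<forall>x\<in>F. blinfun_apply f x = 0) \<and> s f \<noteq> 0"
  proof (rule ccontr)
    assume none: "\<not> ?thesis"
    have "\<forall>f\<in>dual smul. (\<forall>x\<in>F. blinfun_apply f x = 0) \<longrightarrow> 0 f = (0 :: 'k) \<longrightarrow> s f = 0"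
    proof (intro ballI impI, rule ccontr)
      fix f assume f: "f \<in> dual smul" and Ff: "\<forall>x\<in>F. blinfun_apply f x = 0" and sf: "s f \<noteq> 0"
      from Ff sf have "(\<forall>x\<in>F. blinfun_apply f x = 0) \<and> s f \<noteq> 0" by (rule conjI)
      from this f have "\<exists>f\<in>dual smul. (\<forall>x\<in>F. blinfun_apply f x = 0) \<and> s f \<noteq> 0" by (rule bexI)
      with none show False by (rule notE)
    qed
    from vanishing_imp_canonical_plus_multiple[OF s(1) bidual_zero F this]
    obtain w c where w: "s = canonical_embedding smul w + scale_bidual c 0" by (elim exE conjE) (rule that)
    have "scale_bidual c 0 = (0 :: ('a \<Rightarrow>\<^sub>L 'k) \<Rightarrow> 'k)" by (rule ext) (simp add: scale_bidual_def)
    then have "s = canonical_embedding smul w" using w by simp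
    then have "P s = s" by (simp only: P_canonical)
    then show False using s(2,3) by metis
  qed
  then obtain f where f: "f \<in> dual smul" "\<forall>x\<in>F. blinfun_apply f x = 0" "s f \<noteq> 0"
    by (elim bexE conjE) (rule that)
  show ?thesis
  proof (rule that[of "scale_functional (r / s f) f"])
    show "scale_functional (r / s f) f \<in> dual smul" by (intro dual_scale f)
    show "s (scale_functional (r / s f) f) = r" using f(3) by (simp add: bidual_scaleD[OF s(1) f(1)])
    show "blinfun_apply (scale_functional (r / s f) f) x = 0" if "x \<in> F" for x
      using f(2) that by simp
  qed
qed

text \<open>
  The tuples \<open>h\<close> in the dual that meet the linear conditions exactly form a translate of a subspace \<open>L\<close>;
  the question is how small they can make all combinations with coefficients from \<open>B\<close> at once. This is a distance
  in the space of families indexed by \<open>B\<close>, with the supremum norm, and a norming functional \<open>\<Phi>\<close> measures it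
  that vanishes on the families of combinations coming from \<open>L\<close>. Such a functional consists of elements \<open>\<xi> \<beta>\<close> of the
  bidual whose norms add up to at most \<open>1\<close>. Its vanishing says that the combinations \<open>\<Xi> i = \<Sum> \<beta> i \<xi> \<beta>\<close> are fixed by \<open>P\<close> for \<open>i < n\<close>,
  and that \<open>\<Xi> n\<close> has a multiple of \<open>s\<close> as singular part. Hence the old functionals only see \<open>P (\<xi> \<beta>)\<close>, the new one
  only sees \<open>\<xi> \<beta> - P (\<xi> \<beta>)\<close>, each contributes at most \<open>C\<close> times the norm of what it sees, and
  these norms add up to the norm of \<open>\<xi> \<beta>\<close>.
\<close>

lemma extend_family_on_finite_coefficient_set:
  fixes g :: "nat \<Rightarrow> ('a \<Rightarrow>\<^sub>L 'k)" and B :: "(nat \<Rightarrow> 'k) set"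
  assumes g: "\<forall>i<n. g i \<in> dual smul" and C: "0 \<le> C" "C < \<rho>"
    and gC: "\<forall>\<beta>. (\<forall>i<n. norm (\<beta> i) \<le> 1) \<longrightarrow> norm (\<Sum>i<n. scale_functional (\<beta> i) (g i)) \<le> C"
    and F: "finite F" and s: "s \<in> bidual smul" "P s = 0" "s \<noteq> 0"
    and B: "finite B" "\<forall>\<beta>\<in>B. \<forall>i\<le>n. norm (\<beta> i) \<le> 1"
  shows "\<exists>h. (\<forall>i. h i \<in> dual smul) \<and>
    (\<forall>\<beta>\<in>B. norm (\<Sum>i\<le>n. scale_functional (\<beta> i) (h i)) \<le> \<rho>) \<and>
    (\<forall>i<n. \<forall>x\<in>F. blinfun_apply (h i) x = blinfun_apply (g i) x) \<and>
    (\<forall>x\<in>F. blinfun_apply (h n) x = 0) \<and>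
    s (h n) = of_real (C * norm_bidual smul s)"
proof -
  let ?N = "norm_bidual smul"
  obtain e where e: "e \<in> dual smul" "\<And>x. x \<in> F \<Longrightarrow> blinfun_apply e x = 0" "s e = of_real (C * ?N s)"
    by (rule singular_separated[OF s F]) (rule that)
  define h0 where "h0 i = (if i < n then g i else if i = n then e else 0)" for i
  have h0: "h0 i \<in> dual smul" for i using g e by (simp add: h0_def)
  define comb where "comb h \<beta> = (\<Sum>i\<le>n. scale_functional (\<beta> i) (h i))" for h :: "nat \<Rightarrow> ('a \<Rightarrow>\<^sub>L 'k)" and \<beta>
  define L where "L = {h. (\<forall>i. h i \<in> dual smul) \<and> (\<forall>i\<le>n. \<forall>x\<in>F. blinfun_apply (h i) x = 0) \<and> s (h n) = 0}"
  interpret V: vector_space "scale_functional :: 'k \<Rightarrow> ('a \<Rightarrow>\<^sub>L 'k) \<Rightarrow> _" by (rule vector_space_scale_functional)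
  have comb_add: "comb (\<lambda>i. h i + h' i) \<beta> = comb h \<beta> + comb h' \<beta>" for h h' \<beta>
    by (simp add: comb_def V.scale_right_distrib sum.distrib)
  have comb_scale: "comb (\<lambda>i. scale_functional c (h i)) \<beta> = scale_functional c (comb h \<beta>)" for h c \<beta>
    by (simp add: comb_def V.scale_sum_right mult.commute)
  have L0: "(\<lambda>i. 0) \<in> L" using bidual_zeroD[OF s(1)] by (simp add: L_def)
  have comb0: "comb (\<lambda>i. 0) \<beta> = 0" for \<beta> by (simp add: comb_def)
  have Ladd: "(\<lambda>i. h i + h' i) \<in> L" if "h \<in> L" "h' \<in> L" for h h'
    using that bidual_addD[OF s(1)] by (simp add: L_def dual_add blinfun.add_left)
  have Lscale: "(\<lambda>i. scale_functional c (h i)) \<in> L" if "h \<in> L" for h c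
    using that bidual_scaleD[OF s(1)] by (simp add: L_def dual_scale)
  \<comment> \<open>\<open>p\<close> is the distance from \<open>L\<close> in the supremum norm over \<open>B\<close>.\<close>
  define S where "S v = {r. 0 \<le> r \<and> (\<exists>h\<in>L. \<forall>\<beta>\<in>B. norm (v \<beta> - comb h \<beta>) \<le> r)}"
    for v :: "(nat \<Rightarrow> 'k) \<Rightarrow> ('a \<Rightarrow>\<^sub>L 'k)"
  define p where "p v = Inf (S v)" for v
  have S_ne: "S v \<noteq> {}" for v
  proof -
    have "(\<Sum>\<beta>\<in>B. norm (v \<beta>)) \<in> S v"
      unfolding S_def using L0 B(1)
      by (auto intro!: sum_nonneg bexI[of _ "\<lambda>i. 0"] member_le_sum simp: comb0)
    then show ?thesis by blast
  qed
  have S_bdd: "bdd_below (S v)" for v by (rule bdd_belowI[of _ 0]) (simp add: S_def)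
  have p_le: "p v \<le> r" if "r \<in> S v" for v r unfolding p_def using S_bdd that by (rule cInf_lower[rotated])
  have p_ge: "r \<le> p v" if "\<And>t. t \<in> S v \<Longrightarrow> r \<le> t" for v r
    unfolding p_def using S_ne that by (rule cInf_greatest)
  have p_add: "p (v + w) \<le> p v + p w" for v w
  proof -
    have "p (v + w) - b \<le> p v" if b: "b \<in> S w" for b
    proof (rule p_ge)
      fix a assume a: "a \<in> S v"
      obtain h where h: "h \<in> L" "\<And>\<beta>. \<beta> \<in> B \<Longrightarrow> norm (v \<beta> - comb h \<beta>) \<le> a" using a by (auto simp: S_def)
      obtain h' where h': "h' \<in> L" "\<And>\<beta>. \<beta> \<in> B \<Longrightarrow> norm (w \<beta> - comb h' \<beta>) \<le> b" using b by (auto simp: S_def)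
      have "norm ((v + w) \<beta> - comb (\<lambda>i. h i + h' i) \<beta>) \<le> a + b" if "\<beta> \<in> B" for \<beta>
      proof -
        have "(v + w) \<beta> - comb (\<lambda>i. h i + h' i) \<beta> = (v \<beta> - comb h \<beta>) + (w \<beta> - comb h' \<beta>)"
          by (simp add: comb_add)
        then show ?thesis using h(2)[OF that] h'(2)[OF that] norm_triangle_mono by metis
      qed
      then have "a + b \<in> S (v + w)" using a b Ladd[OF h(1) h'(1)] by (auto simp: S_def)
      then show "p (v + w) - b \<le> a" using p_le by fastforce
    qed
    then have "p (v + w) - p v \<le> p w" by (intro p_ge) (smt (verit))
    then show ?thesis by simp
  qed
  define sc where "sc c v = (\<lambda>\<beta>. scale_functional c (v \<beta>))" for c :: 'k and v :: "(nat \<Rightarrow> 'k) \<Rightarrow> ('a \<Rightarrow>\<^sub>L 'k)"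
  have vs: "vector_space sc"
    by unfold_locales (auto simp: sc_def V.scale_right_distrib V.scale_left_distrib)
  have p_scale_le: "p (sc c v) \<le> norm c * p v" for c v
  proof (cases "c = 0")
    case True
    have "0 \<in> S (sc c v)" using L0 True by (auto simp: S_def sc_def comb0 intro!: bexI[of _ "\<lambda>i. 0"])
    then show ?thesis using True p_le by simp
  next
    case False
    have "p (sc c v) / norm c \<le> p v"
    proof (rule p_ge)
      fix a assume a: "a \<in> S v"
      obtain h where h: "h \<in> L" "\<And>\<beta>. \<beta> \<in> B \<Longrightarrow> norm (v \<beta> - comb h \<beta>) \<le> a" using a by (auto simp: S_def)
      have "norm (sc c v \<beta> - comb (\<lambda>i. scale_functional c (h i)) \<beta>) \<le> norm c * a" if "\<beta> \<in> B" for \<beta>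
        using h(2)[OF that]
        by (simp add: sc_def comb_scale norm_scale_functional mult_left_mono flip: V.scale_right_diff_distrib)
      then have "norm c * a \<in> S (sc c v)" using a Lscale[OF h(1)] by (auto simp: S_def)
      then show "p (sc c v) / norm c \<le> a" using p_le[of "norm c * a"] False by (simp add: field_simps)
    qed
    then show ?thesis using False by (simp add: field_simps)
  qed
  have p_scale: "p (sc c v) = norm c * p v" for c v
  proof (cases "c = 0")
    case True
    have "0 \<le> p (sc c v)" by (rule p_ge) (simp add: S_def)
    then show ?thesis using p_scale_le[of c v] True by simp
  next
    case False
    have "p (sc (inverse c) (sc c v)) \<le> norm (inverse c) * p (sc c v)" by (rule p_scale_le)
    moreover have "sc (inverse c) (sc c v) = v" using False by (simp add: sc_def)
    ultimately have "norm c * p v \<le> p (sc c v)" using False by (simp add: norm_inverse norm_divide field_simps)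
    then show ?thesis using p_scale_le[of c v] by simp
  qed
  have p_L: "p (comb h) = 0" if "h \<in> L" for h
  proof (rule antisym)
    show "p (comb h) \<le> 0" by (rule p_le) (use that in \<open>auto simp: S_def\<close>)
    show "0 \<le> p (comb h)" by (rule p_ge) (simp add: S_def)
  qed
  have p_off: "p v = 0" if "\<And>\<beta>. \<beta> \<in> B \<Longrightarrow> v \<beta> = 0" for v
  proof (rule antisym)
    show "p v \<le> 0" by (rule p_le) (use that L0 in \<open>auto simp: S_def comb0 intro!: bexI[of _ "\<lambda>i. 0"]\<close>)
    show "0 \<le> p v" by (rule p_ge) (simp add: S_def)
  qed
  have p_sup: "p v \<le> r" if "0 \<le> r" "\<And>\<beta>. \<beta> \<in> B \<Longrightarrow> norm (v \<beta>) \<le> r" for v r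
    by (rule p_le) (use that L0 in \<open>auto simp: S_def comb0 intro!: bexI[of _ "\<lambda>i. 0"]\<close>)
  have "p (comb h0) \<le> C"
  proof -
    obtain \<Phi> where \<Phi>_add: "\<And>x y. \<Phi> (x + y) = \<Phi> x + \<Phi> y" and \<Phi>_scale: "\<And>c x. \<Phi> (sc c x) = c * \<Phi> x"
      and \<Phi>_le: "\<And>x. norm (\<Phi> x) \<le> p x" and \<Phi>_u: "p (comb h0) \<le> norm (\<Phi> (comb h0))"
      by (rule seminorm_norming_functional[where p=p and u="comb h0", OF vs p_add p_scale]) (rule that)
    \<comment> \<open>Restricting \<open>\<Phi>\<close> to families supported at one \<open>\<beta>\<close> gives its component \<open>\<xi> \<beta>\<close>.\<close>
    define single where "single \<beta> f = (\<lambda>\<beta>'. if \<beta>' = \<beta> then f else 0)" for \<beta> :: "nat \<Rightarrow> 'k" and f :: "'a \<Rightarrow>\<^sub>L 'k"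
    define \<xi> where "\<xi> \<beta> f = (if f \<in> dual smul then \<Phi> (single \<beta> f) else 0)" for \<beta> f
    have \<xi>: "\<xi> \<beta> \<in> bidual smul" for \<beta>
    proof (rule bidualI[of _ _ 1])
      fix f g :: "'a \<Rightarrow>\<^sub>L 'k" assume f: "f \<in> dual smul"
      have "single \<beta> (scale_functional c f) = sc c (single \<beta> f)" for c by (auto simp: single_def sc_def)
      then show "\<xi> \<beta> (scale_functional c f) = c * \<xi> \<beta> f" for c using f by (simp add: \<xi>_def dual_scale \<Phi>_scale)
      have "norm (\<Phi> (single \<beta> f)) \<le> norm f"
        by (rule order_trans[OF \<Phi>_le p_sup]) (auto simp: single_def)
      then show "norm (\<xi> \<beta> f) \<le> 1 * norm f" by (simp add: \<xi>_def)
      assume g: "g \<in> dual smul"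
      have "single \<beta> (f + g) = single \<beta> f + single \<beta> g" by (auto simp: single_def)
      then show "\<xi> \<beta> (f + g) = \<xi> \<beta> f + \<xi> \<beta> g" using f g by (simp add: \<xi>_def dual_add \<Phi>_add)
    qed (simp add: \<xi>_def)
    have \<Phi>0: "\<Phi> 0 = 0" using \<Phi>_add[of 0 0] by simp
    have \<Phi>_eq: "\<Phi> v = (\<Sum>\<beta>\<in>B. \<xi> \<beta> (v \<beta>))" if v: "\<And>\<beta>. \<beta> \<in> B \<Longrightarrow> v \<beta> \<in> dual smul" for v
    proof -
      have part: "\<Phi> (\<lambda>\<beta>. if \<beta> \<in> A then v \<beta> else 0) = (\<Sum>\<beta>\<in>A. \<xi> \<beta> (v \<beta>))" if "finite A" "A \<subseteq> B" for A
        using that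
      proof (induction A rule: finite_induct)
        case empty
        then show ?case using \<Phi>0 by (simp add: zero_fun_def)
      next
        case (insert b A)
        have "(\<lambda>\<beta>. if \<beta> \<in> insert b A then v \<beta> else 0) = single b (v b) + (\<lambda>\<beta>. if \<beta> \<in> A then v \<beta> else 0)"
          using insert.hyps by (auto simp: single_def)
        moreover have "\<xi> b (v b) = \<Phi> (single b (v b))" using v insert.prems by (simp add: \<xi>_def)
        ultimately show ?case using insert by (simp add: \<Phi>_add)
      qed
      have "\<Phi> (v - (\<lambda>\<beta>. if \<beta> \<in> B then v \<beta> else 0)) = 0"
        using \<Phi>_le[of "v - (\<lambda>\<beta>. if \<beta> \<in> B then v \<beta> else 0)"] p_off[of "v - (\<lambda>\<beta>. if \<beta> \<in> B then v \<beta> else 0)"] by simp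
      then show ?thesis
        using \<Phi>_add[of "v - (\<lambda>\<beta>. if \<beta> \<in> B then v \<beta> else 0)" "\<lambda>\<beta>. if \<beta> \<in> B then v \<beta> else 0"] part[OF B(1)] by simp
    qed
    \<comment> \<open>Almost norming all components at once by a family from the unit ball of the supremum norm.\<close>
    have total: "(\<Sum>\<beta>\<in>B. ?N (\<xi> \<beta>)) \<le> 1"
    proof (rule field_le_epsilon)
      fix d :: real assume d: "0 < d"
      define d' where "d' = d / (card B + 1)"
      have d': "0 < d'" using d by (simp add: d'_def)
      have "\<exists>f. f \<in> dual smul \<and> norm f \<le> 1 \<and> \<xi> \<beta> f = of_real (norm (\<xi> \<beta> f)) \<and> ?N (\<xi> \<beta>) - d' < norm (\<xi> \<beta> f)" for \<beta>
      proof -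
        obtain f where f: "f \<in> dual smul" "norm f \<le> 1" "?N (\<xi> \<beta>) - d' < norm (\<xi> \<beta> f)"
          using norm_bidual_approx[OF \<xi>, of "?N (\<xi> \<beta>) - d'" \<beta>] d' by auto
        define c where "c = (if \<xi> \<beta> f = 0 then 1 else of_real (norm (\<xi> \<beta> f)) / \<xi> \<beta> f)"
        have c: "norm c = 1" "c * \<xi> \<beta> f = of_real (norm (\<xi> \<beta> f))" by (auto simp: c_def norm_divide)
        show ?thesis
          by (rule exI[of _ "scale_functional c f"])
            (use f c in \<open>simp add: dual_scale norm_scale_functional bidual_scaleD[OF \<xi> f(1)]\<close>)
      qed
      then obtain f where f: "\<And>\<beta>. f \<beta> \<in> dual smul" "\<And>\<beta>. norm (f \<beta>) \<le> 1"
        "\<And>\<beta>. \<xi> \<beta> (f \<beta>) = of_real (norm (\<xi> \<beta> (f \<beta>)))" "\<And>\<beta>. ?N (\<xi> \<beta>) - d' < norm (\<xi> \<beta> (f \<beta>))" by metis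
      have "(\<Sum>\<beta>\<in>B. ?N (\<xi> \<beta>)) \<le> (\<Sum>\<beta>\<in>B. norm (\<xi> \<beta> (f \<beta>)) + d')"
        using f(4) by (intro sum_mono) (smt (verit))
      also have "\<dots> = (\<Sum>\<beta>\<in>B. norm (\<xi> \<beta> (f \<beta>))) + card B * d'" by (simp add: sum.distrib)
      also have "(\<Sum>\<beta>\<in>B. norm (\<xi> \<beta> (f \<beta>))) = norm (\<Phi> f)"
      proof -
        have "\<Phi> f = (\<Sum>\<beta>\<in>B. \<xi> \<beta> (f \<beta>))" using f(1) by (intro \<Phi>_eq)
        also have "\<dots> = (\<Sum>\<beta>\<in>B. of_real (norm (\<xi> \<beta> (f \<beta>))))" using f(3) by (intro sum.cong) auto
        also have "\<dots> = of_real (\<Sum>\<beta>\<in>B. norm (\<xi> \<beta> (f \<beta>)))" by simp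
        finally have "norm (\<Phi> f) = \<bar>\<Sum>\<beta>\<in>B. norm (\<xi> \<beta> (f \<beta>))\<bar>" by (metis norm_of_real)
        moreover have "0 \<le> (\<Sum>\<beta>\<in>B. norm (\<xi> \<beta> (f \<beta>)))" by (intro sum_nonneg) simp
        ultimately show ?thesis by simp
      qed
      also have "norm (\<Phi> f) \<le> 1" by (rule order_trans[OF \<Phi>_le p_sup]) (use f in auto)
      also have "card B * d' \<le> d" using d by (simp add: d'_def field_simps)
      finally show "(\<Sum>\<beta>\<in>B. ?N (\<xi> \<beta>)) \<le> 1 + d" by simp
    qed
    define \<Xi> where "\<Xi> i = (\<Sum>\<beta>\<in>B. scale_bidual (\<beta> i) (\<xi> \<beta>))" for i
    have \<Xi>: "\<Xi> i \<in> bidual smul" for i unfolding \<Xi>_def by (intro bidual_sum bidual_scale \<xi>)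
    have \<Xi>_apply: "\<Xi> i f = (\<Sum>\<beta>\<in>B. \<beta> i * \<xi> \<beta> f)" for i f
      by (simp add: \<Xi>_def sum_fun_apply scale_bidual_def)
    have comb_dual: "comb h \<beta> \<in> dual smul" if "\<And>i. h i \<in> dual smul" for h \<beta>
      unfolding comb_def using that by (intro dual_sum dual_scale)
    have \<Phi>_comb: "\<Phi> (comb h) = (\<Sum>i\<le>n. \<Xi> i (h i))" if h: "\<And>i. h i \<in> dual smul" for h
    proof -
      have "\<Phi> (comb h) = (\<Sum>\<beta>\<in>B. \<xi> \<beta> (comb h \<beta>))" by (intro \<Phi>_eq comb_dual h)
      also have "\<dots> = (\<Sum>\<beta>\<in>B. \<Sum>i\<le>n. \<beta> i * \<xi> \<beta> (h i))"
        using h by (simp add: comb_def bidual_sumD[OF \<xi>] dual_scale bidual_scaleD[OF \<xi>])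
      also have "\<dots> = (\<Sum>i\<le>n. \<Xi> i (h i))" by (subst sum.swap) (simp add: \<Xi>_apply)
      finally show ?thesis .
    qed
    \<comment> \<open>A family in \<open>L\<close> with a single nonzero member isolates \<open>\<Xi> k\<close>.\<close>
    have \<Xi>_L: "\<Xi> k f = 0" if k: "k \<le> n" and f: "f \<in> dual smul" "\<And>x. x \<in> F \<Longrightarrow> blinfun_apply f x = 0"
      and sf: "k = n \<Longrightarrow> s f = 0" for k f
    proof -
      define h where "h i = (if i = k then f else 0)" for i
      have h: "h i \<in> dual smul" for i using f by (simp add: h_def)
      have "h \<in> L" unfolding L_def using h f sf bidual_zeroD[OF s(1)] by (auto simp: h_def)
      then have "\<Phi> (comb h) = 0" using p_L[of h] \<Phi>_le[of "comb h"] by simp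
      then have "(\<Sum>i\<le>n. \<Xi> i (h i)) = 0" using \<Phi>_comb[OF h] by simp
      also have "(\<Sum>i\<le>n. \<Xi> i (h i)) = (\<Sum>i\<le>n. if i = k then \<Xi> k f else 0)"
        by (intro sum.cong) (auto simp: h_def bidual_zeroD[OF \<Xi>])
      finally show ?thesis using k by simp
    qed
    have P\<Xi>: "P (\<Xi> i) = (\<Sum>\<beta>\<in>B. scale_bidual (\<beta> i) (P (\<xi> \<beta>)))" for i
      unfolding \<Xi>_def by (simp add: P_sum bidual_scale \<xi> P_scale)
    have fixed: "P (\<Xi> i) = \<Xi> i" if "i < n" for i
    proof -
      have "\<forall>f\<in>dual smul. (\<forall>x\<in>F. blinfun_apply f x = 0) \<longrightarrow> 0 f = (0 :: 'k) \<longrightarrow> \<Xi> i f = 0"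
        using \<Xi>_L[of i] that by simp
      from vanishing_imp_canonical_plus_multiple[OF \<Xi>[of i] bidual_zero F this]
      obtain w c where "\<Xi> i = canonical_embedding smul w + scale_bidual c 0" by (elim exE conjE) (rule that)
      then have "\<Xi> i = canonical_embedding smul w" by (auto simp: scale_bidual_def)
      then show ?thesis using P_canonical by simp
    qed
    have "\<forall>f\<in>dual smul. (\<forall>x\<in>F. blinfun_apply f x = 0) \<longrightarrow> s f = 0 \<longrightarrow> \<Xi> n f = 0"
      using \<Xi>_L[of n] by simp
    from vanishing_imp_canonical_plus_multiple[OF \<Xi>[of n] s(1) F this]
    \<comment> \<open>The part in \<open>X\<close> does not see the new functional, since \<open>e\<close> vanishes on \<open>F\<close>.\<close>
    obtain w c where w: "\<Xi> n = canonical_embedding smul w + scale_bidual c s"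
      "\<And>f. f \<in> dual smul \<Longrightarrow> (\<And>x. x \<in> F \<Longrightarrow> blinfun_apply f x = 0) \<Longrightarrow> blinfun_apply f w = 0" by blast
    have "P (scale_bidual c s) = 0" using P_scale[OF s(1), of c] s(2) by (auto simp: scale_bidual_def)
    then have "P (\<Xi> n) = canonical_embedding smul w"
      unfolding w(1) P_add[OF canonical_bidual bidual_scale[OF s(1)]] by (simp add: P_canonical)
    then have cs: "scale_bidual c s = \<Xi> n - P (\<Xi> n)" using w(1) by simp
    have Ncs: "?N (scale_bidual c s) \<le> (\<Sum>\<beta>\<in>B. ?N (\<xi> \<beta> - P (\<xi> \<beta>)))"
    proof (rule norm_bidual_le)
      have Q: "\<xi> \<beta> - P (\<xi> \<beta>) \<in> bidual smul" for \<beta> by (intro bidual_diff \<xi> P_bidual)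
      then show "0 \<le> (\<Sum>\<beta>\<in>B. ?N (\<xi> \<beta> - P (\<xi> \<beta>)))" by (intro sum_nonneg norm_bidual_nonneg)
      fix f assume f: "f \<in> dual smul"
      have "scale_bidual c s f = (\<Sum>\<beta>\<in>B. \<beta> n * (\<xi> \<beta> - P (\<xi> \<beta>)) f)"
        unfolding cs P\<Xi> by (simp add: \<Xi>_apply sum_fun_apply scale_bidual_def sum_subtractf right_diff_distrib)
      also have "norm \<dots> \<le> (\<Sum>\<beta>\<in>B. norm (\<beta> n * (\<xi> \<beta> - P (\<xi> \<beta>)) f))" by (rule norm_sum)
      also have "\<dots> \<le> (\<Sum>\<beta>\<in>B. ?N (\<xi> \<beta> - P (\<xi> \<beta>)) * norm f)"
      proof (rule sum_mono)
        fix \<beta> assume "\<beta> \<in> B"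
        then have "norm (\<beta> n * (\<xi> \<beta> - P (\<xi> \<beta>)) f) \<le> 1 * norm ((\<xi> \<beta> - P (\<xi> \<beta>)) f)"
          unfolding norm_mult using B(2) by (intro mult_right_mono) auto
        then show "norm (\<beta> n * (\<xi> \<beta> - P (\<xi> \<beta>)) f) \<le> ?N (\<xi> \<beta> - P (\<xi> \<beta>)) * norm f"
          using bidual_norm_le[OF Q f, of \<beta>] by linarith
      qed
      finally show "norm (scale_bidual c s f) \<le> (\<Sum>\<beta>\<in>B. ?N (\<xi> \<beta> - P (\<xi> \<beta>))) * norm f"
        by (simp add: sum_distrib_right)
    qed
    have "\<Phi> (comb h0) = (\<Sum>i<n. \<Xi> i (h0 i)) + \<Xi> n (h0 n)"
      using \<Phi>_comb[OF h0] by (simp flip: lessThan_Suc_atMost)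
    moreover have "\<Xi> n (h0 n) = c * of_real (C * ?N s)"
      unfolding w(1) using e w(2)[OF e(1,2)] by (simp add: h0_def scale_bidual_def)
    moreover have "norm (c * of_real (C * ?N s)) = C * ?N (scale_bidual c s)"
      using C norm_bidual_nonneg[OF s(1)] by (simp add: norm_bidual_scale[OF s(1)] norm_mult)
    moreover have "norm (\<Sum>i<n. \<Xi> i (h0 i)) \<le> C * (\<Sum>\<beta>\<in>B. ?N (P (\<xi> \<beta>)))"
    proof -
      have "(\<Sum>i<n. \<Xi> i (h0 i)) = (\<Sum>i<n. (\<Sum>\<beta>\<in>B. \<beta> i * P (\<xi> \<beta>) (g i)))"
      proof (rule sum.cong)
        fix i assume i: "i \<in> {..<n}"
        then have "\<Xi> i (h0 i) = P (\<Xi> i) (g i)" using fixed by (simp add: h0_def)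
        then show "\<Xi> i (h0 i) = (\<Sum>\<beta>\<in>B. \<beta> i * P (\<xi> \<beta>) (g i))"
          by (simp add: P\<Xi> sum_fun_apply scale_bidual_def)
      qed simp
      also have "\<dots> = (\<Sum>\<beta>\<in>B. P (\<xi> \<beta>) (\<Sum>i<n. scale_functional (\<beta> i) (g i)))"
      proof (subst sum.swap, intro sum.cong refl)
        fix \<beta>
        have "P (\<xi> \<beta>) (\<Sum>i<n. scale_functional (\<beta> i) (g i)) = (\<Sum>i<n. P (\<xi> \<beta>) (scale_functional (\<beta> i) (g i)))"
          using g by (intro bidual_sumD[OF P_bidual[OF \<xi>]] dual_scale) auto
        also have "\<dots> = (\<Sum>i<n. \<beta> i * P (\<xi> \<beta>) (g i))"
          using g by (intro sum.cong bidual_scaleD[OF P_bidual[OF \<xi>]]) auto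
        finally show "(\<Sum>i<n. \<beta> i * P (\<xi> \<beta>) (g i)) = P (\<xi> \<beta>) (\<Sum>i<n. scale_functional (\<beta> i) (g i))" ..
      qed
      also have "norm \<dots> \<le> (\<Sum>\<beta>\<in>B. norm (P (\<xi> \<beta>) (\<Sum>i<n. scale_functional (\<beta> i) (g i))))" by (rule norm_sum)
      also have "\<dots> \<le> (\<Sum>\<beta>\<in>B. ?N (P (\<xi> \<beta>)) * C)"
      proof (rule sum_mono)
        fix \<beta> assume b: "\<beta> \<in> B"
        have "norm (P (\<xi> \<beta>) (\<Sum>i<n. scale_functional (\<beta> i) (g i)))
          \<le> ?N (P (\<xi> \<beta>)) * norm (\<Sum>i<n. scale_functional (\<beta> i) (g i))"
          using g by (intro bidual_norm_le P_bidual \<xi> dual_sum dual_scale) auto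
        also have "\<dots> \<le> ?N (P (\<xi> \<beta>)) * C"
          using B(2)[rule_format, OF b] by (intro mult_left_mono gC[rule_format] norm_bidual_nonneg P_bidual \<xi>) auto
        finally show "norm (P (\<xi> \<beta>) (\<Sum>i<n. scale_functional (\<beta> i) (g i))) \<le> ?N (P (\<xi> \<beta>)) * C" .
      qed
      finally show ?thesis by (simp add: sum_distrib_left mult.commute)
    qed
    moreover have "C * (\<Sum>\<beta>\<in>B. ?N (P (\<xi> \<beta>))) + C * ?N (scale_bidual c s) \<le> C * 1"
    proof -
      have "(\<Sum>\<beta>\<in>B. ?N (P (\<xi> \<beta>))) + ?N (scale_bidual c s)
        \<le> (\<Sum>\<beta>\<in>B. ?N (P (\<xi> \<beta>))) + (\<Sum>\<beta>\<in>B. ?N (\<xi> \<beta> - P (\<xi> \<beta>)))" using Ncs by simp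
      also have "\<dots> = (\<Sum>\<beta>\<in>B. ?N (\<xi> \<beta>))" by (simp add: P_norm[OF \<xi>] flip: sum.distrib)
      finally have "(\<Sum>\<beta>\<in>B. ?N (P (\<xi> \<beta>))) + ?N (scale_bidual c s) \<le> 1" using total by simp
      then show ?thesis using C by (metis distrib_left mult_left_mono)
    qed
    ultimately have "norm (\<Phi> (comb h0)) \<le> C"
      using norm_triangle_ineq[of "\<Sum>i<n. \<Xi> i (h0 i)" "c * of_real (C * ?N s)"] by simp
    then show ?thesis using \<Phi>_u by simp
  qed
  then have "p (comb h0) < \<rho>" using C by simp
  then obtain r where "r \<in> S (comb h0)" "r < \<rho>"
    unfolding p_def using cInf_lessD[OF S_ne] by blast
  then obtain h1 where h1: "h1 \<in> L" "\<And>\<beta>. \<beta> \<in> B \<Longrightarrow> norm (comb h0 \<beta> - comb h1 \<beta>) \<le> \<rho>"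
    unfolding S_def by force
  define h where "h i = h0 i + scale_functional (- 1) (h1 i)" for i
  have h1d: "h1 i \<in> dual smul" for i using h1(1) by (simp add: L_def)
  show ?thesis
  proof (intro exI[of _ h] conjI allI ballI impI)
    show "h i \<in> dual smul" for i unfolding h_def by (intro dual_add dual_scale h0 h1d)
    show "norm (\<Sum>i\<le>n. scale_functional (\<beta> i) (h i)) \<le> \<rho>" if "\<beta> \<in> B" for \<beta>
    proof -
      have "(\<Sum>i\<le>n. scale_functional (\<beta> i) (h i)) = comb h0 \<beta> - comb h1 \<beta>"
        unfolding comb_def[symmetric] h_def comb_add comb_scale by simp
      then show ?thesis using h1(2)[OF that] by simp
    qed
    show "blinfun_apply (h i) x = blinfun_apply (g i) x" if "i < n" "x \<in> F" for i x
      using that h1(1) by (simp add: h_def h0_def L_def blinfun.add_left blinfun.diff_left)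
    show "blinfun_apply (h n) x = 0" if "x \<in> F" for x
      using that h1(1) e by (simp add: h_def h0_def L_def blinfun.add_left blinfun.diff_left)
    show "s (h n) = of_real (C * ?N s)"
    proof -
      have "s (h n) = s (h0 n) + - 1 * s (h1 n)"
        unfolding h_def bidual_addD[OF s(1) h0 dual_scale[OF h1d]] bidual_scaleD[OF s(1) h1d] ..
      then show ?thesis using h1(1) e(3) by (simp add: h0_def L_def)
    qed
  qed
qed

text \<open>
  A finite net of coefficients suffices, because the unit coefficient vectors in it bound the norms of the
  individual functionals, which controls the error of approximating arbitrary coefficients.
\<close>

lemma extend_c0_family:
  fixes g :: "nat \<Rightarrow> ('a \<Rightarrow>\<^sub>L 'k)"
  assumes g: "\<forall>i<n. g i \<in> dual smul" and C: "0 \<le> C" "C < C'"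
    and gC: "\<forall>\<beta>. (\<forall>i<n. norm (\<beta> i) \<le> 1) \<longrightarrow> norm (\<Sum>i<n. scale_functional (\<beta> i) (g i)) \<le> C"
    and F: "finite F" and s: "s \<in> bidual smul" "P s = 0" "s \<noteq> 0"
  shows "\<exists>h. (\<forall>i. h i \<in> dual smul) \<and>
    (\<forall>\<beta>. (\<forall>i\<le>n. norm (\<beta> i) \<le> 1) \<longrightarrow> norm (\<Sum>i\<le>n. scale_functional (\<beta> i) (h i)) \<le> C') \<and>
    (\<forall>i<n. \<forall>x\<in>F. blinfun_apply (h i) x = blinfun_apply (g i) x) \<and>
    (\<forall>x\<in>F. blinfun_apply (h n) x = 0) \<and>
    s (h n) = of_real (C * norm_bidual smul s)"
proof -
  interpret V: vector_space "scale_functional :: 'k \<Rightarrow> ('a \<Rightarrow>\<^sub>L 'k) \<Rightarrow> _" by (rule vector_space_scale_functional)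
  define \<rho> where "\<rho> = (C + C') / 2"
  have \<rho>: "C < \<rho>" "\<rho> < C'" "0 < \<rho>" using C by (auto simp: \<rho>_def)
  define \<delta> where "\<delta> = (C' - \<rho>) / (\<rho> * (real n + 1))"
  have \<delta>: "0 < \<delta>" using \<rho> by (simp add: \<delta>_def)
  obtain D :: "'k set" where D: "finite D" "D \<subseteq> cball 0 1"
    "\<And>z. norm z \<le> 1 \<Longrightarrow> \<exists>d\<in>D. norm (z - d) \<le> \<delta>" by (rule finite_net_unit_ball[OF \<delta>]) (rule that)
  \<comment> \<open>The scalars \<open>0\<close> and \<open>1\<close> are added to have the unit coefficient vectors in \<open>B\<close>.\<close>
  define B where "B = Pi\<^sub>E {..n} (\<lambda>_. D \<union> {0, 1})"
  have Bf: "finite B" unfolding B_def using D(1) by (intro finite_PiE) simp_all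
  have Bb: "\<forall>\<beta>\<in>B. \<forall>i\<le>n. norm (\<beta> i) \<le> 1"
  proof (intro ballI allI impI)
    fix \<beta> i assume "\<beta> \<in> B" "i \<le> n"
    then have "\<beta> i \<in> D \<union> {0, 1}" unfolding B_def by auto
    then show "norm (\<beta> i) \<le> 1" using D(2) by auto
  qed
  obtain h where h: "\<forall>i. h i \<in> dual smul"
    "\<forall>\<beta>\<in>B. norm (\<Sum>i\<le>n. scale_functional (\<beta> i) (h i)) \<le> \<rho>"
    "\<forall>i<n. \<forall>x\<in>F. blinfun_apply (h i) x = blinfun_apply (g i) x"
    "\<forall>x\<in>F. blinfun_apply (h n) x = 0"
    "s (h n) = of_real (C * norm_bidual smul s)"
    using extend_family_on_finite_coefficient_set[OF g C(1) \<rho>(1) gC F s Bf Bb] by (elim exE conjE) (rule that)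
  have hn: "norm (h k) \<le> \<rho>" if "k \<le> n" for k
  proof -
    define \<beta> :: "nat \<Rightarrow> 'k" where "\<beta> = restrict (\<lambda>i. if i = k then 1 else 0) {..n}"
    have "\<beta> \<in> B" by (auto simp: \<beta>_def B_def)
    moreover have "(\<Sum>i\<le>n. scale_functional (\<beta> i) (h i)) = (\<Sum>i\<le>n. if i = k then h k else 0)"
      by (intro sum.cong) (auto simp: \<beta>_def)
    ultimately show ?thesis using h(2)[rule_format, of \<beta>] that by simp
  qed
  have bound: "\<forall>\<beta>. (\<forall>i\<le>n. norm (\<beta> i) \<le> 1) \<longrightarrow> norm (\<Sum>i\<le>n. scale_functional (\<beta> i) (h i)) \<le> C'"
  proof (intro allI impI)
    fix \<beta> :: "nat \<Rightarrow> 'k" assume \<beta>: "\<forall>i\<le>n. norm (\<beta> i) \<le> 1"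
    have "\<exists>d. d \<in> D \<and> (i \<le> n \<longrightarrow> norm (\<beta> i - d) \<le> \<delta>)" for i
    proof (cases "i \<le> n")
      case True
      then show ?thesis using D(3)[OF \<beta>[rule_format]] by blast
    next
      case False
      then show ?thesis using D(3)[of 0] by auto
    qed
    then have "\<forall>i. \<exists>d. d \<in> D \<and> (i \<le> n \<longrightarrow> norm (\<beta> i - d) \<le> \<delta>)" by (rule allI)
    from choice[OF this] obtain d where "\<forall>i. d i \<in> D \<and> (i \<le> n \<longrightarrow> norm (\<beta> i - d i) \<le> \<delta>)" by (elim exE)
    then have d: "d i \<in> D" "i \<le> n \<Longrightarrow> norm (\<beta> i - d i) \<le> \<delta>" for i by simp_all
    have dB: "restrict d {..n} \<in> B" using d(1) by (auto simp: B_def)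
    have "(\<Sum>i\<le>n. scale_functional (\<beta> i) (h i)) =
      (\<Sum>i\<le>n. scale_functional (restrict d {..n} i) (h i)) + (\<Sum>i\<le>n. scale_functional (\<beta> i - d i) (h i))"
      unfolding sum.distrib[symmetric] by (intro sum.cong) (simp_all add: V.scale_left_diff_distrib)
    also have "norm \<dots> \<le> \<rho> + (\<Sum>i\<le>n. \<delta> * \<rho>)"
    proof (rule norm_triangle_mono[OF h(2)[rule_format, OF dB] order_trans[OF norm_sum sum_mono]])
      fix i assume "i \<in> {..n}"
      then show "norm (scale_functional (\<beta> i - d i) (h i)) \<le> \<delta> * \<rho>"
        using d(2) hn \<delta> by (simp add: norm_scale_functional mult_mono)
    qed
    also have "\<rho> + (\<Sum>i\<le>n. \<delta> * \<rho>) = \<rho> + \<delta> * (\<rho> * (real n + 1))" by (simp add: algebra_simps)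
    also have "\<delta> * (\<rho> * (real n + 1)) = C' - \<rho>"
    proof -
      have "\<rho> * (real n + 1) \<noteq> 0" using \<rho>(3) by auto
      then show ?thesis by (simp add: \<delta>_def)
    qed
    finally show "norm (\<Sum>i\<le>n. scale_functional (\<beta> i) (h i)) \<le> C'" by simp
  qed
  show ?thesis
  proof (rule exI[of _ h], intro conjI)
  qed (fact h(1) bound h(3) h(4) h(5))+
qed

text \<open>
  Step \<open>n\<close> uses the singular element \<open>s n\<close>. The predicate \<open>R n\<close> is what is wanted of the value of the new
  functional at the point to be recorded. It must be attainable for functionals that vanish at \<open>a n\<close>,
  which in the application is the part in \<open>X\<close> of a cluster point with singular part \<open>s n\<close>.
\<close>

theorem exists_triangular_c0_family:
  assumes s: "\<And>n. s n \<in> bidual smul" "\<And>n. P (s n) = 0" "\<And>n. s n \<noteq> 0"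
    and sel: "\<forall>n N. \<forall>f\<in>dual smul. s n f = of_real (level n * norm_bidual smul (s n)) \<longrightarrow>
      blinfun_apply f (a n) = 0 \<longrightarrow> (\<exists>q>N. R n (blinfun_apply f (y q)))"
  shows "\<exists>g (p :: nat \<Rightarrow> nat). (\<forall>i. g i \<in> dual smul) \<and>
    (\<forall>n \<beta>. (\<forall>i<n. norm (\<beta> i) \<le> 1) \<longrightarrow> norm (\<Sum>i<n. scale_functional (\<beta> i) (g i)) \<le> 1) \<and>
    (\<lambda>i. norm (g i)) \<longlonglongrightarrow> 1 \<and> strict_mono p \<and>
    (\<forall>l i. l < i \<longrightarrow> blinfun_apply (g i) (y (p l)) = 0) \<and>
    (\<forall>n. R n (blinfun_apply (g n) (y (p n))))"
proof -
  let ?N = "norm_bidual smul"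
  \<comment> \<open>A state consists of the current functionals, the finite set of points whose values are to be kept,
    and the last recorded index. Only the first \<open>n\<close> functionals matter at step \<open>n\<close>.\<close>
  define I where "I n = (\<lambda>(G :: nat \<Rightarrow> ('a \<Rightarrow>\<^sub>L 'k), F :: 'a set, q :: nat). finite F \<and> (\<forall>i. G i \<in> dual smul) \<and>
    (\<forall>\<beta>. (\<forall>i<n. norm (\<beta> i) \<le> 1) \<longrightarrow> norm (\<Sum>i<n. scale_functional (\<beta> i) (G i)) \<le> level n))" for n
  define T where "T n = (\<lambda>(G :: nat \<Rightarrow> ('a \<Rightarrow>\<^sub>L 'k), F :: 'a set, q :: nat) (G' :: nat \<Rightarrow> ('a \<Rightarrow>\<^sub>L 'k), F' :: 'a set, q' :: nat).
    F \<subseteq> F' \<and> (\<forall>i<n. \<forall>x\<in>F. blinfun_apply (G' i) x = blinfun_apply (G i) x) \<and>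
    (\<forall>x\<in>F. blinfun_apply (G' n) x = 0) \<and> q < q' \<and> y q' \<in> F' \<and> R n (blinfun_apply (G' n) (y q')) \<and>
    (\<exists>w\<in>F'. norm w \<le> 1 \<and> level n - 1 / (real n + 1) \<le> norm (blinfun_apply (G' n) w)))" for n
  have "\<exists>f. \<forall>n. I n (f n) \<and> T n (f n) (f (Suc n))"
  proof (rule dependent_nat_choice)
    show "\<exists>S. I 0 S"
      by (rule exI[of _ "(\<lambda>_. 0, {}, 0)"]) (use level(1)[of 0] in \<open>simp add: I_def\<close>)
    fix S n assume S: "I n S"
    obtain G F q where GF: "S = (G, F, q)" by (cases S) auto
    have F: "finite (insert (a n) F)" and G: "\<forall>i<n. G i \<in> dual smul"
      and GC: "\<forall>\<beta>. (\<forall>i<n. norm (\<beta> i) \<le> 1) \<longrightarrow> norm (\<Sum>i<n. scale_functional (\<beta> i) (G i)) \<le> level n"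
      using S by (auto simp: I_def GF)
    obtain h where h: "\<forall>i. h i \<in> dual smul"
      "\<forall>\<beta>. (\<forall>i\<le>n. norm (\<beta> i) \<le> 1) \<longrightarrow> norm (\<Sum>i\<le>n. scale_functional (\<beta> i) (h i)) \<le> level (Suc n)"
      "\<forall>i<n. \<forall>x\<in>insert (a n) F. blinfun_apply (h i) x = blinfun_apply (G i) x"
      "\<forall>x\<in>insert (a n) F. blinfun_apply (h n) x = 0"
      "s n (h n) = of_real (level n * ?N (s n))"
      using extend_c0_family[OF G less_imp_le[OF level(1)] level(3) GC F s(1)[of n] s(2)[of n] s(3)[of n]] by (elim exE conjE) (rule that)
    have hn: "h n \<in> dual smul" using h(1) by simp
    obtain q' where q': "q < q'" "R n (blinfun_apply (h n) (y q'))"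
      using sel[rule_format, OF hn h(5), of q] h(4) by auto
    have Npos: "0 < ?N (s n)"
      using norm_bidual_nonneg[OF s(1)] norm_bidual_eq_0[OF s(1)] s(3) by (metis less_le)
    have "level n * ?N (s n) \<le> ?N (s n) * norm (h n)"
      using bidual_norm_le[OF s(1)[of n] hn] level(1)[of n] Npos unfolding h(5) norm_of_real by simp
    then have "level n \<le> norm (h n)" using Npos by (simp add: mult.commute)
    \<comment> \<open>Keeping the value at a point that almost norms the new functional prevents its norm from dropping in the limit.\<close>
    then have "level n - 1 / (real n + 1) < norm (h n)" by (smt (verit) of_nat_0_le_iff divide_pos_pos)
    then obtain w where w: "norm w \<le> 1" "level n - 1 / (real n + 1) \<le> norm (blinfun_apply (h n) w)"
      by (rule blinfun_norm_attained_approx)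
    have "I (Suc n) (h, insert w (insert (y q') F), q')"
      using F h(1,2) by (auto simp: I_def lessThan_Suc_atMost less_Suc_eq_le)
    moreover have "T n S (h, insert w (insert (y q') F), q')"
      using h(3,4) q' w by (auto simp: T_def GF)
    ultimately show "\<exists>S'. I (Suc n) S' \<and> T n S S'" by blast
  qed
  then obtain f where f: "\<And>n. I n (f n)" "\<And>n. T n (f n) (f (Suc n))" by blast
  define G F q where "G n = fst (f n)" and "F n = fst (snd (f n))" and "q n = snd (snd (f n))" for n
  have fn: "f n = (G n, F n, q n)" for n by (simp add: G_def F_def q_def)
  have Gd: "G n i \<in> dual smul" and
    GC: "(\<And>i. i < n \<Longrightarrow> norm (\<beta> i) \<le> 1) \<Longrightarrow> norm (\<Sum>i<n. scale_functional (\<beta> i) (G n i)) \<le> level n" for n i \<beta>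
    using f(1)[of n] by (auto simp: I_def fn)
  have T: "F n \<subseteq> F (Suc n)" "\<And>i x. i < n \<Longrightarrow> x \<in> F n \<Longrightarrow> blinfun_apply (G (Suc n) i) x = blinfun_apply (G n i) x"
    "\<And>x. x \<in> F n \<Longrightarrow> blinfun_apply (G (Suc n) n) x = 0" "q n < q (Suc n)" "y (q (Suc n)) \<in> F (Suc n)"
    "R n (blinfun_apply (G (Suc n) n) (y (q (Suc n))))"
    "\<exists>w\<in>F (Suc n). norm w \<le> 1 \<and> level n - 1 / (real n + 1) \<le> norm (blinfun_apply (G (Suc n) n) w)" for n
    using f(2)[of n] by (auto simp: T_def fn)
  have Fmono: "F k \<subseteq> F n" if "k \<le> n" for k n using T(1) that by (rule lift_Suc_mono_le)
  have stable: "blinfun_apply (G n i) x = blinfun_apply (G k i) x" if "k \<le> n" "i < k" "x \<in> F k" for n k i x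
    using that(1)
  proof (induction n rule: dec_induct)
    case (step n)
    then show ?case using T(2)[of i n x] that Fmono[of k n] by auto
  qed simp
  have Gn: "norm (\<Sum>i<n. scale_functional (\<beta> i) (G m i)) \<le> 1"
    if "n \<le> m" "\<And>i. i < n \<Longrightarrow> norm (\<beta> i) \<le> 1" for n m \<beta>
  proof -
    have "(\<Sum>i<n. scale_functional (\<beta> i) (G m i)) = (\<Sum>i<m. scale_functional (if i < n then \<beta> i else 0) (G m i))"
      using that(1) by (intro sum.mono_neutral_cong_left) (auto intro!: blinfun_eqI)
    also have "norm \<dots> \<le> level m" using that(2) by (intro GC) auto
    finally show ?thesis using level(2)[of m] by simp
  qed
  have G1: "norm (G m i) \<le> 1" if "i < m" for m i
  proof -
    have "(\<Sum>k<Suc i. scale_functional (if k = i then 1 else 0) (G m k)) = (\<Sum>k<Suc i. if k = i then G m i else 0)"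
      by (intro sum.cong) (auto intro!: blinfun_eqI)
    then show ?thesis using Gn[of "Suc i" m "\<lambda>k. if k = i then 1 else 0"] that by simp
  qed
  \<comment> \<open>All functionals are made to converge simultaneously; each one is defined from some step on.\<close>
  define H where "H n = (\<lambda>(i, x). if i < n then blinfun_apply (G n i) x else 0)" for n
  have "H n b \<in> cball 0 (norm (snd b))" for n b
  proof (cases b)
    case (Pair i x)
    then show ?thesis using order_trans[OF norm_blinfun mult_right_mono[OF G1[of i n]]] by (auto simp: H_def)
  qed
  then obtain \<F> L where \<F>: "\<F> \<le> sequentially" "\<F> \<noteq> bot" and L: "\<And>b. ((\<lambda>n. H n b) \<longlongrightarrow> L b) \<F>"
    by (rule pointwise_cluster_filter) (rule that)
  have ev: "eventually (\<lambda>n. k \<le> n) \<F>" for k using filter_leD[OF \<F>(1) eventually_ge_at_top] .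
  have lim: "((\<lambda>n. blinfun_apply (G n i) x) \<longlongrightarrow> L (i, x)) \<F>" for i x
    by (rule Lim_transform_eventually[OF L[of "(i, x)"] eventually_mono[OF ev[of "Suc i"]]]) (simp add: H_def)
  have Lle: "norm (L (i, x)) \<le> norm x" for i x
  proof (rule tendsto_upperbound[OF tendsto_norm[OF lim] eventually_mono[OF ev[of "Suc i"]] \<F>(2)])
    fix n assume "Suc i \<le> n"
    then show "norm (blinfun_apply (G n i) x) \<le> norm x"
      using order_trans[OF norm_blinfun mult_right_mono[OF G1[of i n]], of x] by simp
  qed
  have bl: "bounded_linear (\<lambda>x. L (i, x))" for i
  proof (rule bounded_linear_intro[of _ 1])
    fix u v :: 'a and t :: real
    have "((\<lambda>n. blinfun_apply (G n i) (u + v)) \<longlongrightarrow> L (i, u) + L (i, v)) \<F>"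
      unfolding blinfun.add_right by (intro tendsto_add lim)
    then show "L (i, u + v) = L (i, u) + L (i, v)" using tendsto_unique[OF \<F>(2) lim] by blast
    have "((\<lambda>n. blinfun_apply (G n i) (t *\<^sub>R u)) \<longlongrightarrow> t *\<^sub>R L (i, u)) \<F>"
      unfolding blinfun.scaleR_right by (intro tendsto_scaleR tendsto_const lim)
    then show "L (i, t *\<^sub>R u) = t *\<^sub>R L (i, u)" using tendsto_unique[OF \<F>(2) lim] by blast
  qed (simp add: Lle)
  define g where "g i = Blinfun (\<lambda>x. L (i, x))" for i
  have g: "blinfun_apply (g i) x = L (i, x)" for i x
    unfolding g_def using bounded_linear_Blinfun_apply[OF bl] by simp
  have gval: "blinfun_apply (g i) x = blinfun_apply (G k i) x" if "i < k" "x \<in> F k" for i k x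
  proof -
    have "((\<lambda>n. blinfun_apply (G n i) x) \<longlongrightarrow> blinfun_apply (G k i) x) \<F>"
      by (rule Lim_transform_eventually[OF tendsto_const eventually_mono[OF ev[of k]]])
        (use stable that in metis)
    then show ?thesis using tendsto_unique[OF \<F>(2) lim] g by simp
  qed
  have gd: "g i \<in> dual smul" for i
  proof -
    have "L (i, smul c x) = c * L (i, x)" for c x
    proof -
      have "((\<lambda>n. blinfun_apply (G n i) (smul c x)) \<longlongrightarrow> c * L (i, x)) \<F>"
        using tendsto_mult[OF tendsto_const lim[of i x], of c] Gd by (simp add: dual_def)
      then show ?thesis using tendsto_unique[OF \<F>(2) lim] by blast
    qed
    then show ?thesis by (simp add: dual_def g)
  qed
  have gb: "norm (\<Sum>i<n. scale_functional (\<beta> i) (g i)) \<le> 1" if \<beta>: "\<And>i. i < n \<Longrightarrow> norm (\<beta> i) \<le> 1" for n \<beta>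
  proof (rule norm_blinfun_bound)
    fix x
    have "((\<lambda>m. \<Sum>i<n. \<beta> i * blinfun_apply (G m i) x) \<longlongrightarrow> (\<Sum>i<n. \<beta> i * L (i, x))) \<F>"
      by (intro tendsto_sum tendsto_mult tendsto_const lim)
    then have "norm (\<Sum>i<n. \<beta> i * L (i, x)) \<le> norm x"
    proof (rule tendsto_upperbound[OF tendsto_norm eventually_mono[OF ev[of n]] \<F>(2)])
      fix m assume "n \<le> m"
      then have "norm (\<Sum>i<n. scale_functional (\<beta> i) (G m i)) \<le> 1" using \<beta> by (rule Gn)
      then show "norm (\<Sum>i<n. \<beta> i * blinfun_apply (G m i) x) \<le> norm x"
        using order_trans[OF norm_blinfun mult_right_mono, of "\<Sum>i<n. scale_functional (\<beta> i) (G m i)" 1 x]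
        by (simp add: blinfun.sum_left)
    qed
    then show "norm (blinfun_apply (\<Sum>i<n. scale_functional (\<beta> i) (g i)) x) \<le> 1 * norm x"
      by (simp add: blinfun.sum_left g)
  qed simp
  have gn: "norm (g i) \<le> 1" for i
  proof (rule norm_blinfun_bound)
    show "norm (blinfun_apply (g i) x) \<le> 1 * norm x" for x using Lle by (simp add: g)
  qed simp
  have glow: "level n - 1 / (real n + 1) \<le> norm (g n)" for n
  proof -
    obtain w where w: "w \<in> F (Suc n)" "norm w \<le> 1" "level n - 1 / (real n + 1) \<le> norm (blinfun_apply (G (Suc n) n) w)"
      using T(7)[of n] by blast
    have "norm (blinfun_apply (g n) w) \<le> norm (g n) * norm w" by (rule norm_blinfun)
    also have "\<dots> \<le> norm (g n) * 1" using w(2) by (intro mult_left_mono) auto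
    finally show ?thesis using w gval[of n "Suc n" w] by simp
  qed
  show ?thesis
  proof (intro exI[of _ g] exI[of _ "\<lambda>n. q (Suc n)"] conjI allI impI)
    show "(\<lambda>i. norm (g i)) \<longlonglongrightarrow> 1"
    proof (rule tendsto_sandwich[OF always_eventually always_eventually _ tendsto_const])
      show "(\<lambda>n. level n - 1 / (real n + 1)) \<longlonglongrightarrow> 1" unfolding level_def by real_asymp
    qed (use gn glow in auto)
    show "strict_mono (\<lambda>n. q (Suc n))" using T(4) by (simp add: strict_mono_Suc_iff)
    show "blinfun_apply (g i) (y (q (Suc l))) = 0" if "l < i" for l i
    proof -
      have "y (q (Suc l)) \<in> F i" using T(5) Fmono[of "Suc l" i] that by auto
      then show ?thesis using T(1)[of i] T(3)[of "y (q (Suc l))" i] gval[of i "Suc i" "y (q (Suc l))"] by auto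
    qed
    show "R n (blinfun_apply (g n) (y (q (Suc n))))" for n
      using T(5,6)[of n] gval[of n "Suc n"] by simp
    show "norm (\<Sum>i<n. scale_functional (\<beta> i) (g i)) \<le> 1" if "\<forall>i<n. norm (\<beta> i) \<le> 1" for n \<beta>
      by (rule gb) (simp add: that)
  qed (rule gd)
qed

end

section \<open>Weak-star convergent series of functionals\<close>

lemma norm_linfty_ge: "\<alpha> \<in> linfty \<Longrightarrow> norm (\<alpha> n) \<le> norm_linfty \<alpha>"
proof -
  assume "\<alpha> \<in> linfty"
  then obtain a where "\<And>n. norm (\<alpha> n) \<le> a" by (auto simp: linfty_def bounded_iff)
  then have "bdd_above (range (\<lambda>n. norm (\<alpha> n)))" by (intro bdd_aboveI2)
  then show ?thesis unfolding norm_linfty_def by (rule cSUP_upper2[OF _ _ order_refl]) simp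
qed

text \<open>
  The bound says that mapping the unit vectors of \<open>c\<^sub>0\<close> to \<open>g\<close> extends to a contraction; the weak-star sums
  extend it further to \<open>\<ell>\<^sup>\<infinity>\<close>.
\<close>

locale c0_family = banach_space_over smul
  for smul :: "'k::real_or_complex_field \<Rightarrow> 'a::banach \<Rightarrow> 'a" +
  fixes g :: "nat \<Rightarrow> ('a \<Rightarrow>\<^sub>L 'k)"
  assumes g_dual: "\<And>i. g i \<in> dual smul"
    and g_bound: "\<And>n \<beta>. (\<And>i. i < n \<Longrightarrow> norm (\<beta> i) \<le> 1) \<Longrightarrow>
      norm (\<Sum>i<n. scale_functional (\<beta> i) (g i)) \<le> 1"
begin

definition series :: "(nat \<Rightarrow> 'k) \<Rightarrow> ('a \<Rightarrow>\<^sub>L 'k)" where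
  "series \<gamma> = Blinfun (\<lambda>x. \<Sum>\<^sub>\<infinity>i. \<gamma> i * blinfun_apply (g i) x)"

text \<open>
  The coefficients are phases that turn all values at \<open>x\<close> into their absolute values.
\<close>

lemma sum_norm_apply_le: "(\<Sum>i<n. norm (blinfun_apply (g i) x)) \<le> norm x"
proof -
  define \<beta> where "\<beta> i = (if blinfun_apply (g i) x = 0 then 1
    else of_real (norm (blinfun_apply (g i) x)) / blinfun_apply (g i) x)" for i
  have \<beta>: "norm (\<beta> i) = 1" "\<beta> i * blinfun_apply (g i) x = of_real (norm (blinfun_apply (g i) x))" for i
    by (auto simp: \<beta>_def norm_divide)
  have "blinfun_apply (\<Sum>i<n. scale_functional (\<beta> i) (g i)) x = of_real (\<Sum>i<n. norm (blinfun_apply (g i) x))"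
    by (simp add: blinfun.sum_left \<beta>)
  then have "norm (blinfun_apply (\<Sum>i<n. scale_functional (\<beta> i) (g i)) x) = \<bar>\<Sum>i<n. norm (blinfun_apply (g i) x)\<bar>"
    by (simp only: norm_of_real)
  moreover have "norm (blinfun_apply (\<Sum>i<n. scale_functional (\<beta> i) (g i)) x) \<le> 1 * norm x"
    by (rule order_trans[OF norm_blinfun mult_right_mono[OF g_bound]]) (simp_all add: \<beta>)
  ultimately show ?thesis by linarith
qed

lemma bounded_coefficients_summable:
  assumes "\<And>i. norm (\<gamma> i) \<le> A"
  shows "(\<lambda>i. \<gamma> i * blinfun_apply (g i) x) abs_summable_on UNIV"
    and "norm (\<Sum>\<^sub>\<infinity>i. \<gamma> i * blinfun_apply (g i) x) \<le> A * norm x"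
proof -
  have A: "0 \<le> A" using assms[of 0] norm_ge_zero order_trans by blast
  have le: "norm (\<gamma> i * blinfun_apply (g i) x) \<le> A * norm (blinfun_apply (g i) x)" for i
    unfolding norm_mult using assms by (intro mult_right_mono) auto
  have part: "(\<Sum>i<n. norm (\<gamma> i * blinfun_apply (g i) x)) \<le> A * norm x" for n
  proof -
    have "(\<Sum>i<n. norm (\<gamma> i * blinfun_apply (g i) x)) \<le> (\<Sum>i<n. A * norm (blinfun_apply (g i) x))"
      by (intro sum_mono le)
    also have "\<dots> \<le> A * norm x" unfolding sum_distrib_left[symmetric]
      using A sum_norm_apply_le by (intro mult_left_mono)
    finally show ?thesis .
  qed
  have sm: "summable (\<lambda>i. norm (\<gamma> i * blinfun_apply (g i) x))"
    by (rule summableI_nonneg_bounded[of _ "A * norm x"]) (use part in auto)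
  then show abs: "(\<lambda>i. \<gamma> i * blinfun_apply (g i) x) abs_summable_on UNIV"
    by (simp add: summable_on_UNIV_nonneg_real_iff)
  have "norm (\<Sum>\<^sub>\<infinity>i. \<gamma> i * blinfun_apply (g i) x) \<le> (\<Sum>\<^sub>\<infinity>i. norm (\<gamma> i * blinfun_apply (g i) x))"
    by (rule norm_infsum_bound[OF abs])
  also have "\<dots> = (\<Sum>i. norm (\<gamma> i * blinfun_apply (g i) x))"
    using has_sum_infsum[OF abs] by (intro sums_unique has_sum_imp_sums)
  also have "\<dots> \<le> A * norm x" by (rule suminf_le_const[OF sm part])
  finally show "norm (\<Sum>\<^sub>\<infinity>i. \<gamma> i * blinfun_apply (g i) x) \<le> A * norm x" .
qed

lemma bounded_coefficients_summable_on:
  assumes "\<And>i. norm (\<gamma> i) \<le> A"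
  shows "(\<lambda>i. \<gamma> i * blinfun_apply (g i) x) summable_on UNIV"
  using abs_summable_summable[OF bounded_coefficients_summable(1)[OF assms]] .

lemma series_apply:
  assumes "\<And>i. norm (\<gamma> i) \<le> A"
  shows "blinfun_apply (series \<gamma>) x = (\<Sum>\<^sub>\<infinity>i. \<gamma> i * blinfun_apply (g i) x)"
proof -
  note sm = bounded_coefficients_summable_on[OF assms]
  have "bounded_linear (\<lambda>x. \<Sum>\<^sub>\<infinity>i. \<gamma> i * blinfun_apply (g i) x)"
  proof (rule bounded_linear_intro[of _ A])
    fix x y :: 'a and t :: real
    show "(\<Sum>\<^sub>\<infinity>i. \<gamma> i * blinfun_apply (g i) (x + y)) =
        (\<Sum>\<^sub>\<infinity>i. \<gamma> i * blinfun_apply (g i) x) + (\<Sum>\<^sub>\<infinity>i. \<gamma> i * blinfun_apply (g i) y)"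
      by (simp add: blinfun.add_right distrib_left infsum_add sm)
    show "(\<Sum>\<^sub>\<infinity>i. \<gamma> i * blinfun_apply (g i) (t *\<^sub>R x)) = t *\<^sub>R (\<Sum>\<^sub>\<infinity>i. \<gamma> i * blinfun_apply (g i) x)"
      by (simp add: blinfun.scaleR_right infsum_scaleR_right)
    show "norm (\<Sum>\<^sub>\<infinity>i. \<gamma> i * blinfun_apply (g i) x) \<le> norm x * A"
      using bounded_coefficients_summable(2)[where \<gamma>=\<gamma> and A=A and x=x, OF assms] by (simp add: mult.commute)
  qed
  then show ?thesis unfolding series_def by (simp add: bounded_linear_Blinfun_apply)
qed

lemma norm_series_le:
  assumes "\<And>i. norm (\<gamma> i) \<le> A"
  shows "norm (series \<gamma>) \<le> A"
proof (rule norm_blinfun_bound)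
  show "0 \<le> A" using assms[of 0] norm_ge_zero order_trans by blast
  show "norm (blinfun_apply (series \<gamma>) x) \<le> A * norm x" for x
    using bounded_coefficients_summable(2)[OF assms] by (simp add: series_apply[OF assms])
qed

lemma series_dual:
  assumes "\<And>i. norm (\<gamma> i) \<le> A"
  shows "series \<gamma> \<in> dual smul"
proof -
  have gs: "blinfun_apply (g i) (smul c x) = c * blinfun_apply (g i) x" for i c x
    using g_dual[of i] by (simp add: dual_def)
  show ?thesis
    by (simp add: dual_def series_apply[OF assms] gs mult.left_commute[of _ _ "blinfun_apply _ _"] infsum_cmult_right')
qed

lemma series_add:
  assumes "\<And>i. norm (\<gamma> i) \<le> A" "\<And>i. norm (\<gamma>' i) \<le> A'"
  shows "series (\<lambda>i. \<gamma> i + \<gamma>' i) = series \<gamma> + series \<gamma>'"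
proof (rule blinfun_eqI)
  fix x
  have 1: "norm (\<gamma> i + \<gamma>' i) \<le> A + A'" for i using assms norm_triangle_mono by blast
  show "blinfun_apply (series (\<lambda>i. \<gamma> i + \<gamma>' i)) x = blinfun_apply (series \<gamma> + series \<gamma>') x"
    by (simp add: series_apply[OF 1] series_apply[OF assms(1)] series_apply[OF assms(2)] blinfun.add_left
      distrib_right infsum_add bounded_coefficients_summable_on[OF assms(1)] bounded_coefficients_summable_on[OF assms(2)])
qed

lemma series_scale:
  assumes "\<And>i. norm (\<gamma> i) \<le> A"
  shows "series (\<lambda>i. c * \<gamma> i) = scale_functional c (series \<gamma>)"
proof (rule blinfun_eqI)
  fix x
  have 1: "norm (c * \<gamma> i) \<le> norm c * A" for i using assms by (simp add: norm_mult mult_left_mono)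
  show "blinfun_apply (series (\<lambda>i. c * \<gamma> i)) x = blinfun_apply (scale_functional c (series \<gamma>)) x"
    by (simp add: series_apply[OF 1] series_apply[OF assms] mult.assoc infsum_cmult_right')
qed

lemma series_single: "series (\<lambda>k. if k = i then c else 0) = scale_functional c (g i)"
proof (rule blinfun_eqI)
  fix x
  have 1: "norm (if k = i then c else 0) \<le> norm c" for k by simp
  have "(\<Sum>\<^sub>\<infinity>k. (if k = i then c else 0) * blinfun_apply (g k) x)
    = (\<Sum>\<^sub>\<infinity>k\<in>{i}. c * blinfun_apply (g k) x)"
    by (rule infsum_cong_neutral) auto
  then show "blinfun_apply (series (\<lambda>k. if k = i then c else 0)) x = blinfun_apply (scale_functional c (g i)) x"
    unfolding series_apply[OF 1] by simp
qed

text \<open>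
  Flipping the sign of all coefficients except the one at \<open>i\<close> keeps the norm below \<open>A\<close>, and the two series add up to
  \<open>2 \<gamma> i g i\<close>.
\<close>

lemma norm_series_ge:
  assumes "\<And>i. norm (\<gamma> i) \<le> A"
  shows "2 * norm (\<gamma> i) * norm (g i) \<le> norm (series \<gamma>) + A"
proof -
  define \<gamma>' where "\<gamma>' k = (if k = i then \<gamma> i else - \<gamma> k)" for k
  have 1: "norm (\<gamma>' k) \<le> A" for k using assms by (simp add: \<gamma>'_def)
  have "(\<lambda>k. \<gamma> k + \<gamma>' k) = (\<lambda>k. if k = i then 2 * \<gamma> i else 0)" by (auto simp: \<gamma>'_def)
  then have "scale_functional (2 * \<gamma> i) (g i) = series \<gamma> + series \<gamma>'"
    using series_add[where \<gamma>=\<gamma> and \<gamma>'=\<gamma>', OF assms 1] series_single[of i "2 * \<gamma> i"] by simp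
  then have "norm (scale_functional (2 * \<gamma> i) (g i)) \<le> norm (series \<gamma>) + norm (series \<gamma>')"
    by (metis norm_triangle_ineq)
  also have "norm (series \<gamma>') \<le> A" by (rule norm_series_le[OF 1])
  finally show ?thesis by (simp add: norm_scale_functional norm_mult)
qed

text \<open>
  A partition of the natural numbers into infinitely many infinite sets, the \<open>n\<close>-th one consisting of
  the codes of the pairs \<open>(n, j)\<close>.
\<close>

definition block :: "nat \<Rightarrow> nat" where
  "block i = fst (prod_decode i)"

text \<open>
  Only the coefficients that \<open>\<kappa>\<close> does not touch are used for the lower bound: along the \<open>n\<close>-th block
  the norms of \<open>g\<close> tend to \<open>1\<close> while the coefficient stays \<open>\<alpha> n\<close>. The first member of each block is thus free
  to be rescaled.
\<close>

lemma norm_block_series: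
  assumes g1: "(\<lambda>i. norm (g i)) \<longlonglongrightarrow> 1" and \<alpha>: "\<alpha> \<in> linfty"
    and \<kappa>: "\<And>i. norm (\<kappa> i) \<le> 1" "\<And>n j. \<kappa> (prod_encode (n, Suc j)) = 1"
  shows "norm (series (\<lambda>i. \<alpha> (block i) * \<kappa> i)) = norm_linfty \<alpha>"
proof (rule antisym)
  have le: "norm (\<alpha> (block i) * \<kappa> i) \<le> norm_linfty \<alpha>" for i
  proof -
    have "norm (\<alpha> (block i) * \<kappa> i) \<le> norm (\<alpha> (block i)) * 1" unfolding norm_mult by (intro mult_left_mono \<kappa>) simp
    also have "\<dots> \<le> norm_linfty \<alpha>" using norm_linfty_ge[OF \<alpha>] by simp
    finally show ?thesis .
  qed
  let ?S = "series (\<lambda>i. \<alpha> (block i) * \<kappa> i)"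
  show "norm ?S \<le> norm_linfty \<alpha>" by (rule norm_series_le[OF le])
  have "norm (\<alpha> n) \<le> (norm ?S + norm_linfty \<alpha>) / 2" for n
  proof -
    have 1: "2 * norm (\<alpha> n) * norm (g (prod_encode (n, Suc j))) \<le> norm ?S + norm_linfty \<alpha>" for j
      using norm_series_ge[where \<gamma>="\<lambda>i. \<alpha> (block i) * \<kappa> i" and i="prod_encode (n, Suc j)", OF le] by (simp add: block_def \<kappa>(2))
    have "filterlim (\<lambda>j. prod_encode (n, Suc j)) sequentially sequentially"
      by (rule filterlim_at_top_mono[OF filterlim_ident always_eventually])
        (use le_prod_encode_2 in \<open>auto intro: order_trans[OF le_SucI[OF order_refl]]\<close>)
    then have "(\<lambda>j. 2 * norm (\<alpha> n) * norm (g (prod_encode (n, Suc j)))) \<longlonglongrightarrow> 2 * norm (\<alpha> n) * 1"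
      by (intro tendsto_mult tendsto_const filterlim_compose[OF g1])
    then have "2 * norm (\<alpha> n) * 1 \<le> norm ?S + norm_linfty \<alpha>"
      by (rule tendsto_upperbound) (use 1 in auto)
    then show ?thesis by simp
  qed
  then have "norm_linfty \<alpha> \<le> (norm ?S + norm_linfty \<alpha>) / 2"
    unfolding norm_linfty_def by (intro cSUP_least) auto
  then show "norm_linfty \<alpha> \<le> norm ?S" by simp
qed

text \<open>
  At every point the family is absolutely summable, so that it may be summed block by block.
\<close>

lemma weak_star_sums_block_series:
  assumes \<alpha>: "\<alpha> \<in> linfty" and \<kappa>: "\<And>i. norm (\<kappa> i) \<le> 1"
  shows "weak_star_sums (\<lambda>n. scale_functional (\<alpha> n) (series (\<lambda>i. if block i = n then \<kappa> i else 0)))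
    (series (\<lambda>i. \<alpha> (block i) * \<kappa> i))"
  unfolding weak_star_sums_def
proof
  fix x
  have le: "norm (\<alpha> (block i) * \<kappa> i) \<le> norm_linfty \<alpha>" for i
  proof -
    have "norm (\<alpha> (block i) * \<kappa> i) \<le> norm (\<alpha> (block i)) * 1" unfolding norm_mult by (intro mult_left_mono \<kappa>) simp
    also have "\<dots> \<le> norm_linfty \<alpha>" using norm_linfty_ge[OF \<alpha>] by simp
    finally show ?thesis .
  qed
  have le1: "norm (if block i = n then \<kappa> i else 0) \<le> 1" for i n using \<kappa> by simp
  define t where "t i = \<alpha> (block i) * \<kappa> i * blinfun_apply (g i) x" for i
  have "t summable_on UNIV" unfolding t_def by (rule bounded_coefficients_summable_on[OF le])
  then have "(t \<circ> prod_encode) summable_on UNIV"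
    using summable_on_reindex[of prod_encode UNIV t] bij_prod_encode
    by (simp add: bij_is_inj bij_is_surj)
  then have sm: "(\<lambda>(n, j). t (prod_encode (n, j))) summable_on (UNIV \<times> UNIV)"
    by (simp add: o_def case_prod_unfold)
  have inner: "(\<Sum>\<^sub>\<infinity>j. t (prod_encode (n, j))) =
    blinfun_apply (scale_functional (\<alpha> n) (series (\<lambda>i. if block i = n then \<kappa> i else 0))) x" for n
  proof -
    have inj: "inj (\<lambda>j. prod_encode (n, j))" by (auto intro: injI)
    have "(\<Sum>\<^sub>\<infinity>j. t (prod_encode (n, j))) = (\<Sum>\<^sub>\<infinity>i\<in>range (\<lambda>j. prod_encode (n, j)). t i)"
      using infsum_reindex[OF inj, of t] by (simp add: o_def)
    also have "\<dots> = (\<Sum>\<^sub>\<infinity>i. \<alpha> n * ((if block i = n then \<kappa> i else 0) * blinfun_apply (g i) x))"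
    proof (rule infsum_cong_neutral)
      fix i assume "i \<in> UNIV - range (\<lambda>j. prod_encode (n, j))"
      then have "block i \<noteq> n" unfolding block_def
        by (metis DiffD2 prod.collapse prod_decode_inverse rangeI)
      then show "\<alpha> n * ((if block i = n then \<kappa> i else 0) * blinfun_apply (g i) x) = 0" by simp
    qed (auto simp: t_def block_def)
    also have "\<dots> = \<alpha> n * blinfun_apply (series (\<lambda>i. if block i = n then \<kappa> i else 0)) x"
      by (simp add: infsum_cmult_right' series_apply[OF le1])
    finally show ?thesis by simp
  qed
  have "(\<lambda>n. \<Sum>\<^sub>\<infinity>j. t (prod_encode (n, j))) summable_on UNIV"
    using summable_on_Sigma_banach[OF sm] by simp
  moreover have "(\<Sum>\<^sub>\<infinity>n. \<Sum>\<^sub>\<infinity>j. t (prod_encode (n, j))) = (\<Sum>\<^sub>\<infinity>i. t i)"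
  proof -
    have "(\<Sum>\<^sub>\<infinity>n. \<Sum>\<^sub>\<infinity>j. t (prod_encode (n, j))) = (\<Sum>\<^sub>\<infinity>(n, j)\<in>UNIV \<times> UNIV. t (prod_encode (n, j)))"
      using infsum_Sigma'_banach[OF sm] .
    also have "\<dots> = infsum (t \<circ> prod_encode) UNIV" by (simp add: o_def case_prod_unfold)
    also have "\<dots> = infsum t (range prod_encode)"
      by (rule infsum_reindex[symmetric]) (rule bij_is_inj[OF bij_prod_encode])
    finally show ?thesis using bij_is_surj[OF bij_prod_encode] by simp
  qed
  ultimately have "((\<lambda>n. \<Sum>\<^sub>\<infinity>j. t (prod_encode (n, j))) has_sum (\<Sum>\<^sub>\<infinity>i. t i)) UNIV"
    using has_sum_infsum by metis
  then have "(\<lambda>n. \<Sum>\<^sub>\<infinity>j. t (prod_encode (n, j))) sums (\<Sum>\<^sub>\<infinity>i. t i)" by (rule has_sum_imp_sums)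
  then show "(\<lambda>n. blinfun_apply (scale_functional (\<alpha> n) (series (\<lambda>i. if block i = n then \<kappa> i else 0))) x) sums
     blinfun_apply (series (\<lambda>i. \<alpha> (block i) * \<kappa> i)) x"
    by (simp only: inner series_apply[OF le] t_def[symmetric])
qed

lemma dual_contains_linfty_of_c0_family:
  assumes g1: "(\<lambda>i. norm (g i)) \<longlonglongrightarrow> 1"
  shows "dual_contains_isometric_linfty smul"
  unfolding dual_contains_isometric_linfty_def
proof (intro exI[of _ "\<lambda>\<alpha>. series (\<lambda>i. \<alpha> (block i))"] conjI ballI allI)
  fix \<alpha> :: "nat \<Rightarrow> 'k" assume \<alpha>: "\<alpha> \<in> linfty"
  note b = norm_linfty_ge[OF \<alpha>]
  show "series (\<lambda>i. \<alpha> (block i)) \<in> dual smul" by (rule series_dual[OF b])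
  show "series (\<lambda>i. c * \<alpha> (block i)) = scale_functional c (series (\<lambda>i. \<alpha> (block i)))" for c
    by (rule series_scale[OF b])
  show "norm (series (\<lambda>i. \<alpha> (block i))) = norm_linfty \<alpha>"
    using norm_block_series[OF g1 \<alpha>, of "\<lambda>_. 1"] by simp
  fix \<beta> :: "nat \<Rightarrow> 'k" assume \<beta>: "\<beta> \<in> linfty"
  show "series (\<lambda>i. \<alpha> (block i) + \<beta> (block i)) = series (\<lambda>i. \<alpha> (block i)) + series (\<lambda>i. \<beta> (block i))"
    by (rule series_add[OF b norm_linfty_ge[OF \<beta>]])
qed

end

section \<open>James constants\<close>

lemma sums_tail_of_finite:
  fixes f :: "nat \<Rightarrow> 'b::{comm_monoid_add,t2_space}"
  assumes "finite I" "I \<subseteq> {m..}"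
  shows "(\<lambda>n. if n + m \<in> I then f (n + m) else 0) sums (\<Sum>i\<in>I. f i)"
proof -
  have inj: "inj_on (\<lambda>i. i - m) I" using assms(2) by (intro inj_onI) (metis atLeast_iff le_add_diff_inverse subsetD)
  have "(\<lambda>n. if n + m \<in> I then f (n + m) else 0) sums
      (\<Sum>n\<in>(\<lambda>i. i - m) ` I. if n + m \<in> I then f (n + m) else 0)"
  proof (rule sums_finite)
    show "finite ((\<lambda>i. i - m) ` I)" using assms(1) by simp
    fix n assume n: "n \<notin> (\<lambda>i. i - m) ` I"
    have "n + m \<notin> I"
    proof
      assume "n + m \<in> I"
      then have "n + m - m \<in> (\<lambda>i. i - m) ` I" by (rule imageI)
      then show False using n by simp
    qed
    then show "(if n + m \<in> I then f (n + m) else 0) = 0" by simp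
  qed
  also have "(\<Sum>n\<in>(\<lambda>i. i - m) ` I. if n + m \<in> I then f (n + m) else 0) = (\<Sum>i\<in>I. f i)"
    unfolding sum.reindex[OF inj] using assms(2) by (intro sum.cong) auto
  finally show ?thesis .
qed

context banach_space_over
begin

lemma james_tail_le:
  assumes "\<And>n. norm (y n) \<le> b"
  shows "james_tail smul y m \<le> b"
    and "(\<lambda>n. norm (\<alpha> n)) sums 1 \<Longrightarrow> james_tail smul y m \<le> norm (\<Sum>n. smul (\<alpha> n) (y (n + m)))"
proof -
  have bdd: "bdd_below ((\<lambda>\<alpha>. norm (\<Sum>n. smul (\<alpha> n) (y (n + m)))) ` {\<alpha>. (\<lambda>n. norm (\<alpha> n)) sums 1})"
    by (rule bdd_belowI2[of _ 0]) simp
  show le: "james_tail smul y m \<le> norm (\<Sum>n. smul (\<alpha> n) (y (n + m)))" if "(\<lambda>n. norm (\<alpha> n)) sums 1" for \<alpha>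
    unfolding james_tail_def using that by (intro cINF_lower[OF bdd]) simp
  define \<delta> :: "nat \<Rightarrow> 'k" where "\<delta> n = (if n = 0 then 1 else 0)" for n
  have "(\<lambda>n. if n = 0 then norm (1 :: 'k) else 0) sums norm (1 :: 'k)" by (rule sums_single)
  then have 1: "(\<lambda>n. norm (\<delta> n)) sums 1" by (simp add: \<delta>_def if_distrib cong: if_cong)
  have "(\<lambda>n. if n = 0 then y (n + m) else 0) sums y (0 + m)" by (rule sums_single)
  then have "(\<lambda>n. smul (\<delta> n) (y (n + m))) sums y m"
    by (simp add: \<delta>_def if_distribR if_distrib[of "\<lambda>c. smul c _"] cong: if_cong)
  then have "(\<Sum>n. smul (\<delta> n) (y (n + m))) = y m" by (rule sums_unique[symmetric])
  then show "james_tail smul y m \<le> b" using le[OF 1] assms[of m] by simp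
qed

text \<open>
  Normalising the coefficients and extending them by zero makes them admissible in the infimum.
\<close>

lemma finite_lower_estimate_of_james_tail:
  assumes b: "\<And>n. norm (y n) \<le> b" and c: "c \<le> james_tail smul y m"
    and I: "finite I" "I \<subseteq> {m..}"
  shows "c * (\<Sum>i\<in>I. norm (\<alpha> i)) \<le> norm (\<Sum>i\<in>I. smul (\<alpha> i) (y i))"
proof (cases "(\<Sum>i\<in>I. norm (\<alpha> i)) = 0")
  case False
  define t where "t = (\<Sum>i\<in>I. norm (\<alpha> i))"
  have t: "0 < t" using False unfolding t_def by (simp add: less_le sum_nonneg)
  define \<beta> where "\<beta> n = (if n + m \<in> I then \<alpha> (n + m) / of_real t else 0)" for n
  have "(\<lambda>n. if n + m \<in> I then norm (\<alpha> (n + m)) / t else 0) sums (\<Sum>i\<in>I. norm (\<alpha> i) / t)"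
    by (rule sums_tail_of_finite[OF I])
  also have "(\<Sum>i\<in>I. norm (\<alpha> i) / t) = 1" using t by (simp add: t_def flip: sum_divide_distrib)
  also have "(\<lambda>n. if n + m \<in> I then norm (\<alpha> (n + m)) / t else 0) = (\<lambda>n. norm (\<beta> n))"
    using t by (auto simp: \<beta>_def norm_divide)
  finally have 1: "(\<lambda>n. norm (\<beta> n)) sums 1" .
  have "(\<lambda>n. if n + m \<in> I then smul (\<alpha> (n + m) / of_real t) (y (n + m)) else 0) sums
      (\<Sum>i\<in>I. smul (\<alpha> i / of_real t) (y i))"
    by (rule sums_tail_of_finite[OF I])
  also have "(\<lambda>n. if n + m \<in> I then smul (\<alpha> (n + m) / of_real t) (y (n + m)) else 0) = (\<lambda>n. smul (\<beta> n) (y (n + m)))"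
    by (auto simp: \<beta>_def)
  also have "(\<Sum>i\<in>I. smul (\<alpha> i / of_real t) (y i)) = smul (of_real (1 / t)) (\<Sum>i\<in>I. smul (\<alpha> i) (y i))"
    by (simp add: scale_sum_right)
  finally have "(\<Sum>n. smul (\<beta> n) (y (n + m))) = smul (of_real (1 / t)) (\<Sum>i\<in>I. smul (\<alpha> i) (y i))"
    by (rule sums_unique[symmetric])
  then have "c \<le> norm (smul (of_real (1 / t)) (\<Sum>i\<in>I. smul (\<alpha> i) (y i)))"
    using james_tail_le(2)[of y b \<beta> m] b 1 c by simp
  then show ?thesis using t unfolding norm_smul norm_of_real by (simp add: field_simps flip: t_def)
qed simp

lemma equiv_l1_basis_bounded:
  assumes "equiv_l1_basis smul x"
  obtains b where "\<And>n. norm (x n) \<le> b"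
proof -
  obtain a b where ab: "\<forall>\<alpha>. summable (\<lambda>n. norm (\<alpha> n)) \<longrightarrow>
      summable (\<lambda>n. smul (\<alpha> n) (x n)) \<and>
      a * (\<Sum>n. norm (\<alpha> n)) \<le> norm (\<Sum>n. smul (\<alpha> n) (x n)) \<and>
      norm (\<Sum>n. smul (\<alpha> n) (x n)) \<le> b * (\<Sum>n. norm (\<alpha> n))"
    using assms unfolding equiv_l1_basis_def by (elim exE conjE) (rule that)
  have b: "norm (\<Sum>n. smul (\<alpha> n) (x n)) \<le> b * (\<Sum>n. norm (\<alpha> n))"
    if "summable (\<lambda>n. norm (\<alpha> n))" for \<alpha>
    using ab that by simp
  have "norm (x k) \<le> b" for k
  proof -
    define \<delta> :: "nat \<Rightarrow> 'k" where "\<delta> n = (if n = k then 1 else 0)" for n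
    have "(\<lambda>n. if n = k then norm (1 :: 'k) else 0) sums norm (1 :: 'k)" by (rule sums_single)
    then have 1: "(\<lambda>n. norm (\<delta> n)) sums 1" by (simp add: \<delta>_def if_distrib cong: if_cong)
    have "(\<lambda>n. if n = k then x n else 0) sums x k" by (rule sums_single)
    then have "(\<lambda>n. smul (\<delta> n) (x n)) sums x k"
      by (simp add: \<delta>_def if_distribR if_distrib[of "\<lambda>c. smul c _"] cong: if_cong)
    then have "(\<Sum>n. smul (\<delta> n) (x n)) = x k" by (rule sums_unique[symmetric])
    then show ?thesis using b[OF sums_summable[OF 1]] sums_unique[OF 1, symmetric] by simp
  qed
  then show ?thesis by (rule that)
qed

lemma james_const_bounds:
  assumes "\<And>n. norm (y n) \<le> b"
  shows "james_tail smul y m \<le> james_const smul y" "james_const smul y \<le> b"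
proof -
  have "bdd_above (range (james_tail smul y))" by (rule bdd_aboveI2) (rule james_tail_le(1)[OF assms])
  then show "james_tail smul y m \<le> james_const smul y" unfolding james_const_def by (rule cSUP_upper[OF UNIV_I])
  show "james_const smul y \<le> b"
    unfolding james_const_def by (rule cSUP_least) (simp, rule james_tail_le(1)[OF assms])
qed

lemma james_const_sup_pos:
  assumes "equiv_l1_basis smul x"
  shows "0 < james_const_sup smul x"
proof -
  obtain b where b: "\<And>n. norm (x n) \<le> b" by (rule equiv_l1_basis_bounded[OF assms]) (rule that)
  obtain a b' where a0: "0 < a" and ab: "\<forall>\<alpha>. summable (\<lambda>n. norm (\<alpha> n)) \<longrightarrow>
      summable (\<lambda>n. smul (\<alpha> n) (x n)) \<and>
      a * (\<Sum>n. norm (\<alpha> n)) \<le> norm (\<Sum>n. smul (\<alpha> n) (x n)) \<and>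
      norm (\<Sum>n. smul (\<alpha> n) (x n)) \<le> b' * (\<Sum>n. norm (\<alpha> n))"
    using assms unfolding equiv_l1_basis_def by (elim exE conjE) (rule that)
  have al: "a * (\<Sum>n. norm (\<alpha> n)) \<le> norm (\<Sum>n. smul (\<alpha> n) (x n))"
    if "summable (\<lambda>n. norm (\<alpha> n))" for \<alpha>
    using ab that by simp
  note a = a0 al
  have ne: "{\<alpha> :: nat \<Rightarrow> 'k. (\<lambda>n. norm (\<alpha> n)) sums 1} \<noteq> {}"
  proof -
    have "(\<lambda>n. if n = 0 then norm (1 :: 'k) else 0) sums norm (1 :: 'k)" by (rule sums_single)
    then have "(\<lambda>n. norm (if n = 0 then 1 else 0 :: 'k)) sums 1" by (simp add: if_distrib cong: if_cong)
    then have "(\<lambda>n. if n = 0 then 1 else 0 :: 'k) \<in> {\<alpha>. (\<lambda>n. norm (\<alpha> n)) sums 1}" by (simp only: mem_Collect_eq)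
    then show ?thesis by (intro ex_in_conv[THEN iffD1] exI)
  qed
  have "a \<le> james_tail smul x 0"
    unfolding james_tail_def
  proof (rule cINF_greatest[OF ne])
    fix \<alpha> :: "nat \<Rightarrow> 'k" assume "\<alpha> \<in> {\<alpha>. (\<lambda>n. norm (\<alpha> n)) sums 1}"
    then have \<alpha>: "(\<lambda>n. norm (\<alpha> n)) sums 1" by simp
    show "a \<le> norm (\<Sum>n. smul (\<alpha> n) (x (n + 0)))"
      using a(2)[OF sums_summable[OF \<alpha>]] sums_unique[OF \<alpha>, symmetric] by simp
  qed
  also have "\<dots> \<le> james_const smul (x \<circ> id)" using james_const_bounds(1)[OF b] by simp
  also have "\<dots> \<le> james_const_sup smul x"
    unfolding james_const_sup_def
  proof (rule cSUP_upper)
    show "bdd_above ((\<lambda>r. james_const smul (x \<circ> r)) ` {r :: nat \<Rightarrow> nat. strict_mono r})"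
      by (rule bdd_aboveI2[of _ _ b], rule james_const_bounds(2)) (simp add: b)
  qed (simp add: strict_mono_def)
  finally show ?thesis using a(1) by simp
qed

lemma subsequence_with_large_james_tail:
  assumes b: "\<And>n. norm (x n) \<le> b" and c: "c < james_const_sup smul x"
  obtains r m where "strict_mono r" "c < james_tail smul (x \<circ> r) m"
proof -
  have "bdd_above ((\<lambda>r. james_const smul (x \<circ> r)) ` {r :: nat \<Rightarrow> nat. strict_mono r})"
    by (rule bdd_aboveI2[of _ _ b], rule james_const_bounds(2)) (simp add: b)
  moreover have "id \<in> {r :: nat \<Rightarrow> nat. strict_mono r}" by (simp add: strict_mono_def)
  then have "{r :: nat \<Rightarrow> nat. strict_mono r} \<noteq> {}" by (intro ex_in_conv[THEN iffD1] exI)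
  ultimately obtain r :: "nat \<Rightarrow> nat" where r: "strict_mono r" "c < james_const smul (x \<circ> r)"
    using c unfolding james_const_sup_def by (subst (asm) less_cSUP_iff) auto
  have "bdd_above (range (james_tail smul (x \<circ> r)))"
    by (rule bdd_aboveI2[of _ _ b], rule james_tail_le(1)) (simp add: b)
  then obtain m where "c < james_tail smul (x \<circ> r) m"
    using r(2) unfolding james_const_def by (subst (asm) less_cSUP_iff) auto
  then show ?thesis by (rule that[OF r(1)])
qed

end

lemma prod_encode_first_less: "l < n \<Longrightarrow> prod_encode (l, 0) < prod_encode (n, j)"
proof -
  assume "l < n"
  have "triangle l \<le> triangle (n + j)"
    by (rule incseqD[OF incseq_SucI]) (use \<open>l < n\<close> in simp_all)
  then show ?thesis using \<open>l < n\<close> by (simp add: prod_encode_def)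
qed

lemma prod_encode_0_less_Suc: "prod_encode (n, 0) < prod_encode (n, Suc j)"
proof -
  have "triangle n \<le> triangle (n + j)" by (rule incseqD[OF incseq_SucI]) simp_all
  then show ?thesis by (simp add: prod_encode_def)
qed

context L_embedded_space
begin

text \<open>
  The cluster point belongs to a subsequence that depends on \<open>c\<close>. What is retained of the subsequence is only that
  terms of \<open>x\<close> with arbitrarily large indices come close to \<open>z\<close> at a given functional, so that cluster points for
  different \<open>c\<close> can be used along a single sequence of indices.
\<close>

lemma singular_cluster_point_of_l1_basis:
  assumes x: "equiv_l1_basis smul x" and c: "c < james_const_sup smul x"
  shows "\<exists>z. z \<in> bidual smul \<and> c \<le> norm_bidual smul (z - P z) \<and>
    (\<forall>f\<in>dual smul. \<forall>e>0. \<forall>N. \<exists>q>N. norm (blinfun_apply f (x q) - z f) < e)"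
proof -
  obtain b where b: "\<And>n. norm (x n) \<le> b" by (rule equiv_l1_basis_bounded[OF x]) (rule that)
  obtain r m where r: "strict_mono r" and m: "c < james_tail smul (x \<circ> r) m"
    by (rule subsequence_with_large_james_tail[of x b c, OF b c]) (rule that)
  have br: "norm ((x \<circ> r) n) \<le> b" for n using b by simp
  obtain z \<F> where z: "z \<in> bidual smul" and \<F>: "\<F> \<le> sequentially" "\<F> \<noteq> bot"
    and lim: "\<And>f. f \<in> dual smul \<Longrightarrow> ((\<lambda>n. blinfun_apply f ((x \<circ> r) n)) \<longlongrightarrow> z f) \<F>"
    by (rule bounded_sequence_cluster[where y="x \<circ> r", OF br]) (rule that)
  show ?thesis
  proof (intro exI[of _ z] conjI ballI allI impI)
    show "c \<le> norm_bidual smul (z - P z)"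
    proof (rule singular_part_cluster_ge[where y="x \<circ> r", OF lim \<F> z])
      fix e :: real assume e: "0 < e"
      show "\<exists>m. \<forall>I \<alpha>. finite I \<longrightarrow> I \<subseteq> {m..} \<longrightarrow>
          (c - e) * (\<Sum>i\<in>I. norm (\<alpha> i)) \<le> norm (\<Sum>i\<in>I. smul (\<alpha> i) ((x \<circ> r) i))"
      proof (intro exI[of _ m] allI impI)
        fix I and \<alpha> :: "nat \<Rightarrow> 'k" assume I: "finite I" "I \<subseteq> {m..}"
        show "(c - e) * (\<Sum>i\<in>I. norm (\<alpha> i)) \<le> norm (\<Sum>i\<in>I. smul (\<alpha> i) ((x \<circ> r) i))"
          by (rule finite_lower_estimate_of_james_tail[where y="x \<circ> r", OF br _ I]) (use m e in simp)
      qed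
    qed
    show "\<exists>q>N. norm (blinfun_apply f (x q) - z f) < e" if f: "f \<in> dual smul" "0 < e" for f e N
    proof -
      have 1: "eventually (\<lambda>n. norm (blinfun_apply f ((x \<circ> r) n) - z f) < e) \<F>"
        using tendstoD[OF lim[OF f(1)] f(2)] by (simp add: dist_norm)
      have 2: "eventually (\<lambda>n. Suc N \<le> n) \<F>" using filter_leD[OF \<F>(1) eventually_ge_at_top] .
      obtain n where "norm (blinfun_apply f ((x \<circ> r) n) - z f) < e" "Suc N \<le> n"
        using eventually_happens'[OF \<F>(2) eventually_conj[OF 1 2]] by blast
      moreover have "n \<le> r n" by (rule strict_mono_imp_increasing[OF r])
      ultimately show ?thesis by (intro exI[of _ "r n"]) simp
    qed
  qed (rule z)
qed

text \<open>
  No points have to be recorded here, so the sequence of points is constantly zero and nothing is asked of the values.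
\<close>

lemma dual_contains_linfty_of_singular:
  assumes s: "s \<in> bidual smul" "P s = 0" "s \<noteq> 0"
  shows "dual_contains_isometric_linfty smul"
proof -
  have larger: "\<exists>q>N. True" for N :: nat by (rule exI[of _ "Suc N"]) simp
  have sel: "\<forall>n. \<forall>N :: nat. \<forall>f\<in>dual smul. s f = of_real (level n * norm_bidual smul s) \<longrightarrow>
      blinfun_apply f 0 = 0 \<longrightarrow> (\<exists>q>N. True)"
    by (intro allI ballI impI larger)
  obtain g and p :: "nat \<Rightarrow> nat" where g: "\<forall>i. g i \<in> dual smul"
    "\<forall>n \<beta>. (\<forall>i<n. norm (\<beta> i) \<le> 1) \<longrightarrow> norm (\<Sum>i<n. scale_functional (\<beta> i) (g i)) \<le> 1"
    "(\<lambda>i. norm (g i)) \<longlonglongrightarrow> 1"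
    using exists_triangular_c0_family[where s="\<lambda>_. s" and a="\<lambda>_. 0" and y="\<lambda>_. 0" and R="\<lambda>_ _. True", OF s sel]
    by (elim exE conjE) (rule that)
  interpret c0_family smul g by unfold_locales (rule g(1)[rule_format], rule g(2)[rule_format])
  show ?thesis by (rule dual_contains_linfty_of_c0_family[OF g(3)])
qed

text \<open>
  The \<open>n\<close>-th functional is the weak-star sum over the \<open>n\<close>-th block, and its point is the one recorded for the first
  member of that block, whose index precedes all other indices in this block and in the later ones. By
  triangularity the first member alone contributes to the value there. That value is only known to be at least
  about the constant \<open>c\<close>; scaling the first member by \<open>min 1 (c / v)\<close> cuts it off at \<open>c\<close>.
\<close>

lemma linfty_family_along_l1_basis:
  assumes x: "equiv_l1_basis smul x"
  shows "\<exists>(xs :: nat \<Rightarrow> 'a \<Rightarrow>\<^sub>L 'k) (p :: nat \<Rightarrow> nat).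
    (\<forall>n. xs n \<in> dual smul) \<and>
    (\<forall>\<alpha>\<in>linfty. \<exists>f\<in>dual smul.
       weak_star_sums (\<lambda>n. scale_functional (\<alpha> n) (xs n)) f \<and> norm f = norm_linfty \<alpha>) \<and>
    strict_mono p \<and>
    (\<lambda>n. norm (blinfun_apply (xs n) (x (p n)))) \<longlonglongrightarrow> james_const_sup smul x \<and>
    (\<forall>l n. l < n \<longrightarrow> blinfun_apply (xs n) (x (p l)) = 0)"
proof -
  let ?N = "norm_bidual smul" and ?hat = "canonical_embedding smul"
  \<comment> \<open>The product with \<open>level n\<close> below is a positive number smaller than \<open>c\<close> and tends to \<open>c\<close>, so that
    the singular parts obtained from it are nonzero.\<close>
  define c where "c = james_const_sup smul x"
  have c: "0 < c" unfolding c_def by (rule james_const_sup_pos[OF x])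
  have "\<forall>n. \<exists>z. z \<in> bidual smul \<and> c * level n \<le> ?N (z - P z) \<and>
    (\<forall>f\<in>dual smul. \<forall>e>0. \<forall>N. \<exists>q>N. norm (blinfun_apply f (x q) - z f) < e)"
  proof
    fix n
    have "c * level n < c * 1" using c level(2)[of n] by (intro mult_strict_left_mono)
    then have lt: "c * level n < james_const_sup smul x" by (simp add: c_def)
    show "\<exists>z. z \<in> bidual smul \<and> c * level n \<le> ?N (z - P z) \<and>
      (\<forall>f\<in>dual smul. \<forall>e>0. \<forall>N. \<exists>q>N. norm (blinfun_apply f (x q) - z f) < e)"
      by (rule singular_cluster_point_of_l1_basis[OF x lt])
  qed
  from choice[OF this] obtain z where "\<forall>n. z n \<in> bidual smul \<and> c * level n \<le> ?N (z n - P (z n)) \<and>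
    (\<forall>f\<in>dual smul. \<forall>e>0. \<forall>N. \<exists>q>N. norm (blinfun_apply f (x q) - z n f) < e)" by (elim exE)
  then have z: "z n \<in> bidual smul" "c * level n \<le> ?N (z n - P (z n))"
    "\<forall>f\<in>dual smul. \<forall>e>0. \<forall>N. \<exists>q>N. norm (blinfun_apply f (x q) - z n f) < e" for n
    by simp_all
  have "\<forall>n. \<exists>a. P (z n) = ?hat a" using P_in_range[OF z(1)] by simp
  from choice[OF this] obtain a where "\<forall>n. P (z n) = ?hat (a n)" by (elim exE)
  then have a: "P (z n) = ?hat (a n)" for n by simp
  define s where "s n = z n - P (z n)" for n
  have s: "s n \<in> bidual smul" for n unfolding s_def by (intro bidual_diff z P_bidual)
  have Ps: "P (s n) = 0" for n unfolding s_def by (simp add: P_diff z P_bidual P_idem)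
  have sN: "c * level n \<le> ?N (s n)" for n unfolding s_def by (rule z(2))
  have s0: "s n \<noteq> 0" for n
  proof
    assume "s n = 0"
    moreover have "?N 0 \<le> 0" by (rule norm_bidual_le) simp_all
    ultimately have "c * level n \<le> 0" using sN[of n] by simp
    moreover have "0 < c * level n" using c level(1)[of n] by (rule mult_pos_pos)
    ultimately show False by simp
  qed
  define lo where "lo n = level n * (c * level n) - 1 / (real n + 1)" for n
  have sel: "\<forall>n N. \<forall>f\<in>dual smul. s n f = of_real (level n * ?N (s n)) \<longrightarrow>
      blinfun_apply f (a n) = 0 \<longrightarrow> (\<exists>q>N. lo n \<le> norm (blinfun_apply f (x q)))"
  proof (intro allI ballI impI)
    fix n N f assume f: "f \<in> dual smul" "s n f = of_real (level n * ?N (s n))" "blinfun_apply f (a n) = 0"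
    have "0 < 1 / (real n + 1)" by simp
    then obtain q where q: "N < q" "norm (blinfun_apply f (x q) - z n f) < 1 / (real n + 1)"
      using z(3)[of n] f(1) by blast
    have "z n f = s n f" unfolding s_def a using f(1,3) by simp
    then have "norm (z n f) = \<bar>level n * ?N (s n)\<bar>" unfolding f(2) by (simp only: norm_of_real)
    moreover have "level n * (c * level n) \<le> level n * ?N (s n)"
      using sN level(1)[of n] by (intro mult_left_mono) simp_all
    moreover have "norm (z n f) \<le> norm (blinfun_apply f (x q)) + norm (blinfun_apply f (x q) - z n f)"
      by (metis norm_minus_commute norm_triangle_sub)
    ultimately have "lo n \<le> norm (blinfun_apply f (x q))" using q(2) unfolding lo_def by linarith
    then show "\<exists>q>N. lo n \<le> norm (blinfun_apply f (x q))" using q(1) by blast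
  qed
  obtain g and p :: "nat \<Rightarrow> nat" where g: "\<forall>i. g i \<in> dual smul"
    "\<forall>n \<beta>. (\<forall>i<n. norm (\<beta> i) \<le> 1) \<longrightarrow> norm (\<Sum>i<n. scale_functional (\<beta> i) (g i)) \<le> 1"
    "(\<lambda>i. norm (g i)) \<longlonglongrightarrow> 1" and p: "strict_mono p"
    and gp0: "\<forall>l i. l < i \<longrightarrow> blinfun_apply (g i) (x (p l)) = 0"
    and gp: "\<forall>n. lo n \<le> norm (blinfun_apply (g n) (x (p n)))"
    using exists_triangular_c0_family[where s=s and a=a and y=x and R="\<lambda>n v. lo n \<le> norm v", OF s Ps s0 sel]
    by (elim exE conjE) (rule that)
  interpret c0_family smul g by unfold_locales (rule g(1)[rule_format], rule g(2)[rule_format])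
  define v where "v i = norm (blinfun_apply (g i) (x (p i)))" for i
  define \<kappa> :: "nat \<Rightarrow> 'k" where "\<kappa> i = (if snd (prod_decode i) = 0 then of_real (min 1 (c / v i)) else 1)" for i
  have \<kappa>: "norm (\<kappa> i) \<le> 1" for i
  proof -
    have "0 \<le> c / v i" using c by (simp add: v_def)
    then show ?thesis unfolding \<kappa>_def by (simp add: norm_of_real del: of_real_divide)
  qed
  have \<kappa>1: "\<kappa> (prod_encode (n, Suc j)) = 1" for n j by (simp add: \<kappa>_def)
  define xs where "xs n = series (\<lambda>i. if block i = n then \<kappa> i else 0)" for n
  define e where "e n = prod_encode (n, 0)" for n
  have e: "strict_mono e" unfolding e_def by (rule strict_monoI) (rule prod_encode_first_less)
  have le1: "norm (if block i = n then \<kappa> i else 0) \<le> 1" for i n using \<kappa> by simp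
  have g0: "blinfun_apply (g i) (x (p (e l))) = 0" if "block i = n" "l < n \<or> l = n \<and> i \<noteq> e n" for i l n
  proof -
    have "i = prod_encode (fst (prod_decode i), snd (prod_decode i))" by simp
    then have "i = prod_encode (n, snd (prod_decode i))" using that(1) unfolding block_def by simp
    then obtain j where i: "i = prod_encode (n, j)" by (rule that)
    have "e l < i"
    proof (cases "l < n")
      case True
      then show ?thesis unfolding e_def i by (rule prod_encode_first_less)
    next
      case False
      then have "l = n" "j \<noteq> 0" using that(2) i by (auto simp: e_def)
      then obtain j' where "j = Suc j'" using not0_implies_Suc by blast
      then show ?thesis unfolding e_def i \<open>l = n\<close> by (simp only: prod_encode_0_less_Suc)
    qed
    then show ?thesis using gp0 by simp
  qed
  have xs0: "blinfun_apply (xs n) (x (p (e l))) = 0" if "l < n" for l n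
  proof -
    have "(\<Sum>\<^sub>\<infinity>i. (if block i = n then \<kappa> i else 0) * blinfun_apply (g i) (x (p (e l)))) = (\<Sum>\<^sub>\<infinity>i::nat. 0)"
      by (rule infsum_cong) (use g0 that in simp)
    then show ?thesis unfolding xs_def series_apply[OF le1] by simp
  qed
  have xsn: "norm (blinfun_apply (xs n) (x (p (e n)))) = min (v (e n)) c" for n
  proof -
    have "(\<Sum>\<^sub>\<infinity>i. (if block i = n then \<kappa> i else 0) * blinfun_apply (g i) (x (p (e n))))
      = (\<Sum>\<^sub>\<infinity>i\<in>{e n}. \<kappa> i * blinfun_apply (g i) (x (p (e n))))"
      by (rule infsum_cong_neutral) (use g0 in \<open>auto simp: block_def e_def\<close>)
    then have "norm (blinfun_apply (xs n) (x (p (e n)))) = norm (\<kappa> (e n)) * v (e n)"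
      unfolding xs_def series_apply[OF le1] by (simp add: norm_mult v_def)
    also have "norm (\<kappa> (e n)) = \<bar>min 1 (c / v (e n))\<bar>"
      unfolding \<kappa>_def by (simp only: e_def prod_encode_inverse snd_conv refl if_True norm_of_real)
    also have "\<dots> * v (e n) = min (v (e n)) c"
    proof (cases "v (e n) = 0")
      case False
      then have "0 < v (e n)" by (simp add: v_def)
      then show ?thesis using c by (auto simp: min_def field_simps)
    qed (use c in simp)
    finally show ?thesis .
  qed
  show ?thesis
  proof (intro exI[of _ xs] exI[of _ "p \<circ> e"] conjI allI ballI impI)
    show "xs n \<in> dual smul" for n unfolding xs_def by (rule series_dual[OF le1])
    show "strict_mono (p \<circ> e)" using p e by (rule strict_mono_o)
    show "blinfun_apply (xs n) (x ((p \<circ> e) l)) = 0" if "l < n" for l n using xs0[OF that] by simp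
    show "\<exists>f\<in>dual smul. weak_star_sums (\<lambda>n. scale_functional (\<alpha> n) (xs n)) f \<and> norm f = norm_linfty \<alpha>"
      if \<alpha>: "\<alpha> \<in> linfty" for \<alpha>
    proof (intro bexI conjI)
      show "weak_star_sums (\<lambda>n. scale_functional (\<alpha> n) (xs n)) (series (\<lambda>i. \<alpha> (block i) * \<kappa> i))"
        unfolding xs_def by (rule weak_star_sums_block_series[where \<kappa>=\<kappa> and \<alpha>=\<alpha>, OF \<alpha> \<kappa>])
      show "norm (series (\<lambda>i. \<alpha> (block i) * \<kappa> i)) = norm_linfty \<alpha>"
        by (rule norm_block_series[where \<kappa>=\<kappa> and \<alpha>=\<alpha>, OF g(3) \<alpha> \<kappa> \<kappa>1])
      have "norm (\<alpha> (block i) * \<kappa> i) \<le> norm_linfty \<alpha> * 1" for i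
        unfolding norm_mult using \<kappa> norm_linfty_ge[OF \<alpha>] order_trans[OF norm_ge_zero norm_linfty_ge[OF \<alpha>]]
        by (intro mult_mono) auto
      then show "series (\<lambda>i. \<alpha> (block i) * \<kappa> i) \<in> dual smul" by (rule series_dual)
    qed
    have "lo \<longlonglongrightarrow> 1 * (c * 1) - 0"
      unfolding lo_def by (intro tendsto_diff tendsto_mult tendsto_const level(4)) real_asymp
    then have "(\<lambda>n. lo (e n)) \<longlonglongrightarrow> c"
      using filterlim_compose[OF _ filterlim_subseq[OF e]] by simp
    then have lim: "(\<lambda>n. min (lo (e n)) c) \<longlonglongrightarrow> min c c" by (intro tendsto_min tendsto_const)
    have "(\<lambda>n. min (v (e n)) c) \<longlonglongrightarrow> c"
    proof (rule tendsto_sandwich[OF always_eventually always_eventually _ tendsto_const])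
      show "\<forall>n. min (lo (e n)) c \<le> min (v (e n)) c"
      proof
        fix n
        have "lo (e n) \<le> v (e n)" using gp by (simp add: v_def)
        then show "min (lo (e n)) c \<le> min (v (e n)) c" by (intro min.mono order_refl)
      qed
      show "(\<lambda>n. min (lo (e n)) c) \<longlonglongrightarrow> c" using lim by simp
    qed simp
    then show "(\<lambda>n. norm (blinfun_apply (xs n) (x ((p \<circ> e) n)))) \<longlonglongrightarrow> james_const_sup smul x"
      by (simp add: xsn c_def)
  qed
qed

end

section \<open>The theorem\<close>

theorem theorem1:
  fixes smul :: "'k::real_or_complex_field \<Rightarrow> 'a::banach \<Rightarrow> 'a"
  assumes "banach_space_over smul"
    and "L_embedded smul"
  shows "(\<forall>x :: nat \<Rightarrow> 'a. equiv_l1_basis smul x \<longrightarrow>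
           (\<exists>(xs :: nat \<Rightarrow> 'a \<Rightarrow>\<^sub>L 'k) (p :: nat \<Rightarrow> nat).
              (\<forall>n. xs n \<in> dual smul) \<and>
              (\<forall>\<alpha>\<in>linfty. \<exists>f\<in>dual smul.
                 weak_star_sums (\<lambda>n. scale_functional (\<alpha> n) (xs n)) f \<and>
                 norm f = norm_linfty \<alpha>) \<and>
              strict_mono p \<and>
              (\<lambda>n. norm (blinfun_apply (xs n) (x (p n)))) \<longlonglongrightarrow> james_const_sup smul x \<and>
              (\<forall>l n. l < n \<longrightarrow> blinfun_apply (xs n) (x (p l)) = 0)))
       \<and> (\<not> reflexive_space smul \<longrightarrow> dual_contains_isometric_linfty smul)"
  proof -
  interpret banach_space_over smul by fact
  obtain P where P: "L_projection (bidual smul) scale_bidual (norm_bidual smul) P"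
    "P ` bidual smul = range (canonical_embedding smul)"
    using assms(2) unfolding L_embedded_def by (elim exE conjE) (rule that)
  interpret L_embedded_space smul P by unfold_locales (rule P)+
  show ?thesis
  proof (intro conjI allI impI)
    fix x :: "nat \<Rightarrow> 'a" assume "equiv_l1_basis smul x"
    then show "\<exists>(xs :: nat \<Rightarrow> 'a \<Rightarrow>\<^sub>L 'k) (p :: nat \<Rightarrow> nat).
              (\<forall>n. xs n \<in> dual smul) \<and>
              (\<forall>\<alpha>\<in>linfty. \<exists>f\<in>dual smul.
                 weak_star_sums (\<lambda>n. scale_functional (\<alpha> n) (xs n)) f \<and>
                 norm f = norm_linfty \<alpha>) \<and>
              strict_mono p \<and>
              (\<lambda>n. norm (blinfun_apply (xs n) (x (p n)))) \<longlonglongrightarrow> james_const_sup smul x \<and>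
              (\<forall>l n. l < n \<longrightarrow> blinfun_apply (xs n) (x (p l)) = 0)"
      by (rule linfty_family_along_l1_basis)
  next
    assume "\<not> reflexive_space smul"
    then have "range (canonical_embedding smul) \<noteq> bidual smul" by (simp only: reflexive_space_def not_False_eq_True)
    moreover have "range (canonical_embedding smul) \<subseteq> bidual smul"
      by (rule image_subsetI) (rule canonical_bidual)
    ultimately have "\<exists>F. F \<in> bidual smul \<and> F \<notin> range (canonical_embedding smul)"
      by (metis subset_antisym subset_iff)
    then obtain F where F: "F \<in> bidual smul" "F \<notin> range (canonical_embedding smul)"
      by (elim exE conjE) (rule that)
    show "dual_contains_isometric_linfty smul"
    proof (rule dual_contains_linfty_of_singular)
      show "F - P F \<in> bidual smul" by (intro bidual_diff F P_bidual)
      show "P (F - P F) = 0" by (simp add: P_diff F P_bidual P_idem)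
      show "F - P F \<noteq> 0"
      proof
        assume "F - P F = 0"
        then have eq: "F = P F" unfolding right_minus_eq .
        obtain x where "P F = canonical_embedding smul x" using P_in_range[OF F(1)] by (rule exE)
        with eq have "F = canonical_embedding smul x" by (rule trans)
        then have "F \<in> range (canonical_embedding smul)" by (rule range_eqI)
        with F(2) show False by (rule notE)
      qed
    qed
  qed
qed

end
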